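(* For every integer $n\ge 1$ and every continuous function $\psi:[-1,1]\to\mathbb{R}$ there exists a function $v\mapsto\delta(\psi,n,v)$ with $\delta(\psi,n,v)\to 0$ as $v\to\infty$, not depending on $N$ or $\nu$ (nor on $f$), such that for every integer $N\ge 1$, every probability measure $\nu$ on the unit sphere $S\subset\mathbb{R}^N$, every measurable function $f:S^n\to\mathbb{R}$ with $|f|\le 1$, and every value $v$ of the parameter in the definition of the random function $g$ given in the context, $$\mathbb{E}_x\Bigl|\,\mathbb{E}_g\bigl\langle f\,\psi(z^1\cdot z^{n+1})\bigr\rangle-\frac1n\,\mathbb{E}_g\langle f\rangle\,\mathbb{E}_g\bigl\langle\psi(z^1\cdot z^2)\bigr\rangle-\frac1n\sum_{2\le l\le n}\mathbb{E}_g\bigl\langle f\,\psi(z^1\cdot z^l)\bigr\rangle\Bigr|\le\delta(\psi,n,v),$$ where $f=f(z^1,\ldots,z^n)$.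
   Context: Let $S=\{z\in\mathbb{R}^N:|z|=1\}$ be the Euclidean unit sphere and $z^1\cdot z^2$ the usual scalar product. For a (Borel) probability measure $\nu$ on $S$ and a measurable $g:S\to\mathbb{R}$ with $\int e^{g}\,d\nu<\infty$, the probability measure $\nu_g$ on $S$ is defined by the density $$\frac{d\nu_g}{d\nu}(z)=\frac{e^{g(z)}}{\int e^{g(z')}\,d\nu(z')}.$$ Here $g$ is the random function, depending on a parameter $v\ge 0$, $$g(z)=v\sum_{p\ge 1}2^{-p}x_p\,g_p(z),\qquad g_p(z)=\sum_{1\le i_1,\ldots,i_p\le N} g_{i_1,\ldots,i_p}\,z_{i_1}\cdots z_{i_p},$$ where $(x_p)_{p\ge 1}$ are i.i.d. uniform on $[0,1]$ and $g_{i_1,\ldots,i_p}$ (for all $p\ge 1$ and all $1\le i_1,\ldots,i_p\le N$) are i.i.d. standard Gaussian random variables, independent of $(x_p)_{p\ge1}$. It is assumed that the normalizing integral is finite, so that $\nu_g$ is well defined. The measure $\nu$ and the function $f$ are non-random. For a function $h$ of $m$ variables $(z^1,\ldots,z^m)\in S^m$, $\langle h\rangle$ denotes its average with respect to the product measure $\nu_g^{\otimes m}$. $\mathbb{E}_g$ denotes expectation with respect to the Gaussian random variables only (with $(x_p)$ fixed), and $\mathbb{E}_x$ denotes expectation with respect to the uniform random variables $(x_p)$. *)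

theory Defs
  imports "HOL-Probability.Probability"
begin

text \<open>
  The dimension \<open>N\<close> is quantified inside the theorem, so it cannot be a type parameter. A point of
  \<open>\<real>\<^sup>N\<close> is an extensional function on \<open>{1..N}\<close>; the finite product of Borel spaces below carries the
  Borel sigma-algebra of \<open>\<real>\<^sup>N\<close>.
\<close>

definition unit_sphere :: "nat \<Rightarrow> (nat \<Rightarrow> real) set" where
  "unit_sphere N = {z \<in> {1..N} \<rightarrow>\<^sub>E UNIV. L2_set z {1..N} = 1}"

definition sphere_borel :: "nat \<Rightarrow> (nat \<Rightarrow> real) measure" where
  "sphere_borel N = restrict_space (\<Pi>\<^sub>M i\<in>{1..N}. borel) (unit_sphere N)"

definition dot :: "nat \<Rightarrow> (nat \<Rightarrow> real) \<Rightarrow> (nat \<Rightarrow> real) \<Rightarrow> real" where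
  "dot N z w = (\<Sum>i=1..N. z i * w i)"

text \<open>
  The random variables are realised as coordinates: \<open>x p\<close> under \<open>uniform_law\<close>, and \<open>\<gamma> is\<close> under
  \<open>gauss_law N\<close>, where the list \<open>is = [i\<^sub>1, \<dots>, i\<^sub>p]\<close> is the multi-index. The two families are
  independent of each other, so expectation over the Gaussian variables with \<open>x\<close> fixed is
  integration over \<open>gauss_law N\<close>.
\<close>

definition uniform_law :: "(nat \<Rightarrow> real) measure" where
  "uniform_law = (\<Pi>\<^sub>M p\<in>{1..}. uniform_measure lborel {0..1})"

definition multi_indices :: "nat \<Rightarrow> nat \<Rightarrow> nat list set" where
  "multi_indices N p = {is. length is = p \<and> set is \<subseteq> {1..N}}"

definition gauss_law :: "nat \<Rightarrow> (nat list \<Rightarrow> real) measure" where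
  "gauss_law N = (\<Pi>\<^sub>M is\<in>(\<Union>p\<in>{1..}. multi_indices N p). density lborel std_normal_density)"

definition gp :: "nat \<Rightarrow> (nat list \<Rightarrow> real) \<Rightarrow> nat \<Rightarrow> (nat \<Rightarrow> real) \<Rightarrow> real" where
  "gp N \<gamma> p z = (\<Sum>is\<in>multi_indices N p. \<gamma> is * (\<Prod>i\<leftarrow>is. z i))"

text \<open>The sum over \<open>p \<ge> 1\<close> is shifted to start at \<open>0\<close>.\<close>

definition gfun ::
  "nat \<Rightarrow> real \<Rightarrow> (nat \<Rightarrow> real) \<Rightarrow> (nat list \<Rightarrow> real) \<Rightarrow> (nat \<Rightarrow> real) \<Rightarrow> real" where
  "gfun N v x \<gamma> z = v * (\<Sum>p. (1/2) ^ Suc p * x (Suc p) * gp N \<gamma> (Suc p) z)"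

text \<open>
  If \<open>exp \<circ> g\<close> is not integrable, the normalising integral below evaluates to \<open>0\<close> and \<open>tilt \<nu> g\<close> is
  the zero measure.
\<close>

definition tilt :: "'a measure \<Rightarrow> ('a \<Rightarrow> real) \<Rightarrow> 'a measure" where
  "tilt \<nu> g = density \<nu> (\<lambda>z. ennreal (exp (g z) / (\<integral>z'. exp (g z') \<partial>\<nu>)))"

text \<open>The average of a function of \<open>m\<close> variables; \<open>z l\<close> is the \<open>l\<close>-th variable, \<open>1 \<le> l \<le> m\<close>.\<close>

definition avg :: "'a measure \<Rightarrow> ('a \<Rightarrow> real) \<Rightarrow> nat \<Rightarrow> ((nat \<Rightarrow> 'a) \<Rightarrow> real) \<Rightarrow> real" where
  "avg \<nu> g m h = (\<integral>z. h z \<partial>(\<Pi>\<^sub>M l\<in>{1..m}. tilt \<nu> g))"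

definition E_avg :: "nat \<Rightarrow> real \<Rightarrow> (nat \<Rightarrow> real) measure \<Rightarrow> (nat \<Rightarrow> real) \<Rightarrow> nat \<Rightarrow>
    ((nat \<Rightarrow> nat \<Rightarrow> real) \<Rightarrow> real) \<Rightarrow> real" where
  "E_avg N v \<nu> x m h = (\<integral>\<gamma>. avg \<nu> (gfun N v x \<gamma>) m h \<partial>gauss_law N)"

end

theory Submission
  imports Defs
begin

text \<open>
  Write \<open>\<langle>h\<rangle>\<close> for the average under the Gibbs measure \<open>\<nu>\<^sub>g\<close>, \<open>R\<^sub>k\<^sub>l\<close> for the overlap of the replicas \<open>z\<^sup>k\<close> and
  \<open>z\<^sup>l\<close>, and \<open>s = v / 2\<^sup>p\<close>, so that \<open>g = s x\<^sub>p g\<^sub>p + (the other degrees)\<close>. Since both sides of the identity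
  are linear and continuous in \<open>\<psi>\<close>, Stone-Weierstrass reduces it to \<open>\<psi> t = t\<^sup>p\<close>, and degree \<open>0\<close> is trivial.

  For \<open>p \<ge> 1\<close> the power \<open>R\<^sub>k\<^sub>l\<^sup>p\<close> is the covariance of \<open>g\<^sub>p(z\<^sup>k)\<close> and \<open>g\<^sub>p(z\<^sup>l)\<close>. Gaussian integration by
  parts (\<open>gibbs_integration_by_parts\<close>) therefore expresses \<open>E\<langle>f g\<^sub>p(z\<^sup>1)\<rangle>\<close> as \<open>s x\<^sub>p\<close> times
  \<open>E\<langle>f (1 + \<Sum>\<^sub>l R\<^sub>1\<^sub>l\<^sup>p - n R\<^sub>1\<^sub>,\<^sub>n\<^sub>+\<^sub>1\<^sup>p)\<rangle>\<close>, and the quantity to be estimated, multiplied by \<open>n s x\<^sub>p\<close>, becomes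
  \<open>E\<langle>f\<rangle> E\<langle>g\<^sub>p\<rangle> - E\<langle>f g\<^sub>p(z\<^sup>1)\<rangle>\<close>. Its modulus is at most \<open>E\<langle>|g\<^sub>p - c|\<rangle>\<close> with \<open>c = E\<langle>g\<^sub>p\<rangle>\<close>
  (\<open>gg_defect_power_le\<close>), in which \<open>f\<close> has disappeared. It remains to see that \<open>g\<^sub>p\<close> concentrates at a
  scale smaller than \<open>s\<close>, on average over \<open>x\<^sub>p\<close>.

  Let \<open>\<phi>(x\<^sub>p)\<close> be the logarithm of the normalizing integral, and \<open>\<Phi> = E \<phi>\<close>. Averages of
  \<open>exp (\<plusminus> s y (g\<^sub>p - c))\<close> are, up to explicit factors, exponentials of increments of \<open>\<phi>\<close> between \<open>x\<^sub>p\<close>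
  and \<open>x\<^sub>p \<plusminus> y\<close>. An elementary inequality for \<open>|u|\<close> then bounds \<open>s y E\<langle>|g\<^sub>p - c|\<rangle>\<close> by a constant, plus
  the fluctuations \<open>E|\<phi> - \<Phi>|\<close> at these three points, plus the second difference of \<open>\<Phi>\<close>
  (\<open>gp_dev_le\<close>). No derivative of \<open>\<phi>\<close> is involved, only its convexity in the form of Jensen's
  inequality (\<open>tilt_jensen\<close>).

  The fluctuations are \<open>O(v)\<close> (\<open>free_energy_concentration\<close>): the disorder is rotated into an
  independent copy in \<open>k\<close> small steps. By Jensen and the invariance of the Gaussian law, a step of
  angle \<open>\<theta>\<close> costs \<open>O(\<theta> v)\<close> plus a term quadratic in \<open>\<theta>\<close>, and the quadratic terms vanish as
  \<open>k\<close> tends to infinity. The integral over \<open>x\<^sub>p\<close> of the second difference is \<open>O(s\<^sup>2 y\<^sup>2)\<close>, because \<open>\<Phi>\<close> is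
  Lipschitz with constant \<open>O(s\<^sup>2)\<close>: its slope is \<open>s c\<close>, and \<open>c = O(s)\<close> by integration by parts.

  Altogether \<open>x\<^sub>p\<close> times the quantity to be estimated has integral \<open>O(1 / (v y) + y)\<close>, with a constant
  that depends on \<open>p\<close> only. Taking \<open>y = v powr (-1/2)\<close>, and bounding the part \<open>x\<^sub>p < v powr (-1/4)\<close>
  trivially to get rid of the factor \<open>x\<^sub>p\<close>, gives a rate \<open>O(v powr (-1/4))\<close> for each power, uniformly
  in \<open>N\<close>, \<open>\<nu>\<close> and \<open>f\<close>.
\<close>

section \<open>Products of laws and their symmetries\<close>

text \<open>
  The integrand depends on finitely many coordinates, so its integral is one over the finite
  subproduct, where Tonelli's theorem factorizes it.
\<close>

lemma nn_integral_PiM_prod: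
  assumes M: "prob_space M" and J: "finite J" "J \<subseteq> I"
    and f: "\<And>j. j \<in> J \<Longrightarrow> f j \<in> borel_measurable M"
  shows "(\<integral>\<^sup>+\<omega>. (\<Prod>j\<in>J. f j (\<omega> j)) \<partial>PiM I (\<lambda>_. M)) = (\<Prod>j\<in>J. \<integral>\<^sup>+x. f j x \<partial>M)"
proof -
  interpret product_prob_space "\<lambda>_. M" I
    by (simp add: M product_prob_space_def product_prob_space_axioms_def product_sigma_finite_def
        prob_space_imp_sigma_finite)
  have [measurable]: "(\<lambda>\<omega>. \<Prod>j\<in>J. f j (\<omega> j)) \<in> borel_measurable (PiM J (\<lambda>_. M))"
    using f by (intro borel_measurable_prod_ennreal) auto
  have "(\<integral>\<^sup>+\<omega>. (\<Prod>j\<in>J. f j (\<omega> j)) \<partial>PiM I (\<lambda>_. M))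
     = (\<integral>\<^sup>+\<omega>. (\<Prod>j\<in>J. f j (restrict \<omega> J j)) \<partial>PiM I (\<lambda>_. M))"
    by (intro nn_integral_cong prod.cong) auto
  also have "\<dots> = (\<integral>\<^sup>+\<omega>. (\<Prod>j\<in>J. f j (\<omega> j)) \<partial>distr (PiM I (\<lambda>_. M)) (PiM J (\<lambda>_. M)) (\<lambda>\<omega>. restrict \<omega> J))"
    by (subst nn_integral_distr) (use J in \<open>auto intro!: measurable_restrict_subset\<close>)
  also have "\<dots> = (\<Prod>j\<in>J. \<integral>\<^sup>+x. f j x \<partial>M)"
    using f J by (subst distr_PiM_restrict_finite) (auto intro!: product_nn_integral_prod)
  finally show ?thesis .
qed

text \<open>
  Two independent families, zipped index by index, form one independent family. A law on a product
  over an arbitrary index set is determined by its finite-dimensional cylinders, and the preimage of a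
  cylinder is integrated out one family at a time by the product formula above.
\<close>

lemma distr_pair_PiM_pointwise:
  assumes M: "prob_space M" and r [measurable]: "r \<in> M \<Otimes>\<^sub>M M \<rightarrow>\<^sub>M K"
  shows "distr (PiM I (\<lambda>_. M) \<Otimes>\<^sub>M PiM I (\<lambda>_. M)) (PiM I (\<lambda>_. K)) (\<lambda>(\<omega>, \<omega>'). \<lambda>i\<in>I. r (\<omega> i, \<omega>' i))
     = PiM I (\<lambda>_. distr (M \<Otimes>\<^sub>M M) K r)"
proof (rule measure_eqI_PiM_infinite[symmetric])
  let ?P = "PiM I (\<lambda>_. M)" and ?D = "distr (M \<Otimes>\<^sub>M M) K r"
  let ?r = "\<lambda>(\<omega>, \<omega>'). \<lambda>i\<in>I. r (\<omega> i, \<omega>' i)"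
  interpret M: prob_space M by fact
  interpret P: prob_space ?P by (intro prob_space_PiM M)
  interpret PP: pair_prob_space ?P ?P ..
  interpret MM: pair_prob_space M M ..
  have D: "prob_space ?D" by (rule MM.prob_space_distr) simp
  show "sets (PiM I (\<lambda>_. ?D)) = sets (PiM I (\<lambda>_. K))" by (intro sets_PiM_cong) auto
  show "sets (distr (?P \<Otimes>\<^sub>M ?P) (PiM I (\<lambda>_. K)) ?r) = sets (PiM I (\<lambda>_. K))" by simp
  interpret Q: prob_space "PiM I (\<lambda>_. ?D)" by (intro prob_space_PiM D)
  show "finite_measure (PiM I (\<lambda>_. ?D))" by unfold_locales
  have mr [measurable]: "?r \<in> ?P \<Otimes>\<^sub>M ?P \<rightarrow>\<^sub>M PiM I (\<lambda>_. K)"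
    by measurable
  fix A J assume J: "finite J" "J \<subseteq> I" and A: "\<And>i. i \<in> J \<Longrightarrow> A i \<in> sets K"
  have A2: "{x \<in> space (M \<Otimes>\<^sub>M M). r x \<in> A j} \<in> sets (M \<Otimes>\<^sub>M M)" if "j \<in> J" for j
    using A[OF that] by measurable
  let ?f = "\<lambda>j x. indicator {x \<in> space (M \<Otimes>\<^sub>M M). r x \<in> A j} x :: ennreal"
  let ?X = "prod_emb I (\<lambda>_. K) J (Pi\<^sub>E J A)"
  have X: "?X \<in> sets (PiM I (\<lambda>_. K))"
    using A J by (intro sets_PiM_I) auto
  have mf [measurable]: "?f j \<in> borel_measurable (M \<Otimes>\<^sub>M M)" if "j \<in> J" for j
    using A2[OF that] by simp
  have "emeasure (distr (?P \<Otimes>\<^sub>M ?P) (PiM I (\<lambda>_. K)) ?r) ?X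
      = (\<integral>\<^sup>+w. indicator ?X (?r w) \<partial>(?P \<Otimes>\<^sub>M ?P))"
    using X by (simp add: nn_integral_indicator[symmetric, of ?X "distr (?P \<Otimes>\<^sub>M ?P) (PiM I (\<lambda>_. K)) ?r"] nn_integral_distr del: nn_integral_indicator)
  also have "\<dots> = (\<integral>\<^sup>+w. (\<Prod>j\<in>J. ?f j (fst w j, snd w j)) \<partial>(?P \<Otimes>\<^sub>M ?P))"
  proof (rule nn_integral_cong)
    fix w assume w: "w \<in> space (?P \<Otimes>\<^sub>M ?P)"
    obtain a b where ab: "w = (a, b)" by force
    have sp: "(a i, b i) \<in> space (M \<Otimes>\<^sub>M M)" if "i \<in> I" for i
      using w that by (auto simp: ab space_pair_measure space_PiM)
    have sk: "r (a i, b i) \<in> space K" if "i \<in> I" for i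
      using sp[OF that] measurable_space[OF r] by blast
    have "?r w \<in> ?X \<longleftrightarrow> (\<forall>j\<in>J. r (a j, b j) \<in> A j)"
      using J sk by (auto simp: prod_emb_def ab PiE_iff subset_eq)
    moreover have "(\<Prod>j\<in>J. ?f j (a j, b j)) = (if \<forall>j\<in>J. r (a j, b j) \<in> A j then 1 else 0)"
      using J sp by (auto simp: subset_eq prod_zero_iff intro!: bexI)
    ultimately show "indicator ?X (?r w) = (\<Prod>j\<in>J. ?f j (fst w j, snd w j))"
      by (simp add: ab indicator_def)
  qed
  also have "\<dots> = (\<integral>\<^sup>+a. (\<integral>\<^sup>+b. (\<Prod>j\<in>J. ?f j (a j, b j)) \<partial>?P) \<partial>?P)"
  proof (subst P.nn_integral_fst[symmetric])
    have "(\<lambda>w. ?f j (fst w j, snd w j)) \<in> borel_measurable (?P \<Otimes>\<^sub>M ?P)" if "j \<in> J" for j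
    proof -
      have "(\<lambda>w. (fst w j, snd w j)) \<in> ?P \<Otimes>\<^sub>M ?P \<rightarrow>\<^sub>M M \<Otimes>\<^sub>M M"
        using that J by (auto intro!: measurable_Pair measurable_compose[OF measurable_fst] measurable_compose[OF measurable_snd] measurable_component_singleton)
      from measurable_compose[OF this mf[OF that]] show ?thesis .
    qed
    then show "(\<lambda>w. \<Prod>j\<in>J. ?f j (fst w j, snd w j)) \<in> borel_measurable (?P \<Otimes>\<^sub>M ?P)"
      by (intro borel_measurable_prod_ennreal) auto
  qed auto
  also have "\<dots> = (\<integral>\<^sup>+a. (\<Prod>j\<in>J. \<integral>\<^sup>+y. ?f j (a j, y) \<partial>M) \<partial>?P)"
  proof (rule nn_integral_cong)
    fix a assume a: "a \<in> space ?P"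
    show "(\<integral>\<^sup>+b. (\<Prod>j\<in>J. ?f j (a j, b j)) \<partial>?P) = (\<Prod>j\<in>J. \<integral>\<^sup>+y. ?f j (a j, y) \<partial>M)"
    proof (rule nn_integral_PiM_prod[OF M J, of "\<lambda>j y. ?f j (a j, y)"])
      fix j assume j: "j \<in> J"
      then have "a j \<in> space M" using a J by (auto simp: space_PiM)
      from measurable_compose[OF measurable_Pair1'[OF this] mf[OF j]]
      show "(\<lambda>y. ?f j (a j, y)) \<in> borel_measurable M" by simp
    qed
  qed
  also have "\<dots> = (\<Prod>j\<in>J. \<integral>\<^sup>+x. \<integral>\<^sup>+y. ?f j (x, y) \<partial>M \<partial>M)"
    by (rule nn_integral_PiM_prod[OF M J, of "\<lambda>j x. \<integral>\<^sup>+y. ?f j (x, y) \<partial>M"])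
       (use mf in \<open>auto intro!: M.borel_measurable_nn_integral_fst\<close>)
  also have "\<dots> = (\<Prod>j\<in>J. emeasure ?D (A j))"
  proof (rule prod.cong[OF refl])
    fix j assume j: "j \<in> J"
    have "emeasure ?D (A j) = emeasure (M \<Otimes>\<^sub>M M) {x \<in> space (M \<Otimes>\<^sub>M M). r x \<in> A j}"
      using A[OF j] by (subst emeasure_distr) (auto intro!: arg_cong[where f="emeasure _"])
    also have "\<dots> = (\<integral>\<^sup>+x. ?f j x \<partial>(M \<Otimes>\<^sub>M M))"
      using A2[OF j] by simp
    also have "\<dots> = (\<integral>\<^sup>+x. \<integral>\<^sup>+y. ?f j (x, y) \<partial>M \<partial>M)"
      by (subst M.nn_integral_fst[symmetric]) (use mf[OF j] in auto)
    finally show "(\<integral>\<^sup>+x. \<integral>\<^sup>+y. ?f j (x, y) \<partial>M \<partial>M) = emeasure ?D (A j)" by simp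
  qed
  also have "\<dots> = emeasure (PiM I (\<lambda>_. ?D)) (prod_emb I (\<lambda>_. ?D) J (Pi\<^sub>E J A))"
    using A J by (intro emeasure_PiM_emb[symmetric] D) auto
  also have "prod_emb I (\<lambda>_. ?D) J (Pi\<^sub>E J A) = ?X"
    by (simp add: prod_emb_def)
  finally show "emeasure (PiM I (\<lambda>_. ?D)) ?X = emeasure (distr (?P \<Otimes>\<^sub>M ?P) (PiM I (\<lambda>_. K)) ?r) ?X"
    by (rule sym)
qed

text \<open>
  A symmetry \<open>r\<close> of \<open>M \<Otimes>\<^sub>M M\<close>, applied in every coordinate, is a symmetry of a pair of independent
  families. Zipping with or without \<open>r\<close> produces the same law of pairs, and unzipping recovers the
  two families.
\<close>

lemma distr_pair_PiM_of_pair: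
  assumes M: "prob_space M" and r [measurable]: "r \<in> M \<Otimes>\<^sub>M M \<rightarrow>\<^sub>M M \<Otimes>\<^sub>M M"
    and inv: "distr (M \<Otimes>\<^sub>M M) (M \<Otimes>\<^sub>M M) r = M \<Otimes>\<^sub>M M"
  shows "distr (PiM I (\<lambda>_. M) \<Otimes>\<^sub>M PiM I (\<lambda>_. M)) (PiM I (\<lambda>_. M) \<Otimes>\<^sub>M PiM I (\<lambda>_. M))
      (\<lambda>(\<omega>, \<omega>'). (\<lambda>i\<in>I. fst (r (\<omega> i, \<omega>' i)), \<lambda>i\<in>I. snd (r (\<omega> i, \<omega>' i))))
    = PiM I (\<lambda>_. M) \<Otimes>\<^sub>M PiM I (\<lambda>_. M)" (is "distr ?PP _ ?R = _")
proof -
  let ?Q = "PiM I (\<lambda>_. M \<Otimes>\<^sub>M M)"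
  let ?zip = "\<lambda>r (\<omega>, \<omega>'). \<lambda>i\<in>I. r (\<omega> i, \<omega>' i)"
  let ?U = "\<lambda>w. (\<lambda>i\<in>I. fst (w i), \<lambda>i\<in>I. snd (w i))"
  have U [measurable]: "?U \<in> ?Q \<rightarrow>\<^sub>M ?PP"
    by (intro measurable_Pair measurable_restrict) measurable
  have z [measurable]: "?zip r \<in> ?PP \<rightarrow>\<^sub>M ?Q" "?zip (\<lambda>x. x) \<in> ?PP \<rightarrow>\<^sub>M ?Q"
    by measurable
  \<comment> \<open>Unzip after zipping with \<open>r\<close>; then exchange the law of the zipped family for the one without \<open>r\<close>.\<close>
  have "distr ?PP ?PP ?R = distr (distr ?PP ?Q (?zip r)) ?PP ?U"
    by (subst distr_distr) (auto intro!: distr_cong cong: restrict_cong)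
  also have "distr ?PP ?Q (?zip r) = ?Q"
    by (subst distr_pair_PiM_pointwise[OF M r]) (simp add: inv)
  also have "\<dots> = distr ?PP ?Q (?zip (\<lambda>x. x))"
    by (subst distr_pair_PiM_pointwise[OF M]) (simp_all add: distr_id)
  also have "distr \<dots> ?PP ?U = distr ?PP ?PP (\<lambda>w. w)"
  proof (subst distr_distr)
    show "distr ?PP ?PP (?U \<circ> ?zip (\<lambda>x. x)) = distr ?PP ?PP (\<lambda>w. w)"
      by (rule distr_cong[OF refl refl])
         (auto simp: space_pair_measure space_PiM PiE_iff extensional_restrict cong: restrict_cong)
  qed auto
  finally show ?thesis by (simp only: distr_id)
qed

section \<open>The standard Gaussian law\<close>

lemma nn_integral_std_normal_exp:
  "(\<integral>\<^sup>+x. ennreal (exp (a * x)) \<partial>std_normal_distribution) = ennreal (exp (a\<^sup>2 / 2))"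
proof -
  have "(\<integral>\<^sup>+x. ennreal (exp (a * x)) \<partial>std_normal_distribution) = (\<integral>\<^sup>+x. ennreal (std_normal_density x) * ennreal (exp (a * x)) \<partial>lborel)"
    by (subst nn_integral_density) auto
  also have "\<dots> = (\<integral>\<^sup>+x. ennreal (exp (a\<^sup>2 / 2)) * ennreal (normal_density a 1 x) \<partial>lborel)"
  proof (rule nn_integral_cong)
    fix x :: real
    have "- x\<^sup>2 / 2 + a * x = a\<^sup>2 / 2 + - (x - a)\<^sup>2 / 2"
      by (simp add: power2_eq_square field_simps)
    then have "exp (- x\<^sup>2 / 2) * exp (a * x) = exp (a\<^sup>2 / 2) * exp (- (x - a)\<^sup>2 / 2)"
      by (simp only: exp_add[symmetric])
    then show "ennreal (std_normal_density x) * ennreal (exp (a * x)) = ennreal (exp (a\<^sup>2 / 2)) * ennreal (normal_density a 1 x)"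
      by (simp add: ennreal_mult[symmetric] normal_density_def mult_ac)
  qed
  also have "\<dots> = ennreal (exp (a\<^sup>2 / 2)) * (\<integral>\<^sup>+x. ennreal (normal_density a 1 x) \<partial>lborel)"
    by (subst nn_integral_cmult) auto
  also have "(\<integral>\<^sup>+x. ennreal (normal_density a 1 x) \<partial>lborel) = 1"
    by (subst nn_integral_eq_integral) (auto intro: integrable_normal_density)
  finally show ?thesis by simp
qed

lemma prob_space_std_normal: "prob_space std_normal_distribution"
  using prob_space_normal_density[of 1 0] by simp

lemma nn_integral_gauss_field_exp:
  assumes J: "finite J" "J \<subseteq> I"
  shows "(\<integral>\<^sup>+\<gamma>. ennreal (exp (\<Sum>i\<in>J. a i * \<gamma> i)) \<partial>PiM I (\<lambda>_. std_normal_distribution)) = ennreal (exp ((\<Sum>i\<in>J. (a i)\<^sup>2) / 2))"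
proof -
  have "(\<integral>\<^sup>+\<gamma>. ennreal (exp (\<Sum>i\<in>J. a i * \<gamma> i)) \<partial>PiM I (\<lambda>_. std_normal_distribution))
     = (\<integral>\<^sup>+\<gamma>. (\<Prod>i\<in>J. ennreal (exp (a i * \<gamma> i))) \<partial>PiM I (\<lambda>_. std_normal_distribution))"
    by (simp add: exp_sum J prod_ennreal)
  also have "\<dots> = (\<Prod>i\<in>J. ennreal (exp ((a i)\<^sup>2 / 2)))"
    by (subst nn_integral_PiM_prod[OF prob_space_std_normal J, of "\<lambda>i x. ennreal (exp (a i * x))"])
       (auto simp: nn_integral_std_normal_exp)
  also have "\<dots> = ennreal (exp ((\<Sum>i\<in>J. (a i)\<^sup>2) / 2))"
    by (simp add: prod_ennreal exp_sum J sum_divide_distrib)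
  finally show ?thesis .
qed

text \<open>
  For \<open>c > 0\<close> a rotation of the plane is two affine substitutions in one variable: the first
  coordinate is replaced with the second one fixed, then, after exchanging the integrals, the second
  one is replaced. The Jacobians \<open>1 / c\<close> and \<open>c\<close> cancel, and the density is radial.
\<close>

lemma std_normal_rotation:
  assumes cs: "c\<^sup>2 + s\<^sup>2 = 1" "c > 0"
  shows "distr (std_normal_distribution \<Otimes>\<^sub>M std_normal_distribution) (std_normal_distribution \<Otimes>\<^sub>M std_normal_distribution) (\<lambda>(x, y). (c * x + s * y, c * y - s * x)) = std_normal_distribution \<Otimes>\<^sub>M std_normal_distribution"
proof (rule measure_eqI)
  let ?R = "\<lambda>(x, y). (c * x + s * y, c * y - s * x)"
  show "sets (distr (std_normal_distribution \<Otimes>\<^sub>M std_normal_distribution) (std_normal_distribution \<Otimes>\<^sub>M std_normal_distribution) ?R) = sets (std_normal_distribution \<Otimes>\<^sub>M std_normal_distribution)" by simp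
  fix A assume "A \<in> sets (distr (std_normal_distribution \<Otimes>\<^sub>M std_normal_distribution) (std_normal_distribution \<Otimes>\<^sub>M std_normal_distribution) ?R)"
  then have A: "A \<in> sets (std_normal_distribution \<Otimes>\<^sub>M std_normal_distribution)" by simp
  then have A' [measurable]: "A \<in> sets (borel \<Otimes>\<^sub>M borel)"
    by (simp cong: sets_pair_measure_cong)
  interpret G: prob_space std_normal_distribution by (rule prob_space_std_normal)
  let ?d = "\<lambda>x y. ennreal (std_normal_density x) * ennreal (std_normal_density y)"
  have gg: "(\<integral>\<^sup>+w. f w \<partial>(std_normal_distribution \<Otimes>\<^sub>M std_normal_distribution)) = (\<integral>\<^sup>+y. \<integral>\<^sup>+x. ?d x y * f (x, y) \<partial>lborel \<partial>lborel)"
    if [measurable]: "f \<in> borel_measurable (borel \<Otimes>\<^sub>M borel)" for f :: "real \<times> real \<Rightarrow> ennreal"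
  proof -
    interpret GG: pair_sigma_finite std_normal_distribution std_normal_distribution ..
    have "(\<integral>\<^sup>+w. f w \<partial>(std_normal_distribution \<Otimes>\<^sub>M std_normal_distribution)) = (\<integral>\<^sup>+y. \<integral>\<^sup>+x. f (x, y) \<partial>std_normal_distribution \<partial>std_normal_distribution)"
      by (subst GG.nn_integral_snd[symmetric]) (auto cong: measurable_cong_sets)
    also have "\<dots> = (\<integral>\<^sup>+y. ennreal (std_normal_density y) * (\<integral>\<^sup>+x. ennreal (std_normal_density x) * f (x, y) \<partial>lborel) \<partial>lborel)"
      by (simp add: nn_integral_density)
    also have "\<dots> = (\<integral>\<^sup>+y. \<integral>\<^sup>+x. ?d x y * f (x, y) \<partial>lborel \<partial>lborel)"
      by (subst nn_integral_cmult[symmetric]) (auto simp: mult_ac)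
    finally show ?thesis .
  qed
  have iA [measurable]: "indicator A \<in> borel_measurable (borel \<Otimes>\<^sub>M borel)" by measurable
  have c0: "c \<noteq> 0" using cs by simp
  have "emeasure (distr (std_normal_distribution \<Otimes>\<^sub>M std_normal_distribution) (std_normal_distribution \<Otimes>\<^sub>M std_normal_distribution) ?R) A
     = (\<integral>\<^sup>+w. indicator A (?R w) \<partial>(std_normal_distribution \<Otimes>\<^sub>M std_normal_distribution))"
    using A by (subst nn_integral_indicator[symmetric], simp, subst nn_integral_distr) (auto cong: measurable_cong_sets)
  also have "\<dots> = (\<integral>\<^sup>+y. \<integral>\<^sup>+x. ?d x y * indicator A (c * x + s * y, c * y - s * x) \<partial>lborel \<partial>lborel)"
    by (subst gg) (auto simp: split_beta')
  also have "\<dots> = (\<integral>\<^sup>+y. \<integral>\<^sup>+x. ennreal (1/c) * (?d ((x - s * y) / c) y * indicator A (x, y / c - s * x / c)) \<partial>lborel \<partial>lborel)"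
  proof (rule nn_integral_cong)
    fix y :: real
    have e: "- (s * y) / c + 1 / c * x = (x - s * y) / c" "c * ((x - s * y) / c) + s * y = x"
      "c * y - s * ((x - s * y) / c) = y / c - s * x / c" for x
    proof -
      show "c * ((x - s * y) / c) + s * y = x" using c0 by (simp add: field_simps)
      have "c * y - s * ((x - s * y) / c) = ((c\<^sup>2 + s\<^sup>2) * y - s * x) / c"
        using c0 by (simp add: field_simps power2_eq_square)
      then show "c * y - s * ((x - s * y) / c) = y / c - s * x / c"
        using cs by (simp add: diff_divide_distrib)
      show "- (s * y) / c + 1 / c * x = (x - s * y) / c" by (simp add: diff_divide_distrib)
    qed
    have "(\<integral>\<^sup>+x. ?d x y * indicator A (c * x + s * y, c * y - s * x) \<partial>lborel)
       = ennreal (1/c) * (\<integral>\<^sup>+x. ?d ((x - s * y) / c) y * indicator A (x, y / c - s * x / c) \<partial>lborel)"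
      using cs by (subst nn_integral_real_affine[where c="1/c" and t="- (s * y) / c"]) (auto simp only: e abs_of_pos zero_less_divide_iff divide_eq_0_iff, auto simp: abs_of_pos)
    then show "(\<integral>\<^sup>+x. ?d x y * indicator A (c * x + s * y, c * y - s * x) \<partial>lborel)
       = (\<integral>\<^sup>+x. ennreal (1/c) * (?d ((x - s * y) / c) y * indicator A (x, y / c - s * x / c)) \<partial>lborel)"
      by (subst nn_integral_cmult) auto
  qed
  also have "\<dots> = (\<integral>\<^sup>+x. \<integral>\<^sup>+y. ennreal (1/c) * (?d ((x - s * y) / c) y * indicator A (x, y / c - s * x / c)) \<partial>lborel \<partial>lborel)"
  proof (rule lborel_pair.Fubini')
    show "(\<lambda>(x, y). ennreal (1/c) * (?d ((x - s * y) / c) y * indicator A (x, y / c - s * x / c))) \<in> borel_measurable (lborel \<Otimes>\<^sub>M lborel)"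
      by measurable
  qed
  also have "\<dots> = (\<integral>\<^sup>+x. \<integral>\<^sup>+y. ?d x y * indicator A (x, y) \<partial>lborel \<partial>lborel)"
  proof (rule nn_integral_cong)
    fix x :: real
    have e: "(x - s * (s * x + c * y)) / c = c * x - s * y" "(s * x + c * y) / c - s * x / c = y" for y
    proof -
      have "x - s * (s * x + c * y) = (1 - s\<^sup>2) * x - s * c * y" by (simp add: algebra_simps power2_eq_square)
      also have "1 - s\<^sup>2 = c\<^sup>2" using cs by simp
      finally show "(x - s * (s * x + c * y)) / c = c * x - s * y"
        using c0 by (simp add: field_simps power2_eq_square)
      show "(s * x + c * y) / c - s * x / c = y" using c0 by (simp add: field_simps)
    qed
    have d: "?d (c * x - s * y) (s * x + c * y) = ?d x y" for y
    proof -
      have "(c * x - s * y)\<^sup>2 + (s * x + c * y)\<^sup>2 = (c\<^sup>2 + s\<^sup>2) * (x\<^sup>2 + y\<^sup>2)"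
        by (simp add: algebra_simps power2_eq_square)
      then have "- (c * x - s * y)\<^sup>2 / 2 + - (s * x + c * y)\<^sup>2 / 2 = - x\<^sup>2 / 2 + - y\<^sup>2 / 2"
        using cs by (simp add: field_simps)
      then have "exp (- (c * x - s * y)\<^sup>2 / 2) * exp (- (s * x + c * y)\<^sup>2 / 2) = exp (- x\<^sup>2 / 2) * exp (- y\<^sup>2 / 2)"
        by (simp only: exp_add[symmetric])
      then show ?thesis by (simp add: ennreal_mult[symmetric] std_normal_density_def)
    qed
    have "(\<integral>\<^sup>+y. ennreal (1/c) * (?d ((x - s * y) / c) y * indicator A (x, y / c - s * x / c)) \<partial>lborel)
      = ennreal c * (\<integral>\<^sup>+y. ennreal (1/c) * (?d x y * indicator A (x, y)) \<partial>lborel)"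
      using cs by (subst nn_integral_real_affine[where c=c and t="s * x"]) (auto simp only: e d abs_of_pos, auto)
    also have "\<dots> = (\<integral>\<^sup>+y. ?d x y * indicator A (x, y) \<partial>lborel)"
      using cs by (subst nn_integral_cmult) (auto simp: mult.assoc[symmetric] ennreal_mult[symmetric])
    finally show "(\<integral>\<^sup>+y. ennreal (1/c) * (?d ((x - s * y) / c) y * indicator A (x, y / c - s * x / c)) \<partial>lborel)
      = (\<integral>\<^sup>+y. ?d x y * indicator A (x, y) \<partial>lborel)" .
  qed
  also have "\<dots> = (\<integral>\<^sup>+y. \<integral>\<^sup>+x. ?d x y * indicator A (x, y) \<partial>lborel \<partial>lborel)"
  proof (rule lborel_pair.Fubini'[symmetric])
    show "(\<lambda>(x, y). ?d x y * indicator A (x, y)) \<in> borel_measurable (lborel \<Otimes>\<^sub>M lborel)"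
      by measurable
  qed
  also have "\<dots> = emeasure (std_normal_distribution \<Otimes>\<^sub>M std_normal_distribution) A"
    using A by (subst gg[symmetric]) auto
  finally show "emeasure (distr (std_normal_distribution \<Otimes>\<^sub>M std_normal_distribution) (std_normal_distribution \<Otimes>\<^sub>M std_normal_distribution) ?R) A = emeasure (std_normal_distribution \<Otimes>\<^sub>M std_normal_distribution) A" .
qed

\<comment> \<open>Keeps the index sets \<open>{1..m}\<close> of the replicas in the form in which averages are defined.\<close>
declare One_nat_def [simp del]


section \<open>Exponential tilting\<close>

lemma tilt_normalizer_nonneg: "0 \<le> (\<integral>z. exp (g z) \<partial>\<nu>)" for g :: "'a \<Rightarrow> real"
  by simp

lemma sets_tilt [simp, measurable_cong]: "sets (tilt \<nu> g) = sets \<nu>"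
  by (simp add: tilt_def)

lemma space_tilt [simp]: "space (tilt \<nu> g) = space \<nu>"
  by (simp add: tilt_def)

lemma integral_exp_pos:
  fixes g :: "'a \<Rightarrow> real"
  assumes "prob_space \<nu>" and i: "integrable \<nu> (\<lambda>z. exp (g z))"
  shows "0 < (\<integral>z. exp (g z) \<partial>\<nu>)"
proof -
  interpret prob_space \<nu> by fact
  have "(\<integral>z. exp (g z) \<partial>\<nu>) \<noteq> 0"
    using integral_nonneg_eq_0_iff_AE[OF i] prob_space by (auto simp: AE_False)
  then show ?thesis using tilt_normalizer_nonneg[of \<nu> g] by linarith
qed

lemma integral_tilt:
  fixes h :: "'a \<Rightarrow> real"
  assumes [measurable]: "g \<in> borel_measurable \<nu>" "h \<in> borel_measurable \<nu>"
  shows "(\<integral>z. h z \<partial>tilt \<nu> g) = (\<integral>z. exp (g z) * h z \<partial>\<nu>) / (\<integral>z. exp (g z) \<partial>\<nu>)"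
proof -
  have "(\<integral>z. h z \<partial>tilt \<nu> g) = (\<integral>z. (exp (g z) / (\<integral>z. exp (g z) \<partial>\<nu>)) * h z \<partial>\<nu>)"
    unfolding tilt_def by (subst integral_density) auto
  also have "\<dots> = (\<integral>z. (exp (g z) * h z) / (\<integral>z. exp (g z) \<partial>\<nu>) \<partial>\<nu>)"
    by (simp add: mult_ac)
  finally show ?thesis by simp
qed

lemma integrable_tilt:
  fixes h :: "'a \<Rightarrow> real"
  assumes [measurable]: "g \<in> borel_measurable \<nu>" "h \<in> borel_measurable \<nu>"
    and i: "integrable \<nu> (\<lambda>z. exp (g z) * h z)"
  shows "integrable (tilt \<nu> g) h"
proof -
  have "integrable \<nu> (\<lambda>z. (exp (g z) * h z) / (\<integral>z. exp (g z) \<partial>\<nu>))"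
    using i by (rule integrable_divide)
  then show ?thesis
    unfolding tilt_def by (subst integrable_density) (auto simp: mult_ac)
qed

lemma prob_space_tilt:
  assumes "prob_space \<nu>" and i: "integrable \<nu> (\<lambda>z. exp (g z))"
  shows "prob_space (tilt \<nu> g)"
proof (rule prob_spaceI)
  let ?Z = "\<integral>z. exp (g z) \<partial>\<nu>"
  have [measurable]: "(\<lambda>z. exp (g z)) \<in> borel_measurable \<nu>" using i by simp
  have Z: "0 < ?Z" using assms by (rule integral_exp_pos)
  have "emeasure (tilt \<nu> g) (space (tilt \<nu> g)) = (\<integral>\<^sup>+z. ennreal (exp (g z) / ?Z) \<partial>\<nu>)"
    by (simp add: tilt_def emeasure_density cong: nn_integral_cong)
  also have "\<dots> = ennreal (\<integral>z. exp (g z) / ?Z \<partial>\<nu>)"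
    using i by (intro nn_integral_eq_integral) auto
  finally show "emeasure (tilt \<nu> g) (space (tilt \<nu> g)) = 1"
    using Z by simp
qed

lemma finite_measure_tilt:
  assumes "prob_space \<nu>" and g [measurable]: "g \<in> borel_measurable \<nu>"
  shows "finite_measure (tilt \<nu> g)"
proof (cases "integrable \<nu> (\<lambda>z. exp (g z))")
  case True
  with assms(1) interpret prob_space "tilt \<nu> g" by (rule prob_space_tilt)
  show ?thesis by unfold_locales
next
  case False
  show ?thesis
    by (rule finite_measureI) (simp add: tilt_def not_integrable_integral_eq[OF False] emeasure_density)
qed

lemma tilt_cong_AE:
  assumes [measurable]: "g \<in> borel_measurable \<nu>" "g' \<in> borel_measurable \<nu>" and eq: "AE z in \<nu>. g z = g' z"
  shows "tilt \<nu> g = tilt \<nu> g'"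
proof -
  have "(\<integral>z. exp (g z) \<partial>\<nu>) = (\<integral>z. exp (g' z) \<partial>\<nu>)"
    using eq by (intro integral_cong_AE) auto
  then show ?thesis
    unfolding tilt_def using eq by (intro density_cong) auto
qed

lemma tilt_tilt:
  assumes "prob_space \<nu>" and [measurable]: "g \<in> borel_measurable \<nu>" "h \<in> borel_measurable \<nu>"
    and i: "integrable \<nu> (\<lambda>z. exp (g z))"
  shows "tilt (tilt \<nu> g) h = tilt \<nu> (\<lambda>z. g z + h z)"
proof -
  let ?Z = "\<integral>z. exp (g z) \<partial>\<nu>"
  have Z: "0 < ?Z" by (rule integral_exp_pos) fact+
  have eq: "(\<integral>z. exp (h z) \<partial>tilt \<nu> g) = (\<integral>z. exp (g z + h z) \<partial>\<nu>) / ?Z"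
    by (subst integral_tilt) (auto simp: exp_add)
  have "ennreal (exp (g z) / ?Z) * ennreal (exp (h z) / (\<integral>z. exp (h z) \<partial>tilt \<nu> g))
      = ennreal (exp (g z + h z) / (\<integral>z. exp (g z + h z) \<partial>\<nu>))" for z
    using Z by (subst ennreal_mult[symmetric]) (auto simp: eq exp_add)
  then show ?thesis
    unfolding tilt_def[of "tilt \<nu> g"] unfolding tilt_def[of \<nu>]
    by (subst density_density_eq) (simp_all add: tilt_def)
qed

text \<open>
  The increment of the log-normalizer is bounded below by the average of the increment of the
  exponent: \<open>exp h\<close> lies above its tangent at the mean of \<open>h\<close>. All convexity arguments below go
  through this inequality.
\<close>

lemma tilt_jensen:
  fixes g h :: "'a \<Rightarrow> real"
  assumes \<nu>: "prob_space \<nu>" and [measurable]: "g \<in> borel_measurable \<nu>" "h \<in> borel_measurable \<nu>"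
    and i: "integrable \<nu> (\<lambda>z. exp (g z))" "integrable \<nu> (\<lambda>z. exp (g z + h z))" "integrable (tilt \<nu> g) h"
  shows "(\<integral>z. h z \<partial>tilt \<nu> g) \<le> ln (\<integral>z. exp (g z + h z) \<partial>\<nu>) - ln (\<integral>z. exp (g z) \<partial>\<nu>)"
proof -
  interpret T: prob_space "tilt \<nu> g" by (rule prob_space_tilt[OF \<nu> i(1)])
  let ?m = "\<integral>z. h z \<partial>tilt \<nu> g"
  have p: "0 < (\<integral>z. exp (g z) \<partial>\<nu>)" "0 < (\<integral>z. exp (g z + h z) \<partial>\<nu>)"
    using i \<nu> by (auto intro: integral_exp_pos)
  have ie: "integrable (tilt \<nu> g) (\<lambda>z. exp (h z))"
    using i(2) by (intro integrable_tilt) (auto simp: exp_add)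
  \<comment> \<open>The tangent line to the exponential at \<open>?m\<close> has average \<open>exp ?m\<close>.\<close>
  have "exp ?m = (\<integral>z. exp ?m * (1 + (h z - ?m)) \<partial>tilt \<nu> g)"
    using i(3) T.prob_space by simp
  also have "\<dots> \<le> (\<integral>z. exp (h z) \<partial>tilt \<nu> g)"
  proof (rule integral_mono)
    fix z
    have "exp ?m * (1 + (h z - ?m)) \<le> exp ?m * exp (h z - ?m)"
      by (intro mult_left_mono) auto
    then show "exp ?m * (1 + (h z - ?m)) \<le> exp (h z)" by (simp add: exp_diff)
  qed (use i ie in auto)
  also have "\<dots> = (\<integral>z. exp (g z + h z) \<partial>\<nu>) / (\<integral>z. exp (g z) \<partial>\<nu>)"
    by (subst integral_tilt) (auto simp: exp_add)
  finally have "?m \<le> ln ((\<integral>z. exp (g z + h z) \<partial>\<nu>) / (\<integral>z. exp (g z) \<partial>\<nu>))"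
    using p by (subst ln_ge_iff) auto
  then show ?thesis using p by (simp add: ln_div)
qed

text \<open>
  A measure on a finite product is determined by boxes, on which both sides factorize.
\<close>

lemma PiM_density:
  assumes "prob_space \<nu>" and w [measurable]: "w \<in> borel_measurable \<nu>" and fin: "finite_measure (density \<nu> w)" and L: "finite L"
  shows "PiM L (\<lambda>_. density \<nu> w) = density (PiM L (\<lambda>_. \<nu>)) (\<lambda>z. \<Prod>l\<in>L. w (z l))"
proof -
  interpret \<nu>: prob_space \<nu> by fact
  interpret D: finite_measure "density \<nu> w" by fact
  interpret A: product_sigma_finite "\<lambda>_. \<nu>" by standard
  interpret B: product_sigma_finite "\<lambda>_. density \<nu> w" by standard
  have [measurable]: "(\<lambda>z. \<Prod>l\<in>L. w (z l)) \<in> borel_measurable (PiM L (\<lambda>_. \<nu>))"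
    by (intro borel_measurable_prod_ennreal) auto
  show ?thesis
  proof (rule B.PiM_eqI[symmetric])
    show "sets (density (PiM L (\<lambda>_. \<nu>)) (\<lambda>z. \<Prod>l\<in>L. w (z l))) = sets (PiM L (\<lambda>_. density \<nu> w))"
      by (simp, intro sets_PiM_cong) auto
    fix A assume A: "\<And>i. i \<in> L \<Longrightarrow> A i \<in> sets (density \<nu> w)"
    then have A' [measurable]: "\<And>i. i \<in> L \<Longrightarrow> A i \<in> sets \<nu>" by simp
    have "emeasure (density (PiM L (\<lambda>_. \<nu>)) (\<lambda>z. \<Prod>l\<in>L. w (z l))) (Pi\<^sub>E L A)
        = (\<integral>\<^sup>+z. (\<Prod>l\<in>L. w (z l)) * indicator (Pi\<^sub>E L A) z \<partial>PiM L (\<lambda>_. \<nu>))"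
      using L A' by (intro emeasure_density) (auto intro!: sets_PiM_I_finite)
    also have "\<dots> = (\<integral>\<^sup>+z. (\<Prod>l\<in>L. w (z l) * indicator (A l) (z l)) \<partial>PiM L (\<lambda>_. \<nu>))"
    proof (rule nn_integral_cong)
      fix z assume "z \<in> space (PiM L (\<lambda>_. \<nu>))"
      then have "z \<in> extensional L" by (auto simp: space_PiM PiE_iff)
      then have "indicator (Pi\<^sub>E L A) z = (\<Prod>l\<in>L. indicator (A l) (z l) :: ennreal)"
        using L by (auto simp: PiE_iff indicator_def prod_zero_iff)
      then show "(\<Prod>l\<in>L. w (z l)) * indicator (Pi\<^sub>E L A) z = (\<Prod>l\<in>L. w (z l) * indicator (A l) (z l))"
        by (simp add: prod.distrib)
    qed
    also have "\<dots> = (\<Prod>l\<in>L. \<integral>\<^sup>+z. w z * indicator (A l) z \<partial>\<nu>)"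
      using L by (intro A.product_nn_integral_prod) auto
    also have "\<dots> = (\<Prod>l\<in>L. emeasure (density \<nu> w) (A l))"
      by (intro prod.cong) (auto simp: emeasure_density)
    finally show "emeasure (density (PiM L (\<lambda>_. \<nu>)) (\<lambda>z. \<Prod>l\<in>L. w (z l))) (Pi\<^sub>E L A)
      = (\<Prod>l\<in>L. emeasure (density \<nu> w) (A l))" .
  qed fact
qed

text \<open>
  Averages as quotients of integrals against the fixed measure \<open>\<nu>\<close>. The formula remains valid when
  \<open>exp \<circ> g\<close> is not integrable, because both sides degenerate in the same way; averages are therefore
  measurable functions of the disorder without exceptional sets.
\<close>

lemma avg_eq:
  assumes \<nu>: "prob_space \<nu>" and g [measurable]: "g \<in> borel_measurable \<nu>" and h [measurable]: "h \<in> borel_measurable (PiM {1..m} (\<lambda>_. \<nu>))"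
  shows "avg \<nu> g m h = (\<integral>z. h z * exp (\<Sum>l\<in>{1..m}. g (z l)) \<partial>PiM {1..m} (\<lambda>_. \<nu>)) / (\<integral>z. exp (g z) \<partial>\<nu>) ^ m"
proof -
  let ?Z = "\<integral>z. exp (g z) \<partial>\<nu>"
  have P: "PiM {1..m} (\<lambda>_. tilt \<nu> g) = density (PiM {1..m} (\<lambda>_. \<nu>)) (\<lambda>z. ennreal (exp (\<Sum>l\<in>{1..m}. g (z l)) / ?Z ^ m))"
  proof -
    have "PiM {1..m} (\<lambda>_. tilt \<nu> g) = density (PiM {1..m} (\<lambda>_. \<nu>)) (\<lambda>z. \<Prod>l\<in>{1..m}. ennreal (exp (g (z l)) / ?Z))"
      unfolding tilt_def using finite_measure_tilt[OF \<nu> g]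
      by (intro PiM_density \<nu>) (auto simp: tilt_def)
    also have "(\<lambda>z. \<Prod>l\<in>{1..m}. ennreal (exp (g (z l)) / ?Z)) = (\<lambda>z. ennreal (exp (\<Sum>l\<in>{1..m}. g (z l)) / ?Z ^ m))"
      by (rule ext) (simp add: prod_ennreal prod_dividef exp_sum)
    finally show ?thesis .
  qed
  have "avg \<nu> g m h = (\<integral>z. exp (\<Sum>l\<in>{1..m}. g (z l)) / ?Z ^ m * h z \<partial>PiM {1..m} (\<lambda>_. \<nu>))"
    unfolding avg_def P by (subst integral_density) auto
  also have "\<dots> = (\<integral>z. (h z * exp (\<Sum>l\<in>{1..m}. g (z l))) / ?Z ^ m \<partial>PiM {1..m} (\<lambda>_. \<nu>))"
    by (simp add: mult_ac)
  finally show ?thesis by simp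
qed

lemma sets_PiM_tilt: "sets (PiM L (\<lambda>_. tilt \<nu> g)) = sets (PiM L (\<lambda>_. \<nu>))"
  by (intro sets_PiM_cong) auto

lemma borel_measurable_avg:
  fixes g :: "'b \<Rightarrow> 'a \<Rightarrow> real"
  assumes \<nu>: "prob_space \<nu>"
    and g [measurable]: "(\<lambda>(\<gamma>, z). g \<gamma> z) \<in> borel_measurable (K \<Otimes>\<^sub>M \<nu>)"
    and h [measurable]: "(\<lambda>(\<gamma>, z). h \<gamma> z) \<in> borel_measurable (K \<Otimes>\<^sub>M PiM {1..m} (\<lambda>_. \<nu>))"
  shows "(\<lambda>\<gamma>. avg \<nu> (g \<gamma>) m (h \<gamma>)) \<in> borel_measurable K"
proof -
  interpret \<nu>: prob_space \<nu> by fact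
  interpret N: prob_space "PiM {1..m} (\<lambda>_. \<nu>)" by (intro prob_space_PiM \<nu>)
  have [measurable]: "(\<lambda>(\<gamma>, z). g \<gamma> (z l)) \<in> borel_measurable (K \<Otimes>\<^sub>M PiM {1..m} (\<lambda>_. \<nu>))" if l: "l \<in> {1..m}" for l
  proof -
    have "(\<lambda>w. (fst w, snd w l)) \<in> K \<Otimes>\<^sub>M PiM {1..m} (\<lambda>_. \<nu>) \<rightarrow>\<^sub>M K \<Otimes>\<^sub>M \<nu>"
      using l by measurable
    from measurable_compose[OF this g] show ?thesis by (simp add: split_beta')
  qed
  have "(\<lambda>\<gamma>. (\<integral>z. h \<gamma> z * exp (\<Sum>l\<in>{1..m}. g \<gamma> (z l)) \<partial>PiM {1..m} (\<lambda>_. \<nu>)) / (\<integral>z. exp (g \<gamma> z) \<partial>\<nu>) ^ m) \<in> borel_measurable K"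
    by measurable
  also have "?this \<longleftrightarrow> ?thesis"
  proof (rule measurable_cong)
    fix \<gamma> assume "\<gamma> \<in> space K"
    then have [measurable]: "g \<gamma> \<in> borel_measurable \<nu>" "h \<gamma> \<in> borel_measurable (PiM {1..m} (\<lambda>_. \<nu>))"
      by auto
    show "(\<integral>z. h \<gamma> z * exp (\<Sum>l\<in>{1..m}. g \<gamma> (z l)) \<partial>PiM {1..m} (\<lambda>_. \<nu>)) / (\<integral>z. exp (g \<gamma> z) \<partial>\<nu>) ^ m
      = avg \<nu> (g \<gamma>) m (h \<gamma>)"
      by (rule avg_eq[symmetric, OF \<nu>]) measurable
  qed
  finally show ?thesis .
qed

lemma PiM_integral_component:
  fixes k :: "'a \<Rightarrow> real"
  assumes \<mu>: "prob_space \<mu>" and k [measurable]: "k \<in> borel_measurable \<mu>" and l: "l \<in> L"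
  shows "(\<integral>z. k (z l) \<partial>PiM L (\<lambda>_. \<mu>)) = (\<integral>z. k z \<partial>\<mu>)"
proof -
  have "(\<integral>z. k z \<partial>\<mu>) = (\<integral>z. k z \<partial>distr (PiM L (\<lambda>_. \<mu>)) \<mu> (\<lambda>z. z l))"
    by (subst distr_PiM_component[of L "\<lambda>_. \<mu>" l]) (use \<mu> l in auto)
  also have "\<dots> = (\<integral>z. k (z l) \<partial>PiM L (\<lambda>_. \<mu>))"
    using l by (intro integral_distr) auto
  finally show ?thesis ..
qed

lemma PiM_integrable_component:
  fixes k :: "'a \<Rightarrow> real"
  assumes \<mu>: "prob_space \<mu>" and k: "integrable \<mu> k" and l: "l \<in> L"
  shows "integrable (PiM L (\<lambda>_. \<mu>)) (\<lambda>z. k (z l))"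
proof -
  have [measurable]: "k \<in> borel_measurable \<mu>" using k by simp
  have "integrable (distr (PiM L (\<lambda>_. \<mu>)) \<mu> (\<lambda>z. z l)) k"
    by (subst distr_PiM_component[of L "\<lambda>_. \<mu>" l]) (use \<mu> l k in auto)
  then show ?thesis using l by (subst (asm) integrable_distr_eq) auto
qed

lemma PiM_integral_Suc:
  fixes F :: "(nat \<Rightarrow> 'a) \<Rightarrow> real" and k :: "'a \<Rightarrow> real"
  assumes \<mu>: "prob_space \<mu>" and F [measurable]: "F \<in> borel_measurable (PiM {1..m} (\<lambda>_. \<mu>))"
    and k [measurable]: "k \<in> borel_measurable \<mu>"
    and kB: "\<And>z. z \<in> space \<mu> \<Longrightarrow> \<bar>k z\<bar> \<le> B"
    and FB: "\<And>z. z \<in> space (PiM {1..m} (\<lambda>_. \<mu>)) \<Longrightarrow> \<bar>F z\<bar> \<le> B'"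
  shows "(\<integral>z. F (restrict z {1..m}) * k (z (Suc m)) \<partial>PiM {1..Suc m} (\<lambda>_. \<mu>))
    = (\<integral>z. F z \<partial>PiM {1..m} (\<lambda>_. \<mu>)) * (\<integral>z. k z \<partial>\<mu>)"
proof -
  let ?L = "PiM {1..m} (\<lambda>_. \<mu>)"
  interpret \<mu>: prob_space \<mu> by fact
  interpret L: prob_space ?L by (intro prob_space_PiM \<mu>)
  interpret PL: pair_prob_space \<mu> ?L ..
  interpret pair_sigma_finite \<mu> ?L ..
  have I: "{1..Suc m} = insert (Suc m) {1..m}" by auto
  have [measurable]: "(\<lambda>z. restrict z {1..m}) \<in> PiM {1..Suc m} (\<lambda>_. \<mu>) \<rightarrow>\<^sub>M ?L"
    by (intro measurable_restrict_subset) auto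
  have "(\<integral>z. F (restrict z {1..m}) * k (z (Suc m)) \<partial>PiM {1..Suc m} (\<lambda>_. \<mu>))
    = (\<integral>z. F (restrict z {1..m}) * k (z (Suc m)) \<partial>distr (\<mu> \<Otimes>\<^sub>M ?L) (PiM {1..Suc m} (\<lambda>_. \<mu>)) (\<lambda>(x, z). z(Suc m := x)))"
    unfolding I by (subst distr_pair_PiM_eq_PiM[of "{1..m}" "\<lambda>_. \<mu>" "Suc m"]) (use \<mu> in auto)
  also have "\<dots> = (\<integral>w. k (fst w) * F (snd w) \<partial>(\<mu> \<Otimes>\<^sub>M ?L))"
  proof (subst integral_distr)
    show "(\<lambda>(x, z). z(Suc m := x)) \<in> \<mu> \<Otimes>\<^sub>M ?L \<rightarrow>\<^sub>M PiM {1..Suc m} (\<lambda>_. \<mu>)"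
      unfolding I by measurable
    show "(\<integral>w. F (restrict ((\<lambda>(x, z). z(Suc m := x)) w) {1..m}) * k ((\<lambda>(x, z). z(Suc m := x)) w (Suc m)) \<partial>(\<mu> \<Otimes>\<^sub>M ?L))
       = (\<integral>w. k (fst w) * F (snd w) \<partial>(\<mu> \<Otimes>\<^sub>M ?L))"
      by (rule Bochner_Integration.integral_cong)
         (auto simp: space_pair_measure space_PiM restrict_fupd PiE_iff extensional_restrict)
  qed measurable
  also have "\<dots> = (\<integral>x. (\<integral>z. k x * F z \<partial>?L) \<partial>\<mu>)"
  proof (subst PL.integral_fst'[symmetric])
    show "integrable (\<mu> \<Otimes>\<^sub>M ?L) (\<lambda>w. k (fst w) * F (snd w))"
    proof (rule PL.integrable_const_bound[where B="B * B'"])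
      show "AE w in \<mu> \<Otimes>\<^sub>M ?L. norm (k (fst w) * F (snd w)) \<le> B * B'"
      proof (intro AE_I2)
        fix w assume w: "w \<in> space (\<mu> \<Otimes>\<^sub>M ?L)"
        then have "\<bar>k (fst w)\<bar> \<le> B" "\<bar>F (snd w)\<bar> \<le> B'"
          using kB FB by (auto simp: space_pair_measure)
        then have "\<bar>k (fst w)\<bar> * \<bar>F (snd w)\<bar> \<le> B * B'"
          using abs_ge_zero[of "k (fst w)"] by (intro mult_mono) linarith+
        then show "norm (k (fst w) * F (snd w)) \<le> B * B'" by (simp add: abs_mult)
      qed
    qed measurable
  qed auto
  also have "\<dots> = (\<integral>z. F z \<partial>?L) * (\<integral>z. k z \<partial>\<mu>)"
    by simp
  finally show ?thesis .
qed


section \<open>Derivatives of Gibbs averages and integration by parts\<close>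

lemma abs_exp_minus_linear_le:
  fixes t :: real
  assumes "\<bar>t\<bar> \<le> 1"
  shows "\<bar>exp t - 1 - t\<bar> \<le> t\<^sup>2"
proof (cases "0 \<le> t")
  case True
  then show ?thesis using exp_bound[of t] exp_ge_add_one_self[of t] assms by linarith
next
  case False
  \<comment> \<open>For \<open>t = - s\<close> the claim is a bound of \<open>1 / exp s\<close>, and \<open>exp s\<close> exceeds its quadratic Taylor polynomial.\<close>
  define s where "s = - t"
  have s: "0 < s" "s \<le> 1" using False assms by (auto simp: s_def)
  have "1 \<le> (1 - s + s\<^sup>2) * (1 + s + s\<^sup>2 / 2)"
  proof -
    have "(1 - s + s\<^sup>2) * (1 + s + s\<^sup>2 / 2) = 1 + s\<^sup>2 / 2 + s^3 / 2 + s^4 / 2"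
      by (simp add: field_simps power2_eq_square power3_eq_cube power4_eq_xxxx)
    then show ?thesis using s by simp
  qed
  also have "\<dots> \<le> (1 - s + s\<^sup>2) * exp s"
    using s exp_lower_Taylor_quadratic[of s] by (intro mult_left_mono) auto
  finally have "exp (- s) \<le> 1 - s + s\<^sup>2"
    by (simp add: exp_minus field_simps)
  then have "exp t \<le> 1 + t + t\<^sup>2" by (simp add: s_def)
  then show ?thesis
    using exp_ge_add_one_self[of t] by linarith
qed

text \<open>
  Since \<open>C\<close> is bounded, the difference quotient differs from the expected derivative by at most a
  multiple of the increment, uniformly in \<open>z\<close>.
\<close>

lemma has_derivative_integral_exp:
  fixes C F :: "'a \<Rightarrow> real"
  assumes M: "prob_space M" and [measurable]: "C \<in> borel_measurable M" "F \<in> borel_measurable M"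
    and C: "\<And>z. z \<in> space M \<Longrightarrow> \<bar>C z\<bar> \<le> B" and F: "\<And>z. z \<in> space M \<Longrightarrow> \<bar>F z\<bar> \<le> K"
  shows "((\<lambda>u. \<integral>z. F z * exp (u * C z) \<partial>M) has_real_derivative (\<integral>z. F z * C z * exp (u * C z) \<partial>M)) (at u)"
proof -
  interpret prob_space M by fact
  obtain z0 where "z0 \<in> space M" using not_empty by blast
  then have B: "0 \<le> B" and K: "0 \<le> K"
    using C[of z0] F[of z0] by (auto intro: order_trans[OF abs_ge_zero])
  let ?E = "exp (\<bar>u\<bar> * B)"
  have E: "exp (u * C z) \<le> ?E" if "z \<in> space M" for z
    using mult_mono[OF order_refl[of "\<bar>u\<bar>"] C[OF that]] abs_ge_self[of "u * C z"] by (auto simp: abs_mult)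
  have i1: "integrable M (\<lambda>z. F z * exp (u * C z))" for u
  proof (rule integrable_const_bound[where B="K * exp (\<bar>u\<bar> * B)"])
    show "AE z in M. norm (F z * exp (u * C z)) \<le> K * exp (\<bar>u\<bar> * B)"
    proof (rule AE_I2)
      fix z assume z: "z \<in> space M"
      have "exp (u * C z) \<le> exp (\<bar>u\<bar> * B)"
        using mult_mono[OF order_refl[of "\<bar>u\<bar>"] C[OF z]] abs_ge_self[of "u * C z"] by (auto simp: abs_mult)
      then show "norm (F z * exp (u * C z)) \<le> K * exp (\<bar>u\<bar> * B)"
        using F[OF z] K by (auto simp: abs_mult intro!: mult_mono)
    qed
  qed measurable
  have i2: "integrable M (\<lambda>z. F z * C z * exp (u * C z))"
  proof (rule integrable_const_bound[where B="K * B * ?E"])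
    show "AE z in M. norm (F z * C z * exp (u * C z)) \<le> K * B * ?E"
    proof (rule AE_I2)
      fix z assume z: "z \<in> space M"
      show "norm (F z * C z * exp (u * C z)) \<le> K * B * ?E"
        using F[OF z] C[OF z] E[OF z] K B by (auto simp: abs_mult intro!: mult_mono)
    qed
  qed measurable
  have key: "\<bar>((\<integral>z. F z * exp ((u + h) * C z) \<partial>M) - (\<integral>z. F z * exp (u * C z) \<partial>M)) / h - (\<integral>z. F z * C z * exp (u * C z) \<partial>M)\<bar> \<le> K * ?E * B\<^sup>2 * \<bar>h\<bar>"
    if h: "h \<noteq> 0" "\<bar>h\<bar> * B \<le> 1" for h
  proof -
    let ?d = "\<lambda>z. F z * exp (u * C z) * (exp (h * C z) - 1 - h * C z)"
    have eq: "(\<integral>z. F z * exp ((u + h) * C z) \<partial>M) - (\<integral>z. F z * exp (u * C z) \<partial>M) - h * (\<integral>z. F z * C z * exp (u * C z) \<partial>M) = (\<integral>z. ?d z \<partial>M)"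
    proof -
      have "(\<integral>z. ?d z \<partial>M) = (\<integral>z. F z * exp ((u + h) * C z) - F z * exp (u * C z) - h * (F z * C z * exp (u * C z)) \<partial>M)"
        by (intro Bochner_Integration.integral_cong) (auto simp: algebra_simps exp_add)
      also have "\<dots> = (\<integral>z. F z * exp ((u + h) * C z) \<partial>M) - (\<integral>z. F z * exp (u * C z) \<partial>M) - h * (\<integral>z. F z * C z * exp (u * C z) \<partial>M)"
        using i1 i2 by simp
      finally show ?thesis ..
    qed
    have b: "\<bar>?d z\<bar> \<le> K * ?E * (B\<^sup>2 * h\<^sup>2)" if z: "z \<in> space M" for z
    proof -
      have hC: "\<bar>h * C z\<bar> \<le> \<bar>h\<bar> * B" using C[OF z] by (auto simp: abs_mult intro: mult_left_mono)
      then have "\<bar>exp (h * C z) - 1 - h * C z\<bar> \<le> (h * C z)\<^sup>2"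
        using h by (intro abs_exp_minus_linear_le) linarith
      also have "\<dots> \<le> (\<bar>h\<bar> * B)\<^sup>2"
        using power_mono[OF hC, of 2] by simp
      finally have "\<bar>exp (h * C z) - 1 - h * C z\<bar> \<le> B\<^sup>2 * h\<^sup>2"
        by (simp add: power_mult_distrib mult.commute)
      then show ?thesis
        using F[OF z] E[OF z] K by (auto simp: abs_mult intro!: mult_mono)
    qed
    have id: "integrable M ?d"
      using b by (intro integrable_const_bound[where B="K * ?E * (B\<^sup>2 * h\<^sup>2)"] AE_I2) auto
    have "\<bar>\<integral>z. ?d z \<partial>M\<bar> \<le> (\<integral>z. \<bar>?d z\<bar> \<partial>M)"
      by (rule integral_abs_bound)
    also have "\<dots> \<le> K * ?E * (B\<^sup>2 * h\<^sup>2)"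
      by (rule integral_le_const) (use id b in \<open>auto intro!: AE_I2\<close>)
    finally have "\<bar>\<integral>z. ?d z \<partial>M\<bar> / \<bar>h\<bar> \<le> K * ?E * (B\<^sup>2 * h\<^sup>2) / \<bar>h\<bar>"
      by (rule divide_right_mono) simp
    also have "\<dots> = K * ?E * B\<^sup>2 * \<bar>h\<bar>"
      using h by (simp add: power2_eq_square field_simps)
    finally have "\<bar>(\<integral>z. ?d z \<partial>M) / h\<bar> \<le> K * ?E * B\<^sup>2 * \<bar>h\<bar>" by (simp add: abs_divide)
    then show ?thesis using h by (simp add: eq[symmetric] diff_divide_distrib)
  qed
  have "((\<lambda>h. K * ?E * B\<^sup>2 * \<bar>h\<bar>) \<longlongrightarrow> K * ?E * B\<^sup>2 * \<bar>0\<bar>) (at 0)"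
    by (intro tendsto_intros)
  then have t0: "((\<lambda>h. K * ?E * B\<^sup>2 * \<bar>h\<bar>) \<longlongrightarrow> 0) (at 0)" by simp
  have ev: "\<forall>\<^sub>F h in at 0. h \<noteq> 0 \<and> \<bar>h\<bar> * B \<le> 1"
  proof -
    have "\<forall>\<^sub>F h in at (0::real). h \<noteq> 0 \<and> \<bar>h\<bar> < 1 / (B + 1)"
      using B by (auto simp: eventually_at dist_real_def intro!: exI[of _ "1 / (B + 1)"])
    then show ?thesis
    proof eventually_elim
      case (elim h)
      then have "\<bar>h\<bar> * (B + 1) < 1" using B by (simp add: field_simps)
      then show ?case using elim by (simp add: distrib_left)
    qed
  qed
  have "((\<lambda>h. ((\<integral>z. F z * exp ((u + h) * C z) \<partial>M) - (\<integral>z. F z * exp (u * C z) \<partial>M)) / h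
      - (\<integral>z. F z * C z * exp (u * C z) \<partial>M)) \<longlongrightarrow> 0) (at 0)"
  proof (rule Lim_null_comparison[OF _ t0])
    show "\<forall>\<^sub>F h in at 0. norm (((\<integral>z. F z * exp ((u + h) * C z) \<partial>M) - (\<integral>z. F z * exp (u * C z) \<partial>M)) / h
        - (\<integral>z. F z * C z * exp (u * C z) \<partial>M)) \<le> K * ?E * B\<^sup>2 * \<bar>h\<bar>"
      using ev by (rule eventually_mono) (use key in auto)
  qed
  then show ?thesis
    unfolding DERIV_def by (rule LIM_zero_cancel)
qed

lemma abs_integral_le_bound:
  fixes h :: "'a \<Rightarrow> real"
  assumes M: "prob_space M" and "\<And>z. z \<in> space M \<Longrightarrow> \<bar>h z\<bar> \<le> K"
  shows "\<bar>\<integral>z. h z \<partial>M\<bar> \<le> K"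
proof -
  interpret prob_space M by fact
  obtain z0 where "z0 \<in> space M" using not_empty by blast
  then have K: "0 \<le> K"
    using assms(2)[of z0] by (auto intro: order_trans[OF abs_ge_zero])
  show ?thesis
  proof (cases "integrable M h")
    case True
    have "\<bar>\<integral>z. h z \<partial>M\<bar> \<le> (\<integral>z. \<bar>h z\<bar> \<partial>M)"
      by (rule integral_abs_bound)
    also have "\<dots> \<le> K"
      by (rule integral_le_const) (use True assms(2) in \<open>auto intro!: AE_I2\<close>)
    finally show ?thesis .
  qed (use K in \<open>simp add: not_integrable_integral_eq\<close>)
qed

lemma avg_bound:
  assumes "prob_space \<nu>" "integrable \<nu> (\<lambda>z. exp (g z))"
    and "\<And>z. z \<in> space (PiM {1..m} (\<lambda>_. \<nu>)) \<Longrightarrow> \<bar>h z\<bar> \<le> K"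
  shows "\<bar>avg \<nu> g m h\<bar> \<le> K"
  unfolding avg_def using prob_space_tilt[OF assms(1,2)] assms(3)
  by (intro abs_integral_le_bound prob_space_PiM) (auto simp: space_PiM)

lemma integrable_exp_bounded:
  fixes C :: "'a \<Rightarrow> real"
  assumes M: "prob_space M" and [measurable]: "C \<in> borel_measurable M"
    and C: "\<And>z. z \<in> space M \<Longrightarrow> \<bar>C z\<bar> \<le> B"
  shows "integrable M (\<lambda>z. exp (u * C z))"
proof -
  interpret prob_space M by fact
  show ?thesis
  proof (rule integrable_const_bound[where B="exp (\<bar>u\<bar> * B)"])
    show "AE z in M. norm (exp (u * C z)) \<le> exp (\<bar>u\<bar> * B)"
    proof (rule AE_I2)
      fix z assume z: "z \<in> space M"
      show "norm (exp (u * C z)) \<le> exp (\<bar>u\<bar> * B)"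
        using mult_mono[OF order_refl[of "\<bar>u\<bar>"] C[OF z]] abs_ge_self[of "u * C z"] by (auto simp: abs_mult)
    qed
  qed measurable
qed

text \<open>
  The numerator of an average over \<open>m\<close> replicas contributes \<open>C\<close> at each of them, the \<open>m\<close>-th power of
  the normalizer contributes \<open>m\<close> times the average of \<open>C\<close> at a new replica. The coefficient \<open>n\<close> in the
  Ghirlanda-Guerra identities originates here.
\<close>

lemma avg_has_derivative:
  fixes C :: "'a \<Rightarrow> real"
  assumes \<mu>: "prob_space \<mu>" and C [measurable]: "C \<in> borel_measurable \<mu>" and F [measurable]: "F \<in> borel_measurable (PiM {1..m} (\<lambda>_. \<mu>))"
    and CB: "\<And>z. z \<in> space \<mu> \<Longrightarrow> \<bar>C z\<bar> \<le> B" and FK: "\<And>z. z \<in> space (PiM {1..m} (\<lambda>_. \<mu>)) \<Longrightarrow> \<bar>F z\<bar> \<le> K"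
  shows "((\<lambda>u. avg \<mu> (\<lambda>z. u * C z) m F) has_real_derivative
    avg \<mu> (\<lambda>z. u * C z) m (\<lambda>z. F z * (\<Sum>l\<in>{1..m}. C (z l)))
     - real m * avg \<mu> (\<lambda>z. u * C z) m F * (\<integral>z. C z \<partial>tilt \<mu> (\<lambda>z. u * C z))) (at u)"
proof -
  let ?M = "PiM {1..m} (\<lambda>_. \<mu>)"
  have M: "prob_space ?M" by (intro prob_space_PiM \<mu>)
  let ?S = "\<lambda>z. \<Sum>l\<in>{1..m}. C (z l)"
  have [measurable]: "?S \<in> borel_measurable ?M" by measurable
  have SB: "\<bar>?S z\<bar> \<le> real m * B" if "z \<in> space ?M" for z
  proof -
    have "\<bar>?S z\<bar> \<le> (\<Sum>l\<in>{1..m}. \<bar>C (z l)\<bar>)" by (rule sum_abs)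
    also have "\<dots> \<le> (\<Sum>l\<in>{1..m}. B)" using that CB by (intro sum_mono) (auto simp: space_PiM PiE_iff)
    finally show ?thesis by simp
  qed
  let ?A = "\<lambda>u. \<integral>z. F z * exp (u * ?S z) \<partial>?M" and ?Z = "\<lambda>u. \<integral>z. exp (u * C z) \<partial>\<mu>"
  let ?A' = "\<integral>z. F z * ?S z * exp (u * ?S z) \<partial>?M" and ?Z' = "\<integral>z. C z * exp (u * C z) \<partial>\<mu>"
  have Zp: "0 < ?Z u" for u
    by (intro integral_exp_pos \<mu> integrable_exp_bounded[OF \<mu> C CB])
  have H: "avg \<mu> (\<lambda>z. u * C z) m G = (\<integral>z. G z * exp (u * ?S z) \<partial>?M) / ?Z u ^ m"
    if [measurable]: "G \<in> borel_measurable ?M" for G u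
    by (subst avg_eq[OF \<mu>]) (auto simp: sum_distrib_left)
  have dA: "(?A has_real_derivative ?A') (at u)"
    using has_derivative_integral_exp[OF M, of ?S F "real m * B" K u] SB FK by simp
  have dZ: "(?Z has_real_derivative ?Z') (at u)"
    using has_derivative_integral_exp[OF \<mu> C, of "\<lambda>_. 1" B 1 u] CB by simp
  have "((\<lambda>u. ?A u / ?Z u ^ m) has_real_derivative (?A' * ?Z u ^ m - ?A u * (real m * ?Z u ^ (m - 1) * ?Z')) / (?Z u ^ m * ?Z u ^ m)) (at u)"
    using Zp[of u] by (intro DERIV_cong[OF DERIV_divide[OF dA DERIV_power[OF dZ, of m]]]) (auto simp: mult_ac One_nat_def)
  also have "(?A' * ?Z u ^ m - ?A u * (real m * ?Z u ^ (m - 1) * ?Z')) / (?Z u ^ m * ?Z u ^ m)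
      = ?A' / ?Z u ^ m - real m * (?A u / ?Z u ^ m) * (?Z' / ?Z u)"
  proof -
    have "real m * ?Z u ^ (m - 1) = real m * ?Z u ^ m / ?Z u"
      using Zp[of u] by (cases m) auto
    then have "?A u * (real m * ?Z u ^ (m - 1) * ?Z') = ?Z u ^ m * (real m * ?A u * ?Z' / ?Z u)"
      by (simp add: mult_ac)
    then have "?A' * ?Z u ^ m - ?A u * (real m * ?Z u ^ (m - 1) * ?Z') = ?Z u ^ m * (?A' - real m * ?A u * ?Z' / ?Z u)"
      by (simp add: algebra_simps)
    then show ?thesis using Zp[of u] by (simp add: diff_divide_distrib)
  qed
  also have "(\<lambda>u. ?A u / ?Z u ^ m) = (\<lambda>u. avg \<mu> (\<lambda>z. u * C z) m F)"
    by (rule ext) (simp only: H[OF F])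
  also have "?A' / ?Z u ^ m = avg \<mu> (\<lambda>z. u * C z) m (\<lambda>z. F z * ?S z)"
    by (subst H) auto
  also have "?Z' / ?Z u = (\<integral>z. C z \<partial>tilt \<mu> (\<lambda>z. u * C z))"
    by (subst integral_tilt) (auto simp: mult.commute)
  finally show ?thesis .
qed

lemma avg_component:
  fixes k :: "'a \<Rightarrow> real"
  assumes "prob_space \<nu>" "integrable \<nu> (\<lambda>z. exp (g z))" and [measurable]: "k \<in> borel_measurable \<nu>" and l: "l \<in> {1..m}"
  shows "avg \<nu> g m (\<lambda>z. k (z l)) = (\<integral>z. k z \<partial>tilt \<nu> g)"
  unfolding avg_def using prob_space_tilt[OF assms(1,2)] l
  by (intro PiM_integral_component) auto

lemma std_normal_density_has_derivative:
  "(std_normal_density has_real_derivative - x * std_normal_density x) (at x)"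
  unfolding std_normal_density_def[abs_def]
  by (auto intro!: derivative_eq_intros simp: field_simps)

lemma std_normal_density_tendsto_0:
  "(std_normal_density \<longlongrightarrow> 0) at_top" "(std_normal_density \<longlongrightarrow> 0) at_bot"
proof -
  have "filterlim (\<lambda>x::real. (1/2) * x\<^sup>2) at_top at_top"
    by (intro filterlim_tendsto_pos_mult_at_top[OF tendsto_const] filterlim_pow_at_top filterlim_ident) auto
  then have "filterlim (\<lambda>x::real. - x\<^sup>2 / 2) at_bot at_top"
    by (simp add: filterlim_uminus_at_bot)
  then have "((\<lambda>x::real. (1 / sqrt (2 * pi)) * exp (- x\<^sup>2 / 2)) \<longlongrightarrow> (1 / sqrt (2 * pi)) * 0) at_top"
    by (intro tendsto_mult tendsto_const filterlim_compose[OF exp_at_bot])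
  then show 1: "(std_normal_density \<longlongrightarrow> 0) at_top"
    unfolding std_normal_density_def[abs_def] by simp
  then show "(std_normal_density \<longlongrightarrow> 0) at_bot"
    unfolding filterlim_at_bot_mirror std_normal_density_def[abs_def] by simp
qed

text \<open>
  Stein's identity: the fundamental theorem of calculus for the product of \<open>h\<close> with the Gaussian
  density, which vanishes at infinity.
\<close>

lemma std_normal_integration_by_parts:
  fixes h h' :: "real \<Rightarrow> real"
  assumes d: "\<And>u. (h has_real_derivative h' u) (at u)" and c: "\<And>u. isCont h' u"
    and b: "\<And>u. \<bar>h u\<bar> \<le> B" and b': "\<And>u. \<bar>h' u\<bar> \<le> B'"
  shows "(\<integral>u. u * h u \<partial>std_normal_distribution) = (\<integral>u. h' u \<partial>std_normal_distribution)"
proof -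
  let ?\<phi> = std_normal_density
  have ch: "isCont h u" for u using d by (rule DERIV_isCont)
  have [measurable]: "h \<in> borel_measurable borel" "h' \<in> borel_measurable borel"
    using ch c by (auto intro!: borel_measurable_continuous_onI simp: continuous_on_eq_continuous_at)
  have i1: "integrable lborel (\<lambda>u. ?\<phi> u * h' u)"
  proof (rule Bochner_Integration.integrable_bound)
    show "integrable lborel (\<lambda>u. B' * ?\<phi> u)" by (intro integrable_mult_right integrable_normal_density) auto
    have "\<bar>h' u\<bar> * ?\<phi> u \<le> B' * ?\<phi> u" for u using b' by (intro mult_right_mono) auto
    then show "AE u in lborel. norm (?\<phi> u * h' u) \<le> norm (B' * ?\<phi> u)"
      using b' order_trans[OF abs_ge_zero b'] by (intro AE_I2) (simp add: abs_mult mult_ac)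
  qed measurable
  have i2: "integrable lborel (\<lambda>u. ?\<phi> u * (u * h u))"
  proof (rule Bochner_Integration.integrable_bound)
    show "integrable lborel (\<lambda>u. B * (?\<phi> u * \<bar>u\<bar>))"
      using integrable_std_normal_moment_abs[of 1] by (intro integrable_mult_right) simp
    have "\<bar>h u\<bar> * (?\<phi> u * \<bar>u\<bar>) \<le> B * (?\<phi> u * \<bar>u\<bar>)" for u using b by (intro mult_right_mono) auto
    then show "AE u in lborel. norm (?\<phi> u * (u * h u)) \<le> norm (B * (?\<phi> u * \<bar>u\<bar>))"
      using order_trans[OF abs_ge_zero b] by (intro AE_I2) (simp add: abs_mult mult_ac)
  qed measurable
  have lim: "((\<lambda>u. ?\<phi> u * h u) \<longlongrightarrow> 0) F" if "(?\<phi> \<longlongrightarrow> 0) F" for F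
  proof (rule Lim_null_comparison)
    show "\<forall>\<^sub>F u in F. norm (?\<phi> u * h u) \<le> B * ?\<phi> u"
      using b by (intro always_eventually) (auto simp: abs_mult mult.commute[of B] intro!: mult_left_mono)
    show "((\<lambda>u. B * ?\<phi> u) \<longlongrightarrow> 0) F" using tendsto_mult[OF tendsto_const that, of B] by simp
  qed
  have "(LBINT u=-\<infinity>..\<infinity>. ?\<phi> u * (h' u - u * h u)) = 0 - 0"
  proof (rule interval_integral_FTC_integrable[where F="\<lambda>u. ?\<phi> u * h u"])
    fix u
    have "((\<lambda>u. ?\<phi> u * h u) has_real_derivative ?\<phi> u * (h' u - u * h u)) (at u)"
      by (auto intro!: derivative_eq_intros std_normal_density_has_derivative d simp: algebra_simps)
    then show "((\<lambda>u. ?\<phi> u * h u) has_vector_derivative ?\<phi> u * (h' u - u * h u)) (at u)"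
      by (simp add: has_real_derivative_iff_has_vector_derivative)
    show "isCont (\<lambda>u. ?\<phi> u * (h' u - u * h u)) u"
      using c ch DERIV_isCont[OF std_normal_density_has_derivative] by (intro continuous_intros) auto
  next
    show "set_integrable lborel (einterval (-\<infinity>) \<infinity>) (\<lambda>u. ?\<phi> u * (h' u - u * h u))"
      using Bochner_Integration.integrable_diff[OF i1 i2]
      by (simp add: set_integrable_def algebra_simps)
    show "(((\<lambda>u. ?\<phi> u * h u) \<circ> real_of_ereal) \<longlongrightarrow> 0) (at_right (-\<infinity>))"
      "(((\<lambda>u. ?\<phi> u * h u) \<circ> real_of_ereal) \<longlongrightarrow> 0) (at_left \<infinity>)"
      using lim std_normal_density_tendsto_0 by (simp_all add: ereal_tendsto_simps1)
  qed auto
  then have "(\<integral>u. ?\<phi> u * (h' u - u * h u) \<partial>lborel) = 0"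
    by (simp add: interval_lebesgue_integral_def set_lebesgue_integral_def)
  then have "(\<integral>u. ?\<phi> u * h' u - ?\<phi> u * (u * h u) \<partial>lborel) = 0"
    by (simp add: algebra_simps)
  then have "(\<integral>u. ?\<phi> u * h' u \<partial>lborel) = (\<integral>u. ?\<phi> u * (u * h u) \<partial>lborel)"
    using i1 i2 by simp
  then show ?thesis
    by (simp add: integral_density)
qed

section \<open>The Gaussian field on the sphere\<close>

abbreviation indices :: "nat \<Rightarrow> nat list set" where
  "indices N \<equiv> (\<Union>p\<in>{1..}. multi_indices N p)"

definition monomial :: "nat list \<Rightarrow> (nat \<Rightarrow> real) \<Rightarrow> real" where
  "monomial is z = (\<Prod>i\<leftarrow>is. z i)"

lemma finite_multi_indices [simp]: "finite (multi_indices N p)"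
proof -
  have "multi_indices N p = {is. set is \<subseteq> {1..N} \<and> length is = p}" by (auto simp: multi_indices_def)
  then show ?thesis by (simp add: finite_lists_length_eq)
qed

lemma multi_indices_subset: "1 \<le> p \<Longrightarrow> multi_indices N p \<subseteq> indices N"
  by auto

lemma gp_eq: "gp N \<gamma> p z = (\<Sum>is\<in>multi_indices N p. \<gamma> is * monomial is z)"
  by (simp add: gp_def monomial_def)

text \<open>
  The sum is the covariance of \<open>g\<^sub>p(z)\<close> and \<open>g\<^sub>p(w)\<close>, which explains why powers of overlaps appear. A
  multi-index of length \<open>p + 1\<close> is a first index followed by one of length \<open>p\<close>, so each degree
  contributes one more factor \<open>dot N z w\<close>.
\<close>

lemma sum_monomial_mult: "(\<Sum>is\<in>multi_indices N p. monomial is z * monomial is w) = dot N z w ^ p"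
proof (induction p)
  case 0
  have "multi_indices N 0 = {[]}" by (auto simp: multi_indices_def)
  then show ?case by (simp add: monomial_def)
next
  case (Suc p)
  have eq: "multi_indices N (Suc p) = (\<lambda>(i, is). i # is) ` ({1..N} \<times> multi_indices N p)"
    by (auto simp: multi_indices_def image_iff length_Suc_conv)
  have "(\<Sum>is\<in>multi_indices N (Suc p). monomial is z * monomial is w)
     = (\<Sum>(i, is)\<in>{1..N} \<times> multi_indices N p. (z i * w i) * (monomial is z * monomial is w))"
    unfolding eq by (subst sum.reindex) (auto simp: inj_on_def monomial_def split_beta' mult_ac intro!: sum.cong)
  also have "\<dots> = dot N z w * dot N z w ^ p"
    by (simp add: sum.cartesian_product[symmetric] sum_distrib_left[symmetric] sum_distrib_right[symmetric] Suc dot_def)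
  finally show ?case by simp
qed

lemma abs_dot_le_1:
  assumes "z \<in> unit_sphere N" "w \<in> unit_sphere N"
  shows "\<bar>dot N z w\<bar> \<le> 1"
proof -
  have "\<bar>dot N z w\<bar> \<le> (\<Sum>i=1..N. \<bar>z i\<bar> * \<bar>w i\<bar>)"
    unfolding dot_def by (rule order_trans[OF sum_abs]) (simp add: abs_mult)
  also have "\<dots> \<le> L2_set z {1..N} * L2_set w {1..N}" by (rule L2_set_mult_ineq)
  finally show ?thesis using assms by (simp add: unit_sphere_def)
qed

lemma dot_commute: "dot N z w = dot N w z"
  by (simp add: dot_def mult.commute)

lemma dot_self: "z \<in> unit_sphere N \<Longrightarrow> dot N z z = 1"
  by (simp add: unit_sphere_def dot_def L2_set_def power2_eq_square)

lemma abs_monomial_le_1: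
  assumes z: "z \<in> unit_sphere N" and "is \<in> multi_indices N p"
  shows "\<bar>monomial is z\<bar> \<le> 1"
proof -
  have zi: "\<bar>z i\<bar> \<le> 1" if "i \<in> {1..N}" for i
  proof -
    have "(z i)\<^sup>2 \<le> (\<Sum>i=1..N. (z i)\<^sup>2)" using that by (intro member_le_sum) auto
    also have "\<dots> = 1" using z by (simp add: unit_sphere_def L2_set_def)
    finally show ?thesis by (simp add: abs_square_le_1)
  qed
  have "set is \<subseteq> {1..N}" using assms(2) by (simp add: multi_indices_def)
  then show ?thesis
  proof (induction "is")
    case (Cons i js)
    have "\<bar>z i\<bar> * \<bar>monomial js z\<bar> \<le> 1 * 1"
      by (rule mult_mono) (use zi Cons in auto)
    then show ?case by (simp add: monomial_def abs_mult)
  qed (simp add: monomial_def)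
qed

lemma prob_space_gauss_law: "prob_space (gauss_law N)"
  unfolding gauss_law_def by (intro prob_space_PiM prob_space_std_normal)

lemma sets_gauss_law: "sets (gauss_law N) = sets (PiM (indices N) (\<lambda>_. borel))"
  unfolding gauss_law_def by (intro sets_PiM_cong) auto

lemma space_gauss_law: "space (gauss_law N) = indices N \<rightarrow>\<^sub>E UNIV"
  using sets_eq_imp_space_eq[OF sets_gauss_law] by (simp add: space_PiM)

lemma measurable_gauss_law_component [measurable]:
  assumes "is \<in> indices N"
  shows "(\<lambda>\<gamma>. \<gamma> is) \<in> borel_measurable (gauss_law N)"
proof -
  have "(\<lambda>\<gamma>. \<gamma> is) \<in> borel_measurable (PiM (indices N) (\<lambda>_. borel))"
    by (rule measurable_component_singleton) fact
  then show ?thesis by (simp cong: measurable_cong_sets add: sets_gauss_law)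
qed

text \<open>
  A neighbourhood of the values of the uniform variables: the argument moves one coordinate out of
  \<open>[0, 1]\<close> by at most \<open>1\<close>.
\<close>

definition coef_box :: "(nat \<Rightarrow> real) set" where
  "coef_box = {x. \<forall>p\<ge>1. \<bar>x p\<bar> \<le> 2}"

lemma half_geometric_sums: "(\<lambda>q. (1/2::real) ^ Suc q) sums 1"
  using power_half_series by simp

lemma sum_half_powers_le: "(\<Sum>q<Q. (1/2::real) ^ q) \<le> 2"
  by (simp add: sum_gp_strict)

definition fterm :: "nat \<Rightarrow> (nat \<Rightarrow> real) \<Rightarrow> (nat list \<Rightarrow> real) \<Rightarrow> (nat \<Rightarrow> real) \<Rightarrow> nat \<Rightarrow> real" where
  "fterm N x \<gamma> z q = (1/2) ^ Suc q * x (Suc q) * gp N \<gamma> (Suc q) z"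

lemma gfun_eq: "gfun N v x \<gamma> z = v * (\<Sum>q. fterm N x \<gamma> z q)"
  by (simp add: gfun_def fterm_def)

locale sphere_field =
  fixes N :: nat and \<nu> :: "(nat \<Rightarrow> real) measure" and v :: real
  assumes prob_\<nu>: "prob_space \<nu>" and sets_\<nu>: "sets \<nu> = sets (sphere_borel N)" and v_nonneg: "0 \<le> v"
begin

sublocale \<nu>: prob_space \<nu> by (rule prob_\<nu>)
sublocale P: prob_space "gauss_law N" by (rule prob_space_gauss_law)
sublocale P\<nu>: pair_prob_space "gauss_law N" \<nu> ..

abbreviation H :: "(nat \<Rightarrow> real) \<Rightarrow> (nat list \<Rightarrow> real) \<Rightarrow> (nat \<Rightarrow> real) \<Rightarrow> real" where
  "H \<equiv> gfun N v"

abbreviation gibbs :: "(nat \<Rightarrow> real) \<Rightarrow> (nat list \<Rightarrow> real) \<Rightarrow> (nat \<Rightarrow> real) measure" where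
  "gibbs x \<gamma> \<equiv> tilt \<nu> (H x \<gamma>)"

abbreviation gavg :: "(nat \<Rightarrow> real) \<Rightarrow> (nat list \<Rightarrow> real) \<Rightarrow> nat \<Rightarrow> ((nat \<Rightarrow> nat \<Rightarrow> real) \<Rightarrow> real) \<Rightarrow> real" where
  "gavg x \<gamma> \<equiv> avg \<nu> (H x \<gamma>)"

abbreviation EE :: "(nat \<Rightarrow> real) \<Rightarrow> nat \<Rightarrow> ((nat \<Rightarrow> nat \<Rightarrow> real) \<Rightarrow> real) \<Rightarrow> real" where
  "EE \<equiv> E_avg N v \<nu>"

lemma space_\<nu>: "space \<nu> = unit_sphere N"
proof -
  have "space \<nu> = space (sphere_borel N)" by (rule sets_eq_imp_space_eq) (rule sets_\<nu>)
  then show ?thesis by (auto simp: sphere_borel_def space_restrict_space space_PiM unit_sphere_def)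
qed

lemma measurable_\<nu>_component [measurable]:
  assumes "i \<in> {1..N}"
  shows "(\<lambda>z. z i) \<in> borel_measurable \<nu>"
proof -
  have "(\<lambda>z. z i) \<in> borel_measurable (sphere_borel N)"
    unfolding sphere_borel_def using assms by (intro measurable_restrict_space1) measurable
  then show ?thesis by (simp cong: measurable_cong_sets add: sets_\<nu>)
qed

lemma measurable_monomial:
  assumes "set is \<subseteq> {1..N}"
  shows "monomial is \<in> borel_measurable \<nu>"
  using assms
proof (induction "is")
  case (Cons i js)
  have [measurable]: "monomial js \<in> borel_measurable \<nu>" "(\<lambda>z. z i) \<in> borel_measurable \<nu>"
    using Cons by auto
  have "(\<lambda>z. z i * monomial js z) \<in> borel_measurable \<nu>" by measurable
  then show ?case by (simp add: monomial_def[abs_def])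
qed (simp add: monomial_def[abs_def])

lemma measurable_monomial' [measurable]:
  "is \<in> multi_indices N p \<Longrightarrow> monomial is \<in> borel_measurable \<nu>"
  by (rule measurable_monomial) (simp add: multi_indices_def)

lemma measurable_gp:
  assumes "1 \<le> p" and "\<And>is. is \<in> indices N \<Longrightarrow> (\<lambda>k. \<Gamma> k is) \<in> borel_measurable K" and Z: "Zf \<in> K \<rightarrow>\<^sub>M \<nu>"
  shows "(\<lambda>k. gp N (\<Gamma> k) p (Zf k)) \<in> borel_measurable K"
  unfolding gp_eq
proof (rule borel_measurable_sum)
  fix "is" assume "is": "is \<in> multi_indices N p"
  have "(\<lambda>k. \<Gamma> k is) \<in> borel_measurable K" using assms(1,2) "is" by auto
  moreover have "(\<lambda>k. monomial is (Zf k)) \<in> borel_measurable K"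
    using measurable_compose[OF Z measurable_monomial'[OF "is"]] .
  ultimately show "(\<lambda>k. \<Gamma> k is * monomial is (Zf k)) \<in> borel_measurable K" by measurable
qed

lemma measurable_gfun:
  assumes "\<And>p. 1 \<le> p \<Longrightarrow> (\<lambda>k. X k p) \<in> borel_measurable K"
    and "\<And>is. is \<in> indices N \<Longrightarrow> (\<lambda>k. \<Gamma> k is) \<in> borel_measurable K" and Z: "Zf \<in> K \<rightarrow>\<^sub>M \<nu>"
  shows "(\<lambda>k. H (X k) (\<Gamma> k) (Zf k)) \<in> borel_measurable K"
proof -
  have [measurable]: "(\<lambda>k. gp N (\<Gamma> k) (Suc p) (Zf k)) \<in> borel_measurable K" for p
    by (rule measurable_gp) (use assms in auto)
  have [measurable]: "(\<lambda>k. X k (Suc p)) \<in> borel_measurable K" for p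
    using assms(1) by simp
  show ?thesis unfolding gfun_def by measurable
qed

lemma measurable_gp_pair [measurable]:
  "1 \<le> p \<Longrightarrow> (\<lambda>w. gp N (fst w) p (snd w)) \<in> borel_measurable (gauss_law N \<Otimes>\<^sub>M \<nu>)"
  by (rule measurable_gp) measurable

lemma measurable_gfun_pair [measurable]:
  "(\<lambda>w. H x (fst w) (snd w)) \<in> borel_measurable (gauss_law N \<Otimes>\<^sub>M \<nu>)"
  by (rule measurable_gfun) measurable

lemma measurable_gp_z [measurable]: "gp N \<gamma> p \<in> borel_measurable \<nu>"
proof -
  have "(\<lambda>z. \<Sum>is\<in>multi_indices N p. \<gamma> is * monomial is z) \<in> borel_measurable \<nu>" by measurable
  then show ?thesis by (simp add: gp_eq[abs_def])
qed

lemma measurable_gfun_z [measurable]: "H x \<gamma> \<in> borel_measurable \<nu>"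
proof -
  have "(\<lambda>z. v * (\<Sum>p. (1/2) ^ Suc p * x (Suc p) * gp N \<gamma> (Suc p) z)) \<in> borel_measurable \<nu>" by measurable
  then show ?thesis by (simp add: gfun_def[abs_def])
qed

lemma nn_integral_exp_gp:
  assumes z: "z \<in> unit_sphere N" and p: "1 \<le> p"
  shows "(\<integral>\<^sup>+\<gamma>. ennreal (exp (t * gp N \<gamma> p z)) \<partial>gauss_law N) = ennreal (exp (t\<^sup>2 / 2))"
proof -
  have "(\<integral>\<^sup>+\<gamma>. ennreal (exp (t * gp N \<gamma> p z)) \<partial>gauss_law N)
      = (\<integral>\<^sup>+\<gamma>. ennreal (exp (\<Sum>is\<in>multi_indices N p. (t * monomial is z) * \<gamma> is)) \<partial>gauss_law N)"
    by (simp add: gp_eq sum_distrib_left mult_ac)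
  also have "\<dots> = ennreal (exp ((\<Sum>is\<in>multi_indices N p. (t * monomial is z)\<^sup>2) / 2))"
    unfolding gauss_law_def using p by (intro nn_integral_gauss_field_exp) auto
  also have "(\<Sum>is\<in>multi_indices N p. (t * monomial is z)\<^sup>2) = t\<^sup>2 * (\<Sum>is\<in>multi_indices N p. monomial is z * monomial is z)"
    by (simp add: sum_distrib_left power2_eq_square mult_ac)
  also have "\<dots> = t\<^sup>2" by (simp add: sum_monomial_mult dot_self[OF z])
  finally show ?thesis .
qed

lemma measurable_gp_\<gamma>:
  assumes z: "z \<in> unit_sphere N" and p: "1 \<le> p"
  shows "(\<lambda>\<gamma>. gp N \<gamma> p z) \<in> borel_measurable (gauss_law N)"
  by (rule measurable_gp[OF p]) (use z in \<open>auto simp: space_\<nu>\<close>)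

lemma measurable_gfun_\<gamma>:
  assumes z: "z \<in> unit_sphere N"
  shows "(\<lambda>\<gamma>. H x \<gamma> z) \<in> borel_measurable (gauss_law N)"
  by (rule measurable_gfun) (use z in \<open>auto simp: space_\<nu>\<close>)

text \<open>
  \<open>g\<^sub>p(z)\<close> is standard Gaussian for \<open>z\<close> on the sphere. The constant is crude, from
  \<open>|u| \<le> exp u + exp (- u)\<close>; what matters is that it does not depend on \<open>N\<close> or \<open>p\<close>.
\<close>

lemma nn_integral_abs_gp_le:
  assumes z: "z \<in> unit_sphere N" and p: "1 \<le> p"
  shows "(\<integral>\<^sup>+\<gamma>. ennreal \<bar>gp N \<gamma> p z\<bar> \<partial>gauss_law N) \<le> 4"
proof -
  note [measurable] = measurable_gp_\<gamma>[OF z p]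
  have "(\<integral>\<^sup>+\<gamma>. ennreal \<bar>gp N \<gamma> p z\<bar> \<partial>gauss_law N)
     \<le> (\<integral>\<^sup>+\<gamma>. ennreal (exp (1 * gp N \<gamma> p z)) + ennreal (exp ((-1) * gp N \<gamma> p z)) \<partial>gauss_law N)"
  proof (rule nn_integral_mono)
    fix \<gamma>
    have "\<bar>u\<bar> \<le> exp u + exp (- u)" for u :: real
      using exp_ge_add_one_self[of u] exp_ge_add_one_self[of "- u"] exp_gt_zero[of u] exp_gt_zero[of "- u"]
      by linarith
    then show "ennreal \<bar>gp N \<gamma> p z\<bar> \<le> ennreal (exp (1 * gp N \<gamma> p z)) + ennreal (exp ((-1) * gp N \<gamma> p z))"
      by (auto simp flip: ennreal_plus intro!: ennreal_leI)
  qed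
  also have "\<dots> = ennreal (exp (1\<^sup>2 / 2)) + ennreal (exp ((-1)\<^sup>2 / 2))"
    by (subst nn_integral_add) (auto simp only: nn_integral_exp_gp[OF z p], measurable)
  also have "\<dots> \<le> ennreal 4"
  proof -
    have "(exp (1/2::real))\<^sup>2 \<le> 2\<^sup>2"
      using exp_le by (simp add: power2_eq_square exp_add[symmetric])
    then have "exp (1/2::real) \<le> 2" by (rule power2_le_imp_le) simp
    then have "ennreal (exp (1/2) + exp (1/2)) \<le> ennreal 4" by (intro ennreal_leI) simp
    then show ?thesis by (simp flip: ennreal_plus)
  qed
  finally show ?thesis by simp
qed


lemma measurable_fterm_pair [measurable]:
  "(\<lambda>w. fterm N x (fst w) (snd w) q) \<in> borel_measurable (gauss_law N \<Otimes>\<^sub>M \<nu>)"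
  unfolding fterm_def by measurable

lemma measurable_fterm_\<gamma>:
  assumes z: "z \<in> unit_sphere N"
  shows "(\<lambda>\<gamma>. fterm N x \<gamma> z q) \<in> borel_measurable (gauss_law N)"
  unfolding fterm_def using measurable_gp_\<gamma>[OF z, of "Suc q"] by measurable

text \<open>
  The sum of the moduli of the coefficients of \<open>g\<^sub>p\<close> is of order \<open>N\<^sup>p\<close>, too large in general to make
  the series for \<open>g\<close> converge uniformly on the sphere. At each fixed \<open>z\<close> it converges absolutely
  almost surely, which by Tonelli's theorem is enough for integrals with respect to \<open>\<nu>\<close>.
\<close>

lemma nn_integral_abs_fterm_le:
  assumes x: "x \<in> coef_box" and z: "z \<in> unit_sphere N"
  shows "(\<integral>\<^sup>+\<gamma>. (\<Sum>q. ennreal \<bar>fterm N x \<gamma> z q\<bar>) \<partial>gauss_law N) \<le> 8"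
proof -
  note [measurable] = measurable_fterm_\<gamma>[OF z]
  have "(\<integral>\<^sup>+\<gamma>. (\<Sum>q. ennreal \<bar>fterm N x \<gamma> z q\<bar>) \<partial>gauss_law N)
      = (\<Sum>q. \<integral>\<^sup>+\<gamma>. ennreal \<bar>fterm N x \<gamma> z q\<bar> \<partial>gauss_law N)"
    by (rule nn_integral_suminf) measurable
  also have "\<dots> \<le> (\<Sum>q. ennreal (8 * (1/2) ^ Suc q))"
  proof (rule suminf_le)
    fix q
    note [measurable] = measurable_gp_\<gamma>[OF z, of "Suc q"]
    have x2: "\<bar>x (Suc q)\<bar> \<le> 2" using x by (simp add: coef_box_def)
    have "(\<integral>\<^sup>+\<gamma>. ennreal \<bar>fterm N x \<gamma> z q\<bar> \<partial>gauss_law N)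
        = (\<integral>\<^sup>+\<gamma>. ennreal ((1/2) ^ Suc q * \<bar>x (Suc q)\<bar>) * ennreal \<bar>gp N \<gamma> (Suc q) z\<bar> \<partial>gauss_law N)"
      by (simp add: fterm_def abs_mult ennreal_mult[symmetric])
    also have "\<dots> = ennreal ((1/2) ^ Suc q * \<bar>x (Suc q)\<bar>) * (\<integral>\<^sup>+\<gamma>. ennreal \<bar>gp N \<gamma> (Suc q) z\<bar> \<partial>gauss_law N)"
      by (rule nn_integral_cmult) measurable
    also have "\<dots> \<le> ennreal ((1/2) ^ Suc q * 2) * ennreal 4"
      using x2 nn_integral_abs_gp_le[OF z, of "Suc q"]
      by (intro mult_mono ennreal_leI mult_left_mono) auto
    also have "\<dots> = ennreal (8 * (1/2) ^ Suc q)"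
      by (subst ennreal_mult[symmetric]) auto
    finally show "(\<integral>\<^sup>+\<gamma>. ennreal \<bar>fterm N x \<gamma> z q\<bar> \<partial>gauss_law N) \<le> ennreal (8 * (1/2) ^ Suc q)" .
  qed auto
  also have "\<dots> = ennreal 8"
    using sums_mult[OF half_geometric_sums, of 8] by (intro suminf_ennreal_eq) auto
  finally show ?thesis by simp
qed

lemma abs_gfun_le: "ennreal \<bar>H x \<gamma> z\<bar> \<le> ennreal v * (\<Sum>q. ennreal \<bar>fterm N x \<gamma> z q\<bar>)"
proof (cases "v = 0")
  case True
  then show ?thesis by (simp add: gfun_eq)
next
  case v0: False
  show ?thesis
  proof (cases "(\<Sum>q. ennreal \<bar>fterm N x \<gamma> z q\<bar>) = \<top>")
    case True
    have "ennreal v * \<top> = \<top>" using v0 v_nonneg by (simp add: ennreal_mult_top)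
    then show ?thesis unfolding True by simp
  next
    case False
    then have s: "summable (\<lambda>q. \<bar>fterm N x \<gamma> z q\<bar>)"
      by (rule summable_suminf_not_top[rotated]) simp
    have "\<bar>H x \<gamma> z\<bar> \<le> v * (\<Sum>q. \<bar>fterm N x \<gamma> z q\<bar>)"
      unfolding gfun_eq abs_mult using summable_rabs[OF s] v_nonneg
      by (simp only: abs_of_nonneg mult_left_mono)
    then have "ennreal \<bar>H x \<gamma> z\<bar> \<le> ennreal (v * (\<Sum>q. \<bar>fterm N x \<gamma> z q\<bar>))"
      by (rule ennreal_leI)
    also have "\<dots> = ennreal v * ennreal (\<Sum>q. \<bar>fterm N x \<gamma> z q\<bar>)"
      by (rule ennreal_mult[OF v_nonneg suminf_nonneg[OF s]]) simp
    also have "ennreal (\<Sum>q. \<bar>fterm N x \<gamma> z q\<bar>) = (\<Sum>q. ennreal \<bar>fterm N x \<gamma> z q\<bar>)"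
      by (rule suminf_ennreal2[symmetric, OF _ s]) simp
    finally show ?thesis .
  qed
qed

lemma nn_integral_abs_gfun_le:
  assumes x: "x \<in> coef_box" and z: "z \<in> unit_sphere N"
  shows "(\<integral>\<^sup>+\<gamma>. ennreal \<bar>H x \<gamma> z\<bar> \<partial>gauss_law N) \<le> ennreal (8 * v)"
proof -
  note [measurable] = measurable_fterm_\<gamma>[OF z]
  have "(\<integral>\<^sup>+\<gamma>. ennreal \<bar>H x \<gamma> z\<bar> \<partial>gauss_law N)
      \<le> (\<integral>\<^sup>+\<gamma>. ennreal v * (\<Sum>q. ennreal \<bar>fterm N x \<gamma> z q\<bar>) \<partial>gauss_law N)"
    by (intro nn_integral_mono abs_gfun_le)
  also have "\<dots> = ennreal v * (\<integral>\<^sup>+\<gamma>. (\<Sum>q. ennreal \<bar>fterm N x \<gamma> z q\<bar>) \<partial>gauss_law N)"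
    by (rule nn_integral_cmult) measurable
  also have "\<dots> \<le> ennreal v * ennreal 8"
    using nn_integral_abs_fterm_le[OF x z] by (intro mult_left_mono) auto
  also have "\<dots> = ennreal (8 * v)"
    using v_nonneg by (subst ennreal_mult[symmetric]) (auto simp: mult.commute)
  finally show ?thesis .
qed

lemma AE_summable_fterm:
  assumes x: "x \<in> coef_box"
  shows "AE \<gamma> in gauss_law N. AE z in \<nu>. summable (fterm N x \<gamma> z)"
proof -
  have "(\<integral>\<^sup>+w. (\<Sum>q. ennreal \<bar>fterm N x (fst w) (snd w) q\<bar>) \<partial>(gauss_law N \<Otimes>\<^sub>M \<nu>))
      = (\<integral>\<^sup>+z. \<integral>\<^sup>+\<gamma>. (\<Sum>q. ennreal \<bar>fterm N x \<gamma> z q\<bar>) \<partial>gauss_law N \<partial>\<nu>)"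
    by (subst P\<nu>.nn_integral_snd[symmetric]) auto
  also have "\<dots> \<le> (\<integral>\<^sup>+z. 8 \<partial>\<nu>)"
    using nn_integral_abs_fterm_le[OF x] by (intro nn_integral_mono) (simp add: space_\<nu>)
  also have "\<dots> < \<infinity>" by (simp add: \<nu>.emeasure_space_1)
  finally have "AE w in gauss_law N \<Otimes>\<^sub>M \<nu>. (\<Sum>q. ennreal \<bar>fterm N x (fst w) (snd w) q\<bar>) \<noteq> \<infinity>"
    by (intro nn_integral_PInf_AE) (auto simp: less_top)
  from P\<nu>.AE_pair[OF this] have "AE \<gamma> in gauss_law N. AE z in \<nu>. (\<Sum>q. ennreal \<bar>fterm N x \<gamma> z q\<bar>) \<noteq> \<infinity>"
    by simp
  then show ?thesis
    by (elim eventually_mono) (auto intro!: summable_rabs_cancel[OF summable_suminf_not_top])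
qed

lemma AE_summable_fterm_\<gamma>:
  assumes x: "x \<in> coef_box" and z: "z \<in> unit_sphere N"
  shows "AE \<gamma> in gauss_law N. summable (fterm N x \<gamma> z)"
proof -
  note [measurable] = measurable_fterm_\<gamma>[OF z]
  have "(\<integral>\<^sup>+\<gamma>. (\<Sum>q. ennreal \<bar>fterm N x \<gamma> z q\<bar>) \<partial>gauss_law N) < \<infinity>"
    using nn_integral_abs_fterm_le[OF x z] by (rule order_le_less_trans) simp
  then have "AE \<gamma> in gauss_law N. (\<Sum>q. ennreal \<bar>fterm N x \<gamma> z q\<bar>) \<noteq> \<infinity>"
    by (intro nn_integral_PInf_AE) (auto simp: less_top)
  then show ?thesis
    by (elim eventually_mono) (auto intro!: summable_rabs_cancel[OF summable_suminf_not_top])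
qed

text \<open>
  A partial sum of \<open>t * g(z)\<close> is Gaussian with variance at most \<open>2 t\<^sup>2 v\<^sup>2\<close>, a bound that survives in
  the limit by Fatou's lemma.
\<close>

lemma nn_integral_exp_gfun_le:
  assumes x: "x \<in> coef_box" and z: "z \<in> unit_sphere N"
  shows "(\<integral>\<^sup>+\<gamma>. ennreal (exp (t * H x \<gamma> z)) \<partial>gauss_law N) \<le> ennreal (exp (t\<^sup>2 * v\<^sup>2))"
proof -
  note [measurable] = measurable_fterm_\<gamma>[OF z] measurable_gfun_\<gamma>[OF z]
  let ?S = "\<lambda>\<gamma> Q. t * (v * (\<Sum>q<Q. fterm N x \<gamma> z q))"
  have part: "(\<integral>\<^sup>+\<gamma>. ennreal (exp (?S \<gamma> Q)) \<partial>gauss_law N) \<le> ennreal (exp (t\<^sup>2 * v\<^sup>2))" for Q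
  proof -
    let ?J = "\<Union>q\<in>{..<Q}. multi_indices N (Suc q)"
    let ?a = "\<lambda>is. t * v * (1/2) ^ length is * x (length is) * monomial is z"
    have U: "sum f ?J = (\<Sum>q<Q. \<Sum>is\<in>multi_indices N (Suc q). f is)" for f :: "nat list \<Rightarrow> real"
    proof (rule sum.UNION_disjoint)
      show "\<forall>i\<in>{..<Q}. \<forall>j\<in>{..<Q}. i \<noteq> j \<longrightarrow> multi_indices N (Suc i) \<inter> multi_indices N (Suc j) = {}"
        by (auto simp: multi_indices_def)
    qed auto
    have len: "length is = p" if "is \<in> multi_indices N p" for "is" p
      using that by (simp add: multi_indices_def)
    have "(\<integral>\<^sup>+\<gamma>. ennreal (exp (?S \<gamma> Q)) \<partial>gauss_law N) = (\<integral>\<^sup>+\<gamma>. ennreal (exp (\<Sum>is\<in>?J. ?a is * \<gamma> is)) \<partial>gauss_law N)"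
    proof (rule nn_integral_cong)
      fix \<gamma>
      have "(\<Sum>is\<in>?J. ?a is * \<gamma> is) = (\<Sum>q<Q. \<Sum>is\<in>multi_indices N (Suc q). t * v * (1/2) ^ Suc q * x (Suc q) * monomial is z * \<gamma> is)"
        unfolding U by (intro sum.cong refl) (simp add: len)
      also have "\<dots> = ?S \<gamma> Q"
        by (simp add: fterm_def gp_eq sum_distrib_left sum_divide_distrib mult_ac)
      finally show "ennreal (exp (?S \<gamma> Q)) = ennreal (exp (\<Sum>is\<in>?J. ?a is * \<gamma> is))" by simp
    qed
    also have "\<dots> = ennreal (exp ((\<Sum>is\<in>?J. (?a is)\<^sup>2) / 2))"
      unfolding gauss_law_def by (rule nn_integral_gauss_field_exp) (simp, intro UN_least multi_indices_subset, simp)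
    also have "\<dots> \<le> ennreal (exp (t\<^sup>2 * v\<^sup>2))"
    proof -
      have "(\<Sum>is\<in>?J. (?a is)\<^sup>2) = (\<Sum>q<Q. (t * v * (1/2) ^ Suc q * x (Suc q))\<^sup>2 * (\<Sum>is\<in>multi_indices N (Suc q). monomial is z * monomial is z))"
        unfolding U sum_distrib_left by (intro sum.cong refl) (simp add: len power2_eq_square mult_ac)
      also have "\<dots> = (\<Sum>q<Q. (t * v)\<^sup>2 * ((1/2) ^ Suc q * x (Suc q))\<^sup>2)"
        by (simp add: sum_monomial_mult dot_self[OF z] power_mult_distrib power_divide mult_ac)
      also have "\<dots> \<le> (\<Sum>q<Q. (t * v)\<^sup>2 * (1/2) ^ q)"
      proof (intro sum_mono mult_left_mono)
        fix q
        have "\<bar>x (Suc q)\<bar> \<le> 2" using x by (simp add: coef_box_def)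
        then have "\<bar>(1/2) ^ Suc q * x (Suc q)\<bar> \<le> (1/2) ^ Suc q * 2"
          unfolding abs_mult by (intro mult_mono) auto
        then have "((1/2) ^ Suc q * x (Suc q))\<^sup>2 \<le> ((1/2) ^ q)\<^sup>2"
          by (intro power2_le_iff_abs_le[THEN iffD2]) auto
        also have "\<dots> \<le> (1/2) ^ q"
          by (simp add: power2_eq_square mult_left_le power_le_one)
        finally show "((1/2) ^ Suc q * x (Suc q))\<^sup>2 \<le> (1/2) ^ q" .
      qed auto
      also have "\<dots> = (t * v)\<^sup>2 * (\<Sum>q<Q. (1/2) ^ q)" by (simp add: sum_distrib_left)
      also have "\<dots> \<le> (t * v)\<^sup>2 * 2" by (intro mult_left_mono sum_half_powers_le) auto
      finally show ?thesis by (intro ennreal_leI) (simp add: power_mult_distrib)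
    qed
    finally show ?thesis .
  qed
  have "(\<integral>\<^sup>+\<gamma>. ennreal (exp (t * H x \<gamma> z)) \<partial>gauss_law N)
      = (\<integral>\<^sup>+\<gamma>. liminf (\<lambda>Q. ennreal (exp (?S \<gamma> Q))) \<partial>gauss_law N)"
  proof (rule nn_integral_cong_AE)
    show "AE \<gamma> in gauss_law N. ennreal (exp (t * H x \<gamma> z)) = liminf (\<lambda>Q. ennreal (exp (?S \<gamma> Q)))"
      using AE_summable_fterm_\<gamma>[OF x z]
    proof eventually_elim
      case (elim \<gamma>)
      have "(\<lambda>Q. \<Sum>q<Q. fterm N x \<gamma> z q) \<longlonglongrightarrow> (\<Sum>q. fterm N x \<gamma> z q)"
        using elim by (rule summable_LIMSEQ)
      then have "(\<lambda>Q. ennreal (exp (?S \<gamma> Q))) \<longlonglongrightarrow> ennreal (exp (t * (v * (\<Sum>q. fterm N x \<gamma> z q))))"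
        by (intro tendsto_ennrealI tendsto_intros)
      then have "liminf (\<lambda>Q. ennreal (exp (?S \<gamma> Q))) = ennreal (exp (t * (v * (\<Sum>q. fterm N x \<gamma> z q))))"
        by (intro lim_imp_Liminf) auto
      then show ?case by (simp add: gfun_eq)
    qed
  qed
  also have "\<dots> \<le> liminf (\<lambda>Q. \<integral>\<^sup>+\<gamma>. ennreal (exp (?S \<gamma> Q)) \<partial>gauss_law N)"
    by (rule nn_integral_liminf) measurable
  also have "\<dots> \<le> limsup (\<lambda>Q. \<integral>\<^sup>+\<gamma>. ennreal (exp (?S \<gamma> Q)) \<partial>gauss_law N)"
    by (intro Liminf_le_Limsup) simp
  also have "\<dots> \<le> ennreal (exp (t\<^sup>2 * v\<^sup>2))"
    using part by (intro Limsup_bounded) auto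
  finally show ?thesis .
qed

text \<open>
  Moments under the disorder that are bounded at every point of the sphere are bounded after
  integration over \<open>\<nu>\<close>, by Tonelli's theorem.
\<close>

lemma nn_integral_field_le:
  fixes f :: "(nat list \<Rightarrow> real) \<Rightarrow> (nat \<Rightarrow> real) \<Rightarrow> ennreal"
  assumes f [measurable]: "(\<lambda>w. f (fst w) (snd w)) \<in> borel_measurable (gauss_law N \<Otimes>\<^sub>M \<nu>)"
    and B: "\<And>z. z \<in> unit_sphere N \<Longrightarrow> (\<integral>\<^sup>+\<gamma>. f \<gamma> z \<partial>gauss_law N) \<le> B"
  shows "(\<integral>\<^sup>+\<gamma>. \<integral>\<^sup>+z. f \<gamma> z \<partial>\<nu> \<partial>gauss_law N) \<le> B"
proof -
  have "(\<integral>\<^sup>+\<gamma>. \<integral>\<^sup>+z. f \<gamma> z \<partial>\<nu> \<partial>gauss_law N) = (\<integral>\<^sup>+z. \<integral>\<^sup>+\<gamma>. f \<gamma> z \<partial>gauss_law N \<partial>\<nu>)"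
    by (rule P\<nu>.Fubini'[symmetric]) (use f in \<open>simp add: split_beta'\<close>)
  also have "\<dots> \<le> (\<integral>\<^sup>+z. B \<partial>\<nu>)"
    using B by (intro nn_integral_mono) (simp add: space_\<nu>)
  finally show ?thesis by (simp add: \<nu>.emeasure_space_1)
qed

lemma AE_integrable_exp_gfun:
  assumes x: "x \<in> coef_box"
  shows "AE \<gamma> in gauss_law N. integrable \<nu> (\<lambda>z. exp (t * H x \<gamma> z))"
proof -
  have "(\<integral>\<^sup>+\<gamma>. \<integral>\<^sup>+z. ennreal (exp (t * H x \<gamma> z)) \<partial>\<nu> \<partial>gauss_law N) \<le> ennreal (exp (t\<^sup>2 * v\<^sup>2))"
    using nn_integral_exp_gfun_le[OF x] by (intro nn_integral_field_le) auto
  also have "\<dots> < \<infinity>" by simp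
  finally have "AE \<gamma> in gauss_law N. (\<integral>\<^sup>+z. ennreal (exp (t * H x \<gamma> z)) \<partial>\<nu>) \<noteq> \<infinity>"
    by (intro nn_integral_PInf_AE) (auto simp: less_top)
  then show ?thesis
    by (elim eventually_mono) (auto intro!: integrableI_nonneg simp: less_top)
qed

lemma AE_integrable_gfun:
  assumes x: "x \<in> coef_box"
  shows "AE \<gamma> in gauss_law N. integrable \<nu> (H x \<gamma>)"
proof -
  have "(\<integral>\<^sup>+\<gamma>. \<integral>\<^sup>+z. ennreal \<bar>H x \<gamma> z\<bar> \<partial>\<nu> \<partial>gauss_law N) \<le> ennreal (8 * v)"
    using nn_integral_abs_gfun_le[OF x] by (intro nn_integral_field_le) auto
  also have "\<dots> < \<infinity>" by simp
  finally have "AE \<gamma> in gauss_law N. (\<integral>\<^sup>+z. ennreal \<bar>H x \<gamma> z\<bar> \<partial>\<nu>) \<noteq> \<infinity>"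
    by (intro nn_integral_PInf_AE) (auto simp: less_top)
  then show ?thesis
    by (elim eventually_mono) (auto intro!: integrableI_bounded simp: less_top)
qed

text \<open>
  The disorders for which the Gibbs measure is a probability measure and the series for \<open>g\<close> may be
  manipulated linearly under \<open>\<nu>\<close>. They have full probability, and the property is stable under
  changing a single coefficient of the disorder or a single \<open>x\<^sub>p\<close>.
\<close>

definition good :: "(nat \<Rightarrow> real) \<Rightarrow> (nat list \<Rightarrow> real) \<Rightarrow> bool" where
  "good x \<gamma> \<longleftrightarrow> (AE z in \<nu>. summable (fterm N x \<gamma> z)) \<and> integrable \<nu> (\<lambda>z. exp (H x \<gamma> z))"

lemma AE_good:
  assumes x: "x \<in> coef_box"
  shows "AE \<gamma> in gauss_law N. good x \<gamma>"
  using AE_summable_fterm[OF x] AE_integrable_exp_gfun[OF x, of 1] by eventually_elim (simp add: good_def)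

definition free_energy :: "(nat \<Rightarrow> real) \<Rightarrow> (nat list \<Rightarrow> real) \<Rightarrow> real" where
  "free_energy x \<gamma> = ln (\<integral>z. exp (H x \<gamma> z) \<partial>\<nu>)"

lemma measurable_free_energy [measurable]: "free_energy x \<in> borel_measurable (gauss_law N)"
  unfolding free_energy_def[abs_def] by measurable

text \<open>
  Jensen's inequality gives the lower bound by the mean of \<open>g\<close>, and \<open>ln t \<le> t\<close> the upper one.
\<close>

lemma abs_free_energy_le:
  assumes "integrable \<nu> (\<lambda>z. exp (H x \<gamma> z))" "integrable \<nu> (H x \<gamma>)"
  shows "\<bar>free_energy x \<gamma>\<bar> \<le> (\<integral>z. \<bar>H x \<gamma> z\<bar> \<partial>\<nu>) + (\<integral>z. exp (H x \<gamma> z) \<partial>\<nu>)"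
proof -
  have Z: "0 < (\<integral>z. exp (H x \<gamma> z) \<partial>\<nu>)"
    by (rule integral_exp_pos[OF prob_\<nu> assms(1)])
  have "(\<integral>z. H x \<gamma> z \<partial>tilt \<nu> (\<lambda>_. 0)) \<le> ln (\<integral>z. exp (0 + H x \<gamma> z) \<partial>\<nu>) - ln (\<integral>z. exp 0 \<partial>\<nu>)"
    using assms by (intro tilt_jensen[OF prob_\<nu>] integrable_tilt) auto
  then have "(\<integral>z. H x \<gamma> z \<partial>\<nu>) \<le> free_energy x \<gamma>"
    by (simp add: integral_tilt free_energy_def \<nu>.prob_space)
  moreover have "\<bar>\<integral>z. H x \<gamma> z \<partial>\<nu>\<bar> \<le> (\<integral>z. \<bar>H x \<gamma> z\<bar> \<partial>\<nu>)"
    by (rule integral_abs_bound)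
  moreover have "free_energy x \<gamma> \<le> (\<integral>z. exp (H x \<gamma> z) \<partial>\<nu>)"
    unfolding free_energy_def using ln_le_minus_one[OF Z] by linarith
  moreover have "0 \<le> (\<integral>z. \<bar>H x \<gamma> z\<bar> \<partial>\<nu>)" by simp
  ultimately show ?thesis using Z by linarith
qed

lemma nn_integral_abs_free_energy_le:
  assumes x: "x \<in> coef_box"
  shows "(\<integral>\<^sup>+\<gamma>. ennreal \<bar>free_energy x \<gamma>\<bar> \<partial>gauss_law N) \<le> ennreal (8 * v + exp (v\<^sup>2))"
proof -
  have "(\<integral>\<^sup>+\<gamma>. ennreal \<bar>free_energy x \<gamma>\<bar> \<partial>gauss_law N)
    \<le> (\<integral>\<^sup>+\<gamma>. (\<integral>\<^sup>+z. ennreal \<bar>H x \<gamma> z\<bar> \<partial>\<nu>) + (\<integral>\<^sup>+z. ennreal (exp (1 * H x \<gamma> z)) \<partial>\<nu>) \<partial>gauss_law N)"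
  proof (rule nn_integral_mono_AE)
    show "AE \<gamma> in gauss_law N. ennreal \<bar>free_energy x \<gamma>\<bar> \<le> (\<integral>\<^sup>+z. ennreal \<bar>H x \<gamma> z\<bar> \<partial>\<nu>) + (\<integral>\<^sup>+z. ennreal (exp (1 * H x \<gamma> z)) \<partial>\<nu>)"
      using AE_integrable_exp_gfun[OF x, of 1] AE_integrable_gfun[OF x]
    proof eventually_elim
      case (elim \<gamma>)
      then have "ennreal \<bar>free_energy x \<gamma>\<bar> \<le> ennreal ((\<integral>z. \<bar>H x \<gamma> z\<bar> \<partial>\<nu>) + (\<integral>z. exp (H x \<gamma> z) \<partial>\<nu>))"
        by (intro ennreal_leI abs_free_energy_le) auto
      also have "\<dots> = (\<integral>\<^sup>+z. ennreal \<bar>H x \<gamma> z\<bar> \<partial>\<nu>) + (\<integral>\<^sup>+z. ennreal (exp (1 * H x \<gamma> z)) \<partial>\<nu>)"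
        using elim by (subst (1 2) nn_integral_eq_integral) auto
      finally show ?case .
    qed
  qed
  also have "\<dots> = (\<integral>\<^sup>+\<gamma>. \<integral>\<^sup>+z. ennreal \<bar>H x \<gamma> z\<bar> \<partial>\<nu> \<partial>gauss_law N) + (\<integral>\<^sup>+\<gamma>. \<integral>\<^sup>+z. ennreal (exp (1 * H x \<gamma> z)) \<partial>\<nu> \<partial>gauss_law N)"
    by (rule nn_integral_add) measurable
  also have "\<dots> \<le> ennreal (8 * v) + ennreal (exp (1\<^sup>2 * v\<^sup>2))"
    by (intro add_mono nn_integral_field_le nn_integral_abs_gfun_le[OF x] nn_integral_exp_gfun_le[OF x]) auto
  also have "\<dots> = ennreal (8 * v + exp (v\<^sup>2))"
    using v_nonneg by (simp add: ennreal_plus)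
  finally show ?thesis .
qed

lemma nn_integral_abs_free_energy_finite:
  assumes x: "x \<in> coef_box"
  shows "(\<integral>\<^sup>+\<gamma>. ennreal \<bar>free_energy x \<gamma>\<bar> \<partial>gauss_law N) < \<infinity>"
  using nn_integral_abs_free_energy_le[OF x] by (rule order_le_less_trans) simp

lemma integrable_free_energy: "x \<in> coef_box \<Longrightarrow> integrable (gauss_law N) (free_energy x)"
  using nn_integral_abs_free_energy_finite[of x] by (intro integrableI_bounded) auto

end

section \<open>Concentration of the free energy\<close>

definition comb :: "nat \<Rightarrow> real \<Rightarrow> real \<Rightarrow> (nat list \<Rightarrow> real) \<Rightarrow> (nat list \<Rightarrow> real) \<Rightarrow> nat list \<Rightarrow> real" where
  "comb N c s \<gamma> \<gamma>' = (\<lambda>is\<in>indices N. c * \<gamma> is + s * \<gamma>' is)"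

lemma gp_comb:
  assumes "1 \<le> p"
  shows "gp N (comb N c s \<gamma> \<gamma>') p z = c * gp N \<gamma> p z + s * gp N \<gamma>' p z"
proof -
  have "comb N c s \<gamma> \<gamma>' is = c * \<gamma> is + s * \<gamma>' is" if "is \<in> multi_indices N p" for "is"
    using assms that by (auto simp: comb_def)
  then show ?thesis
    by (simp add: gp_eq sum_distrib_left sum.distrib[symmetric] algebra_simps)
qed

lemma fterm_comb: "fterm N x (comb N c s \<gamma> \<gamma>') z q = c * fterm N x \<gamma> z q + s * fterm N x \<gamma>' z q"
  by (simp add: fterm_def gp_comb algebra_simps)

lemma gfun_comb:
  assumes "summable (fterm N x \<gamma> z)" "summable (fterm N x \<gamma>' z)"
  shows "gfun N v x (comb N c s \<gamma> \<gamma>') z = c * gfun N v x \<gamma> z + s * gfun N v x \<gamma>' z"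
  using assms
  by (simp add: gfun_eq fterm_comb suminf_add[symmetric] suminf_mult summable_mult algebra_simps)

lemma comb_comb:
  "comb N c s (comb N a b \<gamma> \<gamma>') (comb N a' b' \<gamma> \<gamma>') = comb N (c * a + s * a') (c * b + s * b') \<gamma> \<gamma>'"
  by (auto simp: comb_def algebra_simps intro!: restrict_ext)

lemma comb_1_0: "\<gamma> \<in> space (gauss_law N) \<Longrightarrow> comb N 1 0 \<gamma> \<gamma>' = \<gamma>"
  by (auto simp: comb_def space_gauss_law PiE_iff extensional_restrict cong: restrict_cong)

lemma comb_0_1: "\<gamma>' \<in> space (gauss_law N) \<Longrightarrow> comb N 0 1 \<gamma> \<gamma>' = \<gamma>'"
  by (auto simp: comb_def space_gauss_law PiE_iff extensional_restrict cong: restrict_cong)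

lemma measurable_comb [measurable]:
  "(\<lambda>w. comb N c s (fst w) (snd w)) \<in> gauss_law N \<Otimes>\<^sub>M gauss_law N \<rightarrow>\<^sub>M gauss_law N"
proof -
  have "(\<lambda>w. comb N c s (fst w) (snd w)) \<in> gauss_law N \<Otimes>\<^sub>M gauss_law N \<rightarrow>\<^sub>M PiM (indices N) (\<lambda>_. borel)"
    unfolding comb_def
  proof (rule measurable_restrict)
    fix "is" assume "is": "is \<in> indices N"
    note [measurable] = measurable_gauss_law_component[OF this]
    show "(\<lambda>w. c * fst w is + s * snd w is) \<in> borel_measurable (gauss_law N \<Otimes>\<^sub>M gauss_law N)"
      by measurable
  qed
  then show ?thesis by (simp cong: measurable_cong_sets add: sets_gauss_law)
qed

text \<open>
  The planar rotation invariance, applied to each coefficient of two independent disorders.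
\<close>

lemma gauss_law_rotation:
  assumes cs: "c\<^sup>2 + s\<^sup>2 = 1" "c > 0"
  shows "distr (gauss_law N \<Otimes>\<^sub>M gauss_law N) (gauss_law N \<Otimes>\<^sub>M gauss_law N)
      (\<lambda>w. (comb N c s (fst w) (snd w), comb N (- s) c (fst w) (snd w))) = gauss_law N \<Otimes>\<^sub>M gauss_law N"
proof -
  let ?r = "\<lambda>(x::real, y). (c * x + s * y, c * y - s * x)"
  have "?r \<in> borel \<Otimes>\<^sub>M borel \<rightarrow>\<^sub>M borel \<Otimes>\<^sub>M borel" by measurable
  then have r: "?r \<in> std_normal_distribution \<Otimes>\<^sub>M std_normal_distribution \<rightarrow>\<^sub>M std_normal_distribution \<Otimes>\<^sub>M std_normal_distribution"
    by (simp cong: measurable_cong_sets sets_pair_measure_cong)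
  from distr_pair_PiM_of_pair[OF prob_space_std_normal r std_normal_rotation[OF cs], of "indices N"]
  have "distr (gauss_law N \<Otimes>\<^sub>M gauss_law N) (gauss_law N \<Otimes>\<^sub>M gauss_law N)
      (\<lambda>(\<omega>, \<omega>'). (\<lambda>i\<in>indices N. fst (?r (\<omega> i, \<omega>' i)), \<lambda>i\<in>indices N. snd (?r (\<omega> i, \<omega>' i))))
    = gauss_law N \<Otimes>\<^sub>M gauss_law N" by (simp only: gauss_law_def)
  also have "(\<lambda>(\<omega>, \<omega>'). (\<lambda>i\<in>indices N. fst (?r (\<omega> i, \<omega>' i)), \<lambda>i\<in>indices N. snd (?r (\<omega> i, \<omega>' i))))
      = (\<lambda>w. (comb N c s (fst w) (snd w), comb N (- s) c (fst w) (snd w)))"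
    by (auto simp: comb_def fun_eq_iff)
  finally show ?thesis .
qed

context sphere_field
begin

text \<open>
  Along a rotation the exponent \<open>g\<close> changes to \<open>g + ((c - 1) g + s g')\<close>, and Jensen's inequality
  averages the increment under the Gibbs measure of \<open>g\<close> alone. That measure is independent of \<open>g'\<close>.
\<close>

lemma free_energy_diff_le:
  assumes g: "good x \<gamma>" "AE z in \<nu>. summable (fterm N x \<gamma>' z)" "good x (comb N c s \<gamma> \<gamma>')"
  shows "ennreal (free_energy x \<gamma> - free_energy x (comb N c s \<gamma> \<gamma>'))
    \<le> ennreal \<bar>1 - c\<bar> * (\<integral>\<^sup>+z. ennreal \<bar>H x \<gamma> z\<bar> \<partial>gibbs x \<gamma>)
      + ennreal \<bar>s\<bar> * (\<integral>\<^sup>+z. ennreal \<bar>H x \<gamma>' z\<bar> \<partial>gibbs x \<gamma>)"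
proof -
  let ?g = "H x \<gamma>" and ?g' = "H x \<gamma>'"
  let ?h = "\<lambda>z. (c - 1) * ?g z + s * ?g' z"
  let ?T = "tilt \<nu> ?g"
  have Z: "integrable \<nu> (\<lambda>z. exp (?g z))" using g(1) by (simp add: good_def)
  have eq: "AE z in \<nu>. H x (comb N c s \<gamma> \<gamma>') z = ?g z + ?h z"
  proof -
    have "AE z in \<nu>. summable (fterm N x \<gamma> z)" using g(1) by (simp add: good_def)
    with g(2) show "AE z in \<nu>. H x (comb N c s \<gamma> \<gamma>') z = ?g z + ?h z"
      by eventually_elim (simp add: gfun_comb algebra_simps)
  qed
  have Z': "integrable \<nu> (\<lambda>z. exp (?g z + ?h z))"
  proof (rule integrable_cong_AE_imp)
    show "integrable \<nu> (\<lambda>z. exp (H x (comb N c s \<gamma> \<gamma>') z))" using g(3) by (simp add: good_def)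
    show "AE z in \<nu>. exp (H x (comb N c s \<gamma> \<gamma>') z) = exp (?g z + ?h z)"
      using eq by eventually_elim simp
  qed measurable
  have p: "free_energy x (comb N c s \<gamma> \<gamma>') = ln (\<integral>z. exp (?g z + ?h z) \<partial>\<nu>)"
  proof -
    have "(\<integral>z. exp (H x (comb N c s \<gamma> \<gamma>') z) \<partial>\<nu>) = (\<integral>z. exp (?g z + ?h z) \<partial>\<nu>)"
      using eq by (intro integral_cong_AE) (auto elim: eventually_mono)
    then show ?thesis by (simp add: free_energy_def)
  qed
  have "ennreal (free_energy x \<gamma> - free_energy x (comb N c s \<gamma> \<gamma>')) \<le> (\<integral>\<^sup>+z. ennreal \<bar>?h z\<bar> \<partial>?T)"
  proof (cases "(\<integral>\<^sup>+z. ennreal \<bar>?h z\<bar> \<partial>?T) = \<top>")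
    case False
    then have i: "integrable ?T ?h"
      by (intro integrableI_bounded) (auto simp: top.not_eq_extremum)
    have "(\<integral>z. ?h z \<partial>?T) \<le> free_energy x (comb N c s \<gamma> \<gamma>') - free_energy x \<gamma>"
      unfolding p unfolding free_energy_def by (rule tilt_jensen[OF prob_\<nu> _ _ Z Z' i]) measurable
    moreover have "\<bar>\<integral>z. ?h z \<partial>?T\<bar> \<le> (\<integral>z. \<bar>?h z\<bar> \<partial>?T)" by (rule integral_abs_bound)
    ultimately have "free_energy x \<gamma> - free_energy x (comb N c s \<gamma> \<gamma>') \<le> (\<integral>z. \<bar>?h z\<bar> \<partial>?T)" by linarith
    then have "ennreal (free_energy x \<gamma> - free_energy x (comb N c s \<gamma> \<gamma>')) \<le> ennreal (\<integral>z. \<bar>?h z\<bar> \<partial>?T)"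
      by (rule ennreal_leI)
    also have "\<dots> = (\<integral>\<^sup>+z. ennreal \<bar>?h z\<bar> \<partial>?T)"
      using i by (intro nn_integral_eq_integral[symmetric]) auto
    finally show ?thesis .
  qed simp
  also have "\<dots> \<le> (\<integral>\<^sup>+z. ennreal \<bar>1 - c\<bar> * ennreal \<bar>?g z\<bar> + ennreal \<bar>s\<bar> * ennreal \<bar>?g' z\<bar> \<partial>?T)"
  proof (rule nn_integral_mono)
    fix z
    have "\<bar>?h z\<bar> \<le> \<bar>1 - c\<bar> * \<bar>?g z\<bar> + \<bar>s\<bar> * \<bar>?g' z\<bar>"
      using abs_triangle_ineq[of "(c - 1) * ?g z" "s * ?g' z"] by (simp add: abs_mult abs_minus_commute)
    then show "ennreal \<bar>?h z\<bar> \<le> ennreal \<bar>1 - c\<bar> * ennreal \<bar>?g z\<bar> + ennreal \<bar>s\<bar> * ennreal \<bar>?g' z\<bar>"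
      by (simp add: ennreal_mult[symmetric] ennreal_leI flip: ennreal_plus)
  qed
  also have "\<dots> = ennreal \<bar>1 - c\<bar> * (\<integral>\<^sup>+z. ennreal \<bar>?g z\<bar> \<partial>?T) + ennreal \<bar>s\<bar> * (\<integral>\<^sup>+z. ennreal \<bar>?g' z\<bar> \<partial>?T)"
    by (subst nn_integral_add) (auto simp: nn_integral_cmult)
  finally show ?thesis .
qed

text \<open>
  In the estimate of a rotation by a small angle this quantity is multiplied by the square of the
  angle, hence only its finiteness matters.
\<close>

definition gibbs_abs :: "(nat \<Rightarrow> real) \<Rightarrow> ennreal" where
  "gibbs_abs x = (\<integral>\<^sup>+\<gamma>. \<integral>\<^sup>+z. ennreal \<bar>H x \<gamma> z\<bar> \<partial>gibbs x \<gamma> \<partial>gauss_law N)"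

lemma nn_integral_tilt:
  assumes [measurable]: "h \<in> borel_measurable \<nu>"
  shows "(\<integral>\<^sup>+z. h z \<partial>gibbs x \<gamma>)
    = (\<integral>\<^sup>+z. ennreal (exp (H x \<gamma> z) / (\<integral>z'. exp (H x \<gamma> z') \<partial>\<nu>)) * h z \<partial>\<nu>)"
  unfolding tilt_def by (rule nn_integral_density) measurable

lemma measurable_normalizer [measurable]:
  "(\<lambda>\<gamma>. \<integral>z. exp (H x \<gamma> z) \<partial>\<nu>) \<in> borel_measurable (gauss_law N)"
  by measurable

lemma measurable_two_fields [measurable]:
  "(\<lambda>(w, z). ennreal (exp (H x (fst w) z) / (\<integral>z'. exp (H x (fst w) z') \<partial>\<nu>)) * ennreal \<bar>H x (snd w) z\<bar>)
    \<in> borel_measurable ((gauss_law N \<Otimes>\<^sub>M gauss_law N) \<Otimes>\<^sub>M \<nu>)"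
proof -
  let ?P = "gauss_law N"
  have [measurable]: "(\<lambda>w. H x (snd (fst w)) (snd w)) \<in> borel_measurable ((?P \<Otimes>\<^sub>M ?P) \<Otimes>\<^sub>M \<nu>)"
    by (rule measurable_gfun) measurable
  have [measurable]: "(\<lambda>w. H x (fst (fst w)) (snd w)) \<in> borel_measurable ((?P \<Otimes>\<^sub>M ?P) \<Otimes>\<^sub>M \<nu>)"
    by (rule measurable_gfun) measurable
  have "(\<lambda>w. fst (fst w)) \<in> (?P \<Otimes>\<^sub>M ?P) \<Otimes>\<^sub>M \<nu> \<rightarrow>\<^sub>M ?P" by measurable
  from measurable_compose[OF this measurable_normalizer]
  have [measurable]: "(\<lambda>w. \<integral>z'. exp (H x (fst (fst w)) z') \<partial>\<nu>) \<in> borel_measurable ((?P \<Otimes>\<^sub>M ?P) \<Otimes>\<^sub>M \<nu>)" .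
  show ?thesis unfolding split_beta' by measurable
qed

lemma measurable_cross_abs [measurable]:
  "(\<lambda>w. \<integral>\<^sup>+z. ennreal \<bar>H x (snd w) z\<bar> \<partial>tilt \<nu> (H x (fst w))) \<in> borel_measurable (gauss_law N \<Otimes>\<^sub>M gauss_law N)"
proof -
  have "(\<lambda>w. \<integral>\<^sup>+z. ennreal \<bar>H x (snd w) z\<bar> \<partial>tilt \<nu> (H x (fst w)))
     = (\<lambda>w. \<integral>\<^sup>+z. ennreal (exp (H x (fst w) z) / (\<integral>z'. exp (H x (fst w) z') \<partial>\<nu>)) * ennreal \<bar>H x (snd w) z\<bar> \<partial>\<nu>)"
    by (intro ext nn_integral_tilt) measurable
  also have "\<dots> \<in> borel_measurable (gauss_law N \<Otimes>\<^sub>M gauss_law N)"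
    by (rule \<nu>.borel_measurable_nn_integral[OF measurable_two_fields])
  finally show ?thesis .
qed

lemma measurable_self_abs [measurable]:
  "(\<lambda>\<gamma>. \<integral>\<^sup>+z. ennreal \<bar>H x \<gamma> z\<bar> \<partial>gibbs x \<gamma>) \<in> borel_measurable (gauss_law N)"
  using measurable_compose[OF _ measurable_cross_abs, of "\<lambda>\<gamma>. (\<gamma>, \<gamma>)" "gauss_law N"] by simp

text \<open>
  Jensen's inequality with the increment \<open>|g|\<close> compares \<open>\<langle>|g|\<rangle>\<close> with the logarithm of the integral of
  \<open>exp (g + |g|) \<le> exp (2 g) + 1\<close>.
\<close>

lemma gibbs_abs_finite:
  assumes x: "x \<in> coef_box"
  shows "gibbs_abs x < \<infinity>"
proof -
  have "gibbs_abs x \<le> (\<integral>\<^sup>+\<gamma>. (\<integral>\<^sup>+z. ennreal (exp (2 * H x \<gamma> z)) \<partial>\<nu>) + (1 + ennreal \<bar>free_energy x \<gamma>\<bar>) \<partial>gauss_law N)"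
    unfolding gibbs_abs_def
  proof (rule nn_integral_mono_AE)
    show "AE \<gamma> in gauss_law N. (\<integral>\<^sup>+z. ennreal \<bar>H x \<gamma> z\<bar> \<partial>gibbs x \<gamma>)
        \<le> (\<integral>\<^sup>+z. ennreal (exp (2 * H x \<gamma> z)) \<partial>\<nu>) + (1 + ennreal \<bar>free_energy x \<gamma>\<bar>)"
      using AE_good[OF x] AE_integrable_exp_gfun[OF x, of 2]
    proof eventually_elim
      case (elim \<gamma>)
      let ?g = "H x \<gamma>"
      let ?T = "tilt \<nu> ?g"
      have Z: "integrable \<nu> (\<lambda>z. exp (?g z))" using elim by (simp add: good_def)
      have b: "exp (u + \<bar>u\<bar>) \<le> exp (2 * u) + 1" for u :: real
        by (cases "0 \<le> u") (auto simp: add_increasing)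
      have i1: "integrable \<nu> (\<lambda>z. exp (?g z + \<bar>?g z\<bar>))"
        by (rule Bochner_Integration.integrable_bound[of _ "\<lambda>z. exp (2 * ?g z) + 1"]) (use elim b in \<open>auto intro!: AE_I2\<close>)
      have "integrable \<nu> (\<lambda>z. exp (?g z) * \<bar>?g z\<bar>)"
      proof (rule Bochner_Integration.integrable_bound[OF i1])
        show "AE z in \<nu>. norm (exp (?g z) * \<bar>?g z\<bar>) \<le> norm (exp (?g z + \<bar>?g z\<bar>))"
        proof (rule AE_I2)
          fix z
          have "\<bar>?g z\<bar> \<le> exp \<bar>?g z\<bar>" using exp_ge_add_one_self[of "\<bar>?g z\<bar>"] by linarith
          then show "norm (exp (?g z) * \<bar>?g z\<bar>) \<le> norm (exp (?g z + \<bar>?g z\<bar>))"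
            by (simp add: exp_add abs_mult)
        qed
      qed measurable
      then have i2: "integrable ?T (\<lambda>z. \<bar>?g z\<bar>)" by (intro integrable_tilt) auto
      have "(\<integral>z. \<bar>?g z\<bar> \<partial>?T) \<le> ln (\<integral>z. exp (?g z + \<bar>?g z\<bar>) \<partial>\<nu>) - free_energy x \<gamma>"
        unfolding free_energy_def by (rule tilt_jensen[OF prob_\<nu> _ _ Z i1 i2]) measurable
      also have "ln (\<integral>z. exp (?g z + \<bar>?g z\<bar>) \<partial>\<nu>) \<le> (\<integral>z. exp (?g z + \<bar>?g z\<bar>) \<partial>\<nu>)"
        using ln_le_minus_one[OF integral_exp_pos[OF prob_\<nu> i1]] by linarith
      also have "\<dots> \<le> (\<integral>z. exp (2 * ?g z) + 1 \<partial>\<nu>)"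
        using i1 b elim by (intro integral_mono) auto
      also have "\<dots> = (\<integral>z. exp (2 * ?g z) \<partial>\<nu>) + 1"
        using elim \<nu>.prob_space by simp
      finally have "(\<integral>z. \<bar>?g z\<bar> \<partial>?T) \<le> (\<integral>z. exp (2 * ?g z) \<partial>\<nu>) + (1 + \<bar>free_energy x \<gamma>\<bar>)"
        by linarith
      then have "ennreal (\<integral>z. \<bar>?g z\<bar> \<partial>?T) \<le> ennreal ((\<integral>z. exp (2 * ?g z) \<partial>\<nu>) + (1 + \<bar>free_energy x \<gamma>\<bar>))"
        by (rule ennreal_leI)
      also have "\<dots> = ennreal (\<integral>z. exp (2 * ?g z) \<partial>\<nu>) + (1 + ennreal \<bar>free_energy x \<gamma>\<bar>)"
        by (simp add: ennreal_plus)
      also have "ennreal (\<integral>z. \<bar>?g z\<bar> \<partial>?T) = (\<integral>\<^sup>+z. ennreal \<bar>?g z\<bar> \<partial>?T)"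
        using i2 by (intro nn_integral_eq_integral[symmetric]) auto
      also have "ennreal (\<integral>z. exp (2 * ?g z) \<partial>\<nu>) = (\<integral>\<^sup>+z. ennreal (exp (2 * ?g z)) \<partial>\<nu>)"
        using elim by (intro nn_integral_eq_integral[symmetric]) auto
      finally show ?case .
    qed
  qed
  also have "\<dots> = (\<integral>\<^sup>+\<gamma>. \<integral>\<^sup>+z. ennreal (exp (2 * H x \<gamma> z)) \<partial>\<nu> \<partial>gauss_law N)
      + (1 + (\<integral>\<^sup>+\<gamma>. ennreal \<bar>free_energy x \<gamma>\<bar> \<partial>gauss_law N))"
    by (simp add: nn_integral_add P.emeasure_space_1)
  also have "\<dots> < \<infinity>"
  proof -
    have "(\<integral>\<^sup>+\<gamma>. \<integral>\<^sup>+z. ennreal (exp (2 * H x \<gamma> z)) \<partial>\<nu> \<partial>gauss_law N) \<le> ennreal (exp (2\<^sup>2 * v\<^sup>2))"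
      by (intro nn_integral_field_le nn_integral_exp_gfun_le[OF x]) auto
    also have "\<dots> < \<infinity>" by simp
    finally show ?thesis using nn_integral_abs_free_energy_finite[OF x] by simp
  qed
  finally show ?thesis .
qed

text \<open>
  The field in the integrand is independent of the one that defines the Gibbs measure, so it can be
  integrated first, at a fixed \<open>z\<close>, where its first absolute moment is at most \<open>8 v\<close>.
\<close>

lemma nn_integral_gibbs_independent_le:
  assumes x: "x \<in> coef_box"
  shows "(\<integral>\<^sup>+w. \<integral>\<^sup>+z. ennreal \<bar>H x (snd w) z\<bar> \<partial>tilt \<nu> (H x (fst w)) \<partial>(gauss_law N \<Otimes>\<^sub>M gauss_law N)) \<le> ennreal (8 * v)"
proof -
  let ?P = "gauss_law N"
  let ?w = "\<lambda>\<gamma> z. ennreal (exp (H x \<gamma> z) / (\<integral>z'. exp (H x \<gamma> z') \<partial>\<nu>))"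
  have "(\<integral>\<^sup>+w. \<integral>\<^sup>+z. ennreal \<bar>H x (snd w) z\<bar> \<partial>tilt \<nu> (H x (fst w)) \<partial>(?P \<Otimes>\<^sub>M ?P))
    = (\<integral>\<^sup>+w. \<integral>\<^sup>+z. ?w (fst w) z * ennreal \<bar>H x (snd w) z\<bar> \<partial>\<nu> \<partial>(?P \<Otimes>\<^sub>M ?P))"
    by (intro nn_integral_cong nn_integral_tilt) measurable
  also have "\<dots> = (\<integral>\<^sup>+\<gamma>. \<integral>\<^sup>+\<gamma>'. \<integral>\<^sup>+z. ?w \<gamma> z * ennreal \<bar>H x \<gamma>' z\<bar> \<partial>\<nu> \<partial>?P \<partial>?P)"
    using P.nn_integral_fst[OF \<nu>.borel_measurable_nn_integral[OF measurable_two_fields]] by simp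
  also have "\<dots> \<le> (\<integral>\<^sup>+\<gamma>. ennreal (8 * v) \<partial>?P)"
  proof (rule nn_integral_mono)
    fix \<gamma>
    have "(\<integral>\<^sup>+\<gamma>'. \<integral>\<^sup>+z. ?w \<gamma> z * ennreal \<bar>H x \<gamma>' z\<bar> \<partial>\<nu> \<partial>?P)
        = (\<integral>\<^sup>+z. \<integral>\<^sup>+\<gamma>'. ?w \<gamma> z * ennreal \<bar>H x \<gamma>' z\<bar> \<partial>?P \<partial>\<nu>)"
      by (rule P\<nu>.Fubini'[symmetric]) (simp add: split_beta')
    also have "\<dots> \<le> (\<integral>\<^sup>+z. ?w \<gamma> z * ennreal (8 * v) \<partial>\<nu>)"
    proof (rule nn_integral_mono)
      fix z assume "z \<in> space \<nu>"
      then have z: "z \<in> unit_sphere N" by (simp add: space_\<nu>)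
      note [measurable] = measurable_gfun_\<gamma>[OF z]
      have "(\<integral>\<^sup>+\<gamma>'. ?w \<gamma> z * ennreal \<bar>H x \<gamma>' z\<bar> \<partial>?P) = ?w \<gamma> z * (\<integral>\<^sup>+\<gamma>'. ennreal \<bar>H x \<gamma>' z\<bar> \<partial>?P)"
        by (rule nn_integral_cmult) measurable
      also have "\<dots> \<le> ?w \<gamma> z * ennreal (8 * v)"
        by (intro mult_left_mono nn_integral_abs_gfun_le[OF x z]) simp
      finally show "(\<integral>\<^sup>+\<gamma>'. ?w \<gamma> z * ennreal \<bar>H x \<gamma>' z\<bar> \<partial>?P) \<le> ?w \<gamma> z * ennreal (8 * v)" .
    qed
    also have "\<dots> = (\<integral>\<^sup>+z. ennreal (8 * v) \<partial>gibbs x \<gamma>)"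
      by (rule nn_integral_tilt[symmetric]) measurable
    also have "\<dots> = ennreal (8 * v) * emeasure (gibbs x \<gamma>) (space \<nu>)"
      by simp
    also have "\<dots> \<le> ennreal (8 * v) * 1"
    proof (rule mult_left_mono)
      show "emeasure (gibbs x \<gamma>) (space \<nu>) \<le> 1"
      proof (cases "integrable \<nu> (\<lambda>z. exp (H x \<gamma> z))")
        case True
        then interpret T: prob_space "gibbs x \<gamma>" by (rule prob_space_tilt[OF prob_\<nu>])
        show ?thesis using T.emeasure_space_1 by simp
      next
        case False
        show ?thesis
          by (simp add: tilt_def not_integrable_integral_eq[OF False] emeasure_density)
      qed
    qed simp
    finally show "(\<integral>\<^sup>+\<gamma>'. \<integral>\<^sup>+z. ?w \<gamma> z * ennreal \<bar>H x \<gamma>' z\<bar> \<partial>\<nu> \<partial>?P) \<le> ennreal (8 * v)" by simp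
  qed
  finally show ?thesis by (simp add: P.emeasure_space_1)
qed

definition rot :: "real \<Rightarrow> (nat list \<Rightarrow> real) \<times> (nat list \<Rightarrow> real) \<Rightarrow> nat list \<Rightarrow> real" where
  "rot \<theta> w = comb N (cos \<theta>) (sin \<theta>) (fst w) (snd w)"

lemma measurable_rot [measurable]: "rot \<theta> \<in> gauss_law N \<Otimes>\<^sub>M gauss_law N \<rightarrow>\<^sub>M gauss_law N"
  unfolding rot_def[abs_def] by measurable

text \<open>
  The rotation of a pair of disorders by the angle \<open>\<theta>\<close>; its second component is the first one,
  advanced by a quarter turn.
\<close>

definition turn :: "real \<Rightarrow> (nat list \<Rightarrow> real) \<times> (nat list \<Rightarrow> real) \<Rightarrow> (nat list \<Rightarrow> real) \<times> (nat list \<Rightarrow> real)" where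
  "turn \<theta> w = (rot \<theta> w, rot (\<theta> + pi / 2) w)"

lemma turn_eq: "turn \<theta> w = (comb N (cos \<theta>) (sin \<theta>) (fst w) (snd w), comb N (- sin \<theta>) (cos \<theta>) (fst w) (snd w))"
  by (simp add: turn_def rot_def cos_add sin_add)

lemma measurable_turn [measurable]: "turn \<theta> \<in> gauss_law N \<Otimes>\<^sub>M gauss_law N \<rightarrow>\<^sub>M gauss_law N \<Otimes>\<^sub>M gauss_law N"
  unfolding turn_def[abs_def] by measurable

lemma distr_turn:
  assumes "cos \<theta> > 0"
  shows "distr (gauss_law N \<Otimes>\<^sub>M gauss_law N) (gauss_law N \<Otimes>\<^sub>M gauss_law N) (turn \<theta>) = gauss_law N \<Otimes>\<^sub>M gauss_law N"
  unfolding turn_eq[abs_def] by (rule gauss_law_rotation) (use assms in simp_all)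

lemma rot_turn: "rot b (turn a w) = rot (a + b) w"
  by (simp add: turn_eq rot_def comb_comb cos_add sin_add algebra_simps)

lemma rot_0: "w \<in> space (gauss_law N \<Otimes>\<^sub>M gauss_law N) \<Longrightarrow> rot 0 w = fst w"
  by (auto simp: rot_def comb_1_0 space_pair_measure)

lemma rot_pi_half: "w \<in> space (gauss_law N \<Otimes>\<^sub>M gauss_law N) \<Longrightarrow> rot (pi/2) w = snd w"
  by (auto simp: rot_def comb_0_1 space_pair_measure)

lemma nn_integral_turn:
  assumes "cos \<theta> > 0" and [measurable]: "F \<in> borel_measurable (gauss_law N \<Otimes>\<^sub>M gauss_law N)"
  shows "(\<integral>\<^sup>+w. F (turn \<theta> w) \<partial>(gauss_law N \<Otimes>\<^sub>M gauss_law N)) = (\<integral>\<^sup>+w. F w \<partial>(gauss_law N \<Otimes>\<^sub>M gauss_law N))"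
proof -
  have "(\<integral>\<^sup>+w. F w \<partial>(gauss_law N \<Otimes>\<^sub>M gauss_law N))
     = (\<integral>\<^sup>+w. F w \<partial>distr (gauss_law N \<Otimes>\<^sub>M gauss_law N) (gauss_law N \<Otimes>\<^sub>M gauss_law N) (turn \<theta>))"
    by (simp only: distr_turn[OF assms(1)])
  also have "\<dots> = (\<integral>\<^sup>+w. F (turn \<theta> w) \<partial>(gauss_law N \<Otimes>\<^sub>M gauss_law N))"
    by (rule nn_integral_distr) measurable
  finally show ?thesis ..
qed

lemma AE_fst:
  assumes "AE \<gamma> in gauss_law N. Q \<gamma>"
  shows "AE w in gauss_law N \<Otimes>\<^sub>M gauss_law N. Q (fst w)"
  by (rule AE_distrD[OF measurable_fst]) (simp only: P.distr_pair_fst assms)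

lemma AE_snd:
  assumes "AE \<gamma> in gauss_law N. Q \<gamma>"
  shows "AE w in gauss_law N \<Otimes>\<^sub>M gauss_law N. Q (snd w)"
proof (rule AE_distrD[of snd _ "gauss_law N"])
  have "distr (gauss_law N \<Otimes>\<^sub>M gauss_law N) (gauss_law N) snd = gauss_law N"
  proof (rule measure_eqI)
    fix A assume "A \<in> sets (distr (gauss_law N \<Otimes>\<^sub>M gauss_law N) (gauss_law N) snd)"
    then have A: "A \<in> sets (gauss_law N)" by simp
    then have "snd -` A \<inter> space (gauss_law N \<Otimes>\<^sub>M gauss_law N) = space (gauss_law N) \<times> A"
      using sets.sets_into_space[OF A] by (auto simp: space_pair_measure)
    with A show "emeasure (distr (gauss_law N \<Otimes>\<^sub>M gauss_law N) (gauss_law N) snd) A = emeasure (gauss_law N) A"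
      by (simp add: emeasure_distr P.emeasure_pair_measure_Times P.emeasure_space_1)
  qed simp
  then show "AE \<gamma> in distr (gauss_law N \<Otimes>\<^sub>M gauss_law N) (gauss_law N) snd. Q \<gamma>" by (simp only: assms)
qed simp

lemma AE_rot:
  assumes c: "cos \<theta> > 0" and Q: "AE \<gamma> in gauss_law N. Q \<gamma>"
  shows "AE w in gauss_law N \<Otimes>\<^sub>M gauss_law N. Q (rot \<theta> w)"
proof -
  have "AE w in gauss_law N \<Otimes>\<^sub>M gauss_law N. Q (fst (turn \<theta> w))"
    by (rule AE_distrD[OF measurable_turn]) (simp only: distr_turn[OF c] AE_fst[OF Q])
  then show ?thesis by (simp add: turn_def)
qed

definition free_energy_dist :: "(nat \<Rightarrow> real) \<Rightarrow> real \<Rightarrow> ennreal" where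
  "free_energy_dist x \<theta> = (\<integral>\<^sup>+w. ennreal \<bar>free_energy x (rot \<theta> w) - free_energy x (fst w)\<bar> \<partial>(gauss_law N \<Otimes>\<^sub>M gauss_law N))"

lemma free_energy_drop_le:
  assumes x: "x \<in> coef_box" and c: "cos \<theta> > 0"
  shows "(\<integral>\<^sup>+w. ennreal (free_energy x (fst w) - free_energy x (rot \<theta> w)) \<partial>(gauss_law N \<Otimes>\<^sub>M gauss_law N))
    \<le> ennreal (\<theta>\<^sup>2) * gibbs_abs x + ennreal (\<bar>\<theta>\<bar> * (8 * v))"
proof -
  let ?P = "gauss_law N"
  let ?A = "\<lambda>\<gamma> \<gamma>'. \<integral>\<^sup>+z. ennreal \<bar>H x \<gamma>' z\<bar> \<partial>gibbs x \<gamma>"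
  let ?w = "\<lambda>\<gamma> z. ennreal (exp (H x \<gamma> z) / (\<integral>z'. exp (H x \<gamma> z') \<partial>\<nu>))"
  have "(\<integral>\<^sup>+w. ennreal (free_energy x (fst w) - free_energy x (rot \<theta> w)) \<partial>(?P \<Otimes>\<^sub>M ?P))
    \<le> (\<integral>\<^sup>+w. ennreal \<bar>1 - cos \<theta>\<bar> * ?A (fst w) (fst w) + ennreal \<bar>sin \<theta>\<bar> * ?A (fst w) (snd w) \<partial>(?P \<Otimes>\<^sub>M ?P))"
  proof (rule nn_integral_mono_AE)
    show "AE w in ?P \<Otimes>\<^sub>M ?P. ennreal (free_energy x (fst w) - free_energy x (rot \<theta> w))
      \<le> ennreal \<bar>1 - cos \<theta>\<bar> * ?A (fst w) (fst w) + ennreal \<bar>sin \<theta>\<bar> * ?A (fst w) (snd w)"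
      using AE_fst[OF AE_good[OF x]] AE_snd[OF AE_summable_fterm[OF x]] AE_rot[OF c AE_good[OF x]]
      by eventually_elim (unfold rot_def, rule free_energy_diff_le)
  qed
  also have "\<dots> = ennreal \<bar>1 - cos \<theta>\<bar> * (\<integral>\<^sup>+w. ?A (fst w) (fst w) \<partial>(?P \<Otimes>\<^sub>M ?P))
      + ennreal \<bar>sin \<theta>\<bar> * (\<integral>\<^sup>+w. ?A (fst w) (snd w) \<partial>(?P \<Otimes>\<^sub>M ?P))"
    by (subst nn_integral_add) (auto simp: nn_integral_cmult)
  also have "(\<integral>\<^sup>+w. ?A (fst w) (fst w) \<partial>(?P \<Otimes>\<^sub>M ?P)) = gibbs_abs x"
    unfolding gibbs_abs_def by (subst P.nn_integral_fst[symmetric]) (auto simp: P.emeasure_space_1)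
  also have "ennreal \<bar>1 - cos \<theta>\<bar> * gibbs_abs x + ennreal \<bar>sin \<theta>\<bar> * (\<integral>\<^sup>+w. ?A (fst w) (snd w) \<partial>(?P \<Otimes>\<^sub>M ?P))
      \<le> ennreal (\<theta>\<^sup>2) * gibbs_abs x + ennreal \<bar>\<theta>\<bar> * ennreal (8 * v)"
  proof (intro add_mono mult_mono ennreal_leI)
    have "1 - cos \<theta> = 2 * (sin (\<theta>/2))\<^sup>2"
      using cos_double_sin[of "\<theta>/2"] by simp
    also have "(sin (\<theta>/2))\<^sup>2 \<le> (\<theta>/2)\<^sup>2"
      using abs_sin_x_le_abs_x[of "\<theta>/2"] by (simp only: abs_le_square_iff)
    finally have "1 - cos \<theta> \<le> \<theta>\<^sup>2 / 2" by (simp add: power_divide)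
    then show "\<bar>1 - cos \<theta>\<bar> \<le> \<theta>\<^sup>2"
      using zero_le_power2[of \<theta>] cos_le_one[of \<theta>] by linarith
    show "\<bar>sin \<theta>\<bar> \<le> \<bar>\<theta>\<bar>" by (rule abs_sin_x_le_abs_x)
    show "(\<integral>\<^sup>+w. ?A (fst w) (snd w) \<partial>(?P \<Otimes>\<^sub>M ?P)) \<le> ennreal (8 * v)"
      by (rule nn_integral_gibbs_independent_le[OF x])
  qed auto
  also have "ennreal \<bar>\<theta>\<bar> * ennreal (8 * v) = ennreal (\<bar>\<theta>\<bar> * (8 * v))"
    using v_nonneg by (simp add: ennreal_mult)
  finally show ?thesis .
qed

text \<open>
  Jensen's inequality only bounds decreases of the free energy. An increase along the rotation by \<open>\<theta>\<close>
  is a decrease along the rotation by \<open>- \<theta>\<close>, seen from the rotated pair, which has the same law.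
\<close>

lemma free_energy_dist_step:
  assumes x: "x \<in> coef_box" and c: "cos \<theta> > 0"
  shows "free_energy_dist x \<theta> \<le> 2 * (ennreal (\<theta>\<^sup>2) * gibbs_abs x + ennreal (\<bar>\<theta>\<bar> * (8 * v)))"
proof -
  let ?PP = "gauss_law N \<Otimes>\<^sub>M gauss_law N"
  let ?F = "\<lambda>\<theta> w. ennreal (free_energy x (fst w) - free_energy x (rot \<theta> w))"
  have "free_energy_dist x \<theta> = (\<integral>\<^sup>+w. ?F (- \<theta>) (turn \<theta> w) + ?F \<theta> w \<partial>?PP)"
    unfolding free_energy_dist_def
  proof (rule nn_integral_cong)
    fix w assume w: "w \<in> space ?PP"
    have e: "ennreal \<bar>a - b\<bar> = ennreal (a - b) + ennreal (b - a)" for a b :: real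
      by (cases "a \<le> b") (auto simp: ennreal_neg)
    have "rot (- \<theta>) (turn \<theta> w) = fst w" by (simp add: rot_turn rot_0[OF w])
    then show "ennreal \<bar>free_energy x (rot \<theta> w) - free_energy x (fst w)\<bar> = ?F (- \<theta>) (turn \<theta> w) + ?F \<theta> w"
      by (simp add: e) (simp add: turn_def)
  qed
  also have "\<dots> = (\<integral>\<^sup>+w. ?F (- \<theta>) (turn \<theta> w) \<partial>?PP) + (\<integral>\<^sup>+w. ?F \<theta> w \<partial>?PP)"
    by (rule nn_integral_add) measurable
  also have "(\<integral>\<^sup>+w. ?F (- \<theta>) (turn \<theta> w) \<partial>?PP) = (\<integral>\<^sup>+w. ?F (- \<theta>) w \<partial>?PP)"
    by (rule nn_integral_turn[OF c]) measurable
  also have "(\<integral>\<^sup>+w. ?F (- \<theta>) w \<partial>?PP) + (\<integral>\<^sup>+w. ?F \<theta> w \<partial>?PP)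
     \<le> (ennreal (\<theta>\<^sup>2) * gibbs_abs x + ennreal (\<bar>\<theta>\<bar> * (8 * v))) + (ennreal (\<theta>\<^sup>2) * gibbs_abs x + ennreal (\<bar>\<theta>\<bar> * (8 * v)))"
    using free_energy_drop_le[OF x, of "- \<theta>"] free_energy_drop_le[OF x c] c by (intro add_mono) auto
  finally show ?thesis unfolding mult_2 .
qed

text \<open>
  The triangle inequality through the disorder rotated by \<open>a\<close>; the second leg starts from a rotated
  pair, which has the same law.
\<close>

lemma free_energy_dist_add:
  assumes c: "cos a > 0"
  shows "free_energy_dist x (a + b) \<le> free_energy_dist x a + free_energy_dist x b"
proof -
  let ?PP = "gauss_law N \<Otimes>\<^sub>M gauss_law N"
  let ?F = "\<lambda>\<theta> w. ennreal \<bar>free_energy x (rot \<theta> w) - free_energy x (fst w)\<bar>"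
  have "free_energy_dist x (a + b) \<le> (\<integral>\<^sup>+w. ?F a w + ?F b (turn a w) \<partial>?PP)"
    unfolding free_energy_dist_def
  proof (rule nn_integral_mono)
    fix w
    have "\<bar>free_energy x (rot (a + b) w) - free_energy x (fst w)\<bar>
       \<le> \<bar>free_energy x (rot a w) - free_energy x (fst w)\<bar> + \<bar>free_energy x (rot (a + b) w) - free_energy x (rot a w)\<bar>"
      by linarith
    then show "ennreal \<bar>free_energy x (rot (a + b) w) - free_energy x (fst w)\<bar> \<le> ?F a w + ?F b (turn a w)"
      unfolding rot_turn by (simp add: turn_def ennreal_leI flip: ennreal_plus)
  qed
  also have "\<dots> = free_energy_dist x a + (\<integral>\<^sup>+w. ?F b (turn a w) \<partial>?PP)"
    unfolding free_energy_dist_def by (rule nn_integral_add) measurable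
  also have "(\<integral>\<^sup>+w. ?F b (turn a w) \<partial>?PP) = free_energy_dist x b"
    unfolding free_energy_dist_def by (rule nn_integral_turn[OF c]) measurable
  finally show ?thesis .
qed

lemma free_energy_dist_mult:
  assumes \<theta>: "0 < \<theta>" and k: "real k * \<theta> \<le> pi / 2"
  shows "free_energy_dist x (real k * \<theta>) \<le> of_nat k * free_energy_dist x \<theta>"
  using k
proof (induction k)
  case 0
  have "free_energy_dist x 0 = (\<integral>\<^sup>+w. 0 \<partial>(gauss_law N \<Otimes>\<^sub>M gauss_law N))"
    unfolding free_energy_dist_def by (rule nn_integral_cong) (simp add: rot_0)
  then show ?case by simp
next
  case (Suc k)
  \<comment> \<open>Invariance under \<open>turn\<close> is available for angles with positive cosine; the first \<open>k\<close> steps stay below a right angle.\<close>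
  have lt: "real k * \<theta> < pi / 2" using Suc.prems \<theta> by (simp add: algebra_simps)
  then have c: "cos (real k * \<theta>) > 0" using \<theta> by (intro cos_gt_zero_pi) (auto intro: order_less_le_trans[of _ 0])
  have "free_energy_dist x (real (Suc k) * \<theta>) = free_energy_dist x (real k * \<theta> + \<theta>)" by (simp add: algebra_simps)
  also have "\<dots> \<le> free_energy_dist x (real k * \<theta>) + free_energy_dist x \<theta>" by (rule free_energy_dist_add[OF c])
  also have "\<dots> \<le> of_nat k * free_energy_dist x \<theta> + free_energy_dist x \<theta>"
    using Suc lt by (intro add_right_mono) auto
  finally show ?case by (simp add: algebra_simps)
qed

text \<open>
  A quarter turn in \<open>k\<close> equal steps. The terms linear in the angle add up to \<open>8 pi v\<close>, the quadratic
  ones to a multiple of \<open>1 / k\<close>.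
\<close>

lemma free_energy_dist_pi_half:
  assumes x: "x \<in> coef_box"
  shows "free_energy_dist x (pi / 2) \<le> ennreal (8 * pi * v)"
proof -
  obtain K where K: "gibbs_abs x = ennreal K" "0 \<le> K"
    using gibbs_abs_finite[OF x] by (cases "gibbs_abs x") auto
  have b: "free_energy_dist x (pi / 2) \<le> ennreal (pi\<^sup>2 * K / (2 * real k) + 8 * pi * v)" if k: "2 \<le> k" for k :: nat
  proof -
    let ?\<theta> = "pi / (2 * real k)"
    have \<theta>: "0 < ?\<theta>" "?\<theta> < pi / 2" "real k * ?\<theta> = pi / 2" using k by (auto simp: field_simps)
    have c: "cos ?\<theta> > 0" using \<theta> by (intro cos_gt_zero_pi) (auto intro: order_less_trans[of _ 0])
    have "free_energy_dist x (pi / 2) \<le> of_nat k * free_energy_dist x ?\<theta>"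
      using free_energy_dist_mult[OF \<theta>(1), of k] unfolding \<theta>(3) by simp
    also have "\<dots> \<le> of_nat k * (2 * (ennreal (?\<theta>\<^sup>2) * ennreal K + ennreal (\<bar>?\<theta>\<bar> * (8 * v))))"
      using free_energy_dist_step[OF x c] by (intro mult_left_mono) (simp_all add: K)
    also have "\<dots> = ennreal (real k * (2 * (?\<theta>\<^sup>2 * K + \<bar>?\<theta>\<bar> * (8 * v))))"
    proof -
      have 2: "(2::ennreal) = ennreal 2" by simp
      show ?thesis
        using K(2) v_nonneg unfolding 2 ennreal_of_nat_eq_real_of_nat by (simp only: ennreal_mult[symmetric] ennreal_plus[symmetric] mult_nonneg_nonneg add_nonneg_nonneg zero_le_power2 abs_ge_zero of_nat_0_le_iff zero_le_numeral)
    qed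
    also have "real k * (2 * (?\<theta>\<^sup>2 * K + \<bar>?\<theta>\<bar> * (8 * v))) = pi\<^sup>2 * K / (2 * real k) + 8 * pi * v"
      using k by (simp add: field_simps power2_eq_square)
    finally show ?thesis .
  qed
  have "(\<lambda>k. pi\<^sup>2 * K / (2 * real k) + 8 * pi * v) \<longlonglongrightarrow> pi\<^sup>2 * K / 2 * 0 + 8 * pi * v"
  proof (intro tendsto_add tendsto_const)
    have "(\<lambda>k. pi\<^sup>2 * K / 2 * inverse (real k)) \<longlonglongrightarrow> pi\<^sup>2 * K / 2 * 0"
      by (intro tendsto_mult tendsto_const lim_inverse_n)
    then show "(\<lambda>k. pi\<^sup>2 * K / (2 * real k)) \<longlonglongrightarrow> pi\<^sup>2 * K / 2 * 0"
      by (simp add: field_simps)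
  qed
  then have "(\<lambda>k. ennreal (pi\<^sup>2 * K / (2 * real k) + 8 * pi * v)) \<longlonglongrightarrow> ennreal (8 * pi * v)"
    by (intro tendsto_ennrealI) simp
  then show ?thesis
    by (rule tendsto_lowerbound) (use b in \<open>auto simp: eventually_sequentially\<close>)
qed

definition mean_free_energy :: "(nat \<Rightarrow> real) \<Rightarrow> real" where
  "mean_free_energy x = (\<integral>\<gamma>. free_energy x \<gamma> \<partial>gauss_law N)"

text \<open>
  A quarter turn exchanges a disorder for an independent copy, and the distance to the mean is at most
  the mean distance to an independent copy.
\<close>

lemma free_energy_concentration:
  assumes x: "x \<in> coef_box"
  shows "(\<integral>\<gamma>. \<bar>free_energy x \<gamma> - mean_free_energy x\<bar> \<partial>gauss_law N) \<le> 8 * pi * v"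
proof -
  let ?P = "gauss_law N"
  note i = integrable_free_energy[OF x]
  have "(\<integral>\<^sup>+\<gamma>. ennreal \<bar>free_energy x \<gamma> - mean_free_energy x\<bar> \<partial>?P) \<le> (\<integral>\<^sup>+\<gamma>. \<integral>\<^sup>+\<gamma>'. ennreal \<bar>free_energy x \<gamma>' - free_energy x \<gamma>\<bar> \<partial>?P \<partial>?P)"
  proof (rule nn_integral_mono)
    fix \<gamma>
    have "free_energy x \<gamma> - mean_free_energy x = (\<integral>\<gamma>'. free_energy x \<gamma> - free_energy x \<gamma>' \<partial>?P)"
      using i P.prob_space by (simp add: mean_free_energy_def)
    then have "\<bar>free_energy x \<gamma> - mean_free_energy x\<bar> \<le> (\<integral>\<gamma>'. \<bar>free_energy x \<gamma> - free_energy x \<gamma>'\<bar> \<partial>?P)"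
      using integral_abs_bound[of ?P "\<lambda>\<gamma>'. free_energy x \<gamma> - free_energy x \<gamma>'"] by simp
    then have "ennreal \<bar>free_energy x \<gamma> - mean_free_energy x\<bar> \<le> ennreal (\<integral>\<gamma>'. \<bar>free_energy x \<gamma> - free_energy x \<gamma>'\<bar> \<partial>?P)"
      by (rule ennreal_leI)
    also have "\<dots> = (\<integral>\<^sup>+\<gamma>'. ennreal \<bar>free_energy x \<gamma> - free_energy x \<gamma>'\<bar> \<partial>?P)"
      using i by (intro nn_integral_eq_integral[symmetric]) auto
    finally show "ennreal \<bar>free_energy x \<gamma> - mean_free_energy x\<bar> \<le> (\<integral>\<^sup>+\<gamma>'. ennreal \<bar>free_energy x \<gamma>' - free_energy x \<gamma>\<bar> \<partial>?P)"
      by (simp add: abs_minus_commute)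
  qed
  also have "\<dots> = free_energy_dist x (pi / 2)"
  proof -
    have "free_energy_dist x (pi / 2) = (\<integral>\<^sup>+w. ennreal \<bar>free_energy x (snd w) - free_energy x (fst w)\<bar> \<partial>(?P \<Otimes>\<^sub>M ?P))"
      unfolding free_energy_dist_def by (rule nn_integral_cong) (simp add: rot_pi_half)
    then show ?thesis by (simp add: P.nn_integral_fst[symmetric])
  qed
  also have "\<dots> \<le> ennreal (8 * pi * v)" by (rule free_energy_dist_pi_half[OF x])
  finally have *: "(\<integral>\<^sup>+\<gamma>. ennreal \<bar>free_energy x \<gamma> - mean_free_energy x\<bar> \<partial>?P) \<le> ennreal (8 * pi * v)" .
  have "ennreal (\<integral>\<gamma>. \<bar>free_energy x \<gamma> - mean_free_energy x\<bar> \<partial>?P) = (\<integral>\<^sup>+\<gamma>. ennreal \<bar>free_energy x \<gamma> - mean_free_energy x\<bar> \<partial>?P)"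
    using i by (intro nn_integral_eq_integral[symmetric]) auto
  then have "ennreal (\<integral>\<gamma>. \<bar>free_energy x \<gamma> - mean_free_energy x\<bar> \<partial>?P) \<le> ennreal (8 * pi * v)" using * by (simp only:)
  then show ?thesis using v_nonneg by (subst (asm) ennreal_le_iff) auto
qed

end

section \<open>Integration by parts in the disorder\<close>

text \<open>
  Replacing one coordinate by an independent copy does not change the law, because
  \<open>distr_pair_PiM_eq_PiM\<close> also applies to an index that already belongs to the product.
\<close>

lemma integral_PiM_resample:
  fixes \<Phi> :: "('i \<Rightarrow> 'a) \<Rightarrow> real"
  assumes M: "prob_space M" and i: "i \<in> I" and \<Phi>: "integrable (PiM I (\<lambda>_. M)) \<Phi>"
  shows "integrable (PiM I (\<lambda>_. M)) (\<lambda>w. \<integral>u. \<Phi> (w(i := u)) \<partial>M)"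
    and "(\<integral>w. \<Phi> w \<partial>PiM I (\<lambda>_. M)) = (\<integral>w. (\<integral>u. \<Phi> (w(i := u)) \<partial>M) \<partial>PiM I (\<lambda>_. M))"
proof -
  let ?P = "PiM I (\<lambda>_. M)"
  interpret M: prob_space M by fact
  interpret P: prob_space ?P by (intro prob_space_PiM M)
  interpret MP: pair_prob_space M ?P ..
  have I: "insert i I = I" using i by auto
  have d: "distr (M \<Otimes>\<^sub>M ?P) ?P (\<lambda>(u, w). w(i := u)) = ?P"
    using distr_pair_PiM_eq_PiM[of I "\<lambda>_. M" i] M unfolding I by simp
  have m: "(\<lambda>(u, w). w(i := u)) \<in> M \<Otimes>\<^sub>M ?P \<rightarrow>\<^sub>M ?P"
    using measurable_fun_upd[of I I i snd "M \<Otimes>\<^sub>M ?P" "\<lambda>_. M" fst] i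
    by (simp add: I split_beta' insert_absorb)
  have int: "integrable (M \<Otimes>\<^sub>M ?P) (\<lambda>(u, w). \<Phi> (w(i := u)))"
  proof -
    have "integrable (distr (M \<Otimes>\<^sub>M ?P) ?P (\<lambda>(u, w). w(i := u))) \<Phi>" unfolding d by (rule \<Phi>)
    then show ?thesis using m \<Phi> by (subst (asm) integrable_distr_eq) (auto simp: split_beta')
  qed
  show "integrable ?P (\<lambda>w. \<integral>u. \<Phi> (w(i := u)) \<partial>M)"
    by (rule MP.integrable_snd[OF int])
  have "(\<integral>w. \<Phi> w \<partial>?P) = (\<integral>y. \<Phi> ((\<lambda>(u, w). w(i := u)) y) \<partial>(M \<Otimes>\<^sub>M ?P))"
    using integral_distr[OF m, of \<Phi>] \<Phi> unfolding d by simp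
  also have "\<dots> = (\<integral>w. (\<integral>u. \<Phi> (w(i := u)) \<partial>M) \<partial>?P)"
    using MP.integral_snd[OF int] by (simp add: split_beta')
  finally show "(\<integral>w. \<Phi> w \<partial>?P) = (\<integral>w. (\<integral>u. \<Phi> (w(i := u)) \<partial>M) \<partial>?P)" .
qed

text \<open>
  Changing one \<open>x\<^sub>p\<close>, or one coefficient of the disorder, alters a single term of the series for \<open>g\<close>.
\<close>

lemma suminf_shift_one:
  fixes a b :: "nat \<Rightarrow> real"
  assumes "summable a" and b: "\<And>q. b q = a q + (if q = m then d else 0)"
  shows "summable b" "suminf b = suminf a + d"
proof -
  have "(\<lambda>q. a q + (if q = m then d else 0)) sums (suminf a + d)"
    using assms(1) by (intro sums_add sums_single) (simp add: summable_sums)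
  then have "b sums (suminf a + d)" by (simp add: b[abs_def])
  then show "summable b" "suminf b = suminf a + d" by (auto simp: sums_iff)
qed

lemma gfun_upd_x:
  assumes p: "1 \<le> p" and s: "summable (fterm N x \<gamma> z)"
  shows "summable (fterm N (x(p := t)) \<gamma> z)"
    and "gfun N v (x(p := t)) \<gamma> z = gfun N v x \<gamma> z + v * (1/2) ^ p * (t - x p) * gp N \<gamma> p z"
proof -
  obtain m where m: "p = Suc m" using p by (cases p) auto
  have b: "fterm N (x(p := t)) \<gamma> z q = fterm N x \<gamma> z q + (if q = m then (1/2) ^ p * (t - x p) * gp N \<gamma> p z else 0)" for q
    by (cases "q = m") (simp_all add: fterm_def m field_simps)
  show "summable (fterm N (x(p := t)) \<gamma> z)" by (rule suminf_shift_one(1)[OF s b])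
  show "gfun N v (x(p := t)) \<gamma> z = gfun N v x \<gamma> z + v * (1/2) ^ p * (t - x p) * gp N \<gamma> p z"
    unfolding gfun_eq suminf_shift_one(2)[OF s b] by (simp add: algebra_simps)
qed

lemma gfun_upd_\<gamma>:
  assumes p: "1 \<le> p" and "is": "is \<in> multi_indices N p" and s: "summable (fterm N x \<gamma> z)"
  shows "summable (fterm N x (\<gamma>(is := u)) z)"
    and "gfun N v x (\<gamma>(is := u)) z = gfun N v x \<gamma> z + v * (1/2) ^ p * x p * (u - \<gamma> is) * monomial is z"
proof -
  obtain m where m: "p = Suc m" using p by (cases p) auto
  have gp: "gp N (\<gamma>(is := u)) q z = gp N \<gamma> q z + (if q = p then (u - \<gamma> is) * monomial is z else 0)" for q
  proof (cases "q = p")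
    case True
    have "(\<Sum>js\<in>multi_indices N p. (\<gamma>(is := u)) js * monomial js z)
        = (\<Sum>js\<in>multi_indices N p. \<gamma> js * monomial js z + (if js = is then (u - \<gamma> is) * monomial is z else 0))"
      by (intro sum.cong) (auto simp: algebra_simps)
    also have "\<dots> = (\<Sum>js\<in>multi_indices N p. \<gamma> js * monomial js z) + (u - \<gamma> is) * monomial is z"
      using "is" by (simp add: sum.distrib)
    finally show ?thesis using True by (simp add: gp_eq)
  next
    case False
    then have "is \<notin> multi_indices N q" using "is" by (auto simp: multi_indices_def)
    then have "(\<Sum>js\<in>multi_indices N q. (\<gamma>(is := u)) js * monomial js z) = (\<Sum>js\<in>multi_indices N q. \<gamma> js * monomial js z)"
      by (intro sum.cong) auto
    then show ?thesis using False by (simp add: gp_eq)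
  qed
  have b: "fterm N x (\<gamma>(is := u)) z q = fterm N x \<gamma> z q + (if q = m then (1/2) ^ p * x p * ((u - \<gamma> is) * monomial is z) else 0)" for q
    by (simp add: fterm_def gp m algebra_simps)
  show "summable (fterm N x (\<gamma>(is := u)) z)" by (rule suminf_shift_one(1)[OF s b])
  show "gfun N v x (\<gamma>(is := u)) z = gfun N v x \<gamma> z + v * (1/2) ^ p * x p * (u - \<gamma> is) * monomial is z"
    unfolding gfun_eq suminf_shift_one(2)[OF s b] by (simp add: algebra_simps)
qed

lemma integrable_exp_add_bounded:
  fixes g k :: "'a \<Rightarrow> real"
  assumes i: "integrable M (\<lambda>z. exp (g z))" and [measurable]: "g \<in> borel_measurable M" "k \<in> borel_measurable M"
    and k: "\<And>z. z \<in> space M \<Longrightarrow> \<bar>k z\<bar> \<le> B"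
  shows "integrable M (\<lambda>z. exp (g z + k z))"
proof (rule Bochner_Integration.integrable_bound)
  show "integrable M (\<lambda>z. exp B * exp (g z))" using i by simp
  show "AE z in M. norm (exp (g z + k z)) \<le> norm (exp B * exp (g z))"
    using k by (intro AE_I2) (auto simp: exp_add mult.commute[of "exp B"] abs_le_iff)
qed measurable

text \<open>
  A bound of \<open>g\<^sub>p\<close> on the whole sphere. It depends on the disorder and on the dimension, so it serves
  only to justify integrability.
\<close>

definition coef_sum :: "nat \<Rightarrow> nat \<Rightarrow> (nat list \<Rightarrow> real) \<Rightarrow> real" where
  "coef_sum N p \<gamma> = (\<Sum>is\<in>multi_indices N p. \<bar>\<gamma> is\<bar>)"

lemma abs_gp_le_coef_sum:
  assumes z: "z \<in> unit_sphere N"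
  shows "\<bar>gp N \<gamma> p z\<bar> \<le> coef_sum N p \<gamma>"
proof -
  have "\<bar>gp N \<gamma> p z\<bar> \<le> (\<Sum>is\<in>multi_indices N p. \<bar>\<gamma> is\<bar> * \<bar>monomial is z\<bar>)"
    unfolding gp_eq by (rule order_trans[OF sum_abs]) (simp add: abs_mult)
  also have "\<dots> \<le> (\<Sum>is\<in>multi_indices N p. \<bar>\<gamma> is\<bar> * 1)"
    using abs_monomial_le_1[OF z] by (intro sum_mono mult_left_mono) auto
  finally show ?thesis by (simp add: coef_sum_def)
qed

lemma integrable_gauss_component:
  assumes "is \<in> indices N"
  shows "integrable (gauss_law N) (\<lambda>\<gamma>. \<gamma> is)"
proof -
  have "integrable lborel (\<lambda>x::real. std_normal_density x * x)"
    using integrable_std_normal_moment[of 1] by simp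
  then have "integrable std_normal_distribution (\<lambda>x. x)" by (subst integrable_density) auto
  then show ?thesis unfolding gauss_law_def
    by (rule PiM_integrable_component[OF prob_space_std_normal _ assms])
qed

lemma integrable_coef_sum:
  assumes "1 \<le> p"
  shows "integrable (gauss_law N) (coef_sum N p)"
  unfolding coef_sum_def using assms
  by (intro Bochner_Integration.integrable_sum integrable_abs integrable_gauss_component) auto

context sphere_field
begin

lemma good_upd_x:
  assumes p: "1 \<le> p" and g: "good x \<gamma>"
  shows "good (x(p := t)) \<gamma>"
    and "AE z in \<nu>. H (x(p := t)) \<gamma> z = H x \<gamma> z + v * (1/2) ^ p * (t - x p) * gp N \<gamma> p z"
proof -
  have s: "AE z in \<nu>. summable (fterm N x \<gamma> z)" and i: "integrable \<nu> (\<lambda>z. exp (H x \<gamma> z))"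
    using g by (auto simp: good_def)
  show eq: "AE z in \<nu>. H (x(p := t)) \<gamma> z = H x \<gamma> z + v * (1/2) ^ p * (t - x p) * gp N \<gamma> p z"
    using s by eventually_elim (rule gfun_upd_x(2)[OF p])
  have "integrable \<nu> (\<lambda>z. exp (H x \<gamma> z + v * (1/2) ^ p * (t - x p) * gp N \<gamma> p z))"
  proof (rule integrable_exp_add_bounded[OF i])
    fix z assume "z \<in> space \<nu>"
    then show "\<bar>v * (1/2) ^ p * (t - x p) * gp N \<gamma> p z\<bar> \<le> \<bar>v * (1/2) ^ p * (t - x p)\<bar> * coef_sum N p \<gamma>"
      unfolding abs_mult[of _ "gp N \<gamma> p z"] by (intro mult_left_mono abs_gp_le_coef_sum) (auto simp: space_\<nu>)
  qed measurable
  then have "integrable \<nu> (\<lambda>z. exp (H (x(p := t)) \<gamma> z))"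
    by (rule integrable_cong_AE_imp) (use eq in \<open>auto elim: eventually_mono\<close>)
  moreover have "AE z in \<nu>. summable (fterm N (x(p := t)) \<gamma> z)"
    using s by eventually_elim (rule gfun_upd_x(1)[OF p])
  ultimately show "good (x(p := t)) \<gamma>" by (simp add: good_def)
qed

lemma good_upd_\<gamma>:
  assumes p: "1 \<le> p" and "is": "is \<in> multi_indices N p" and g: "good x \<gamma>"
  shows "good x (\<gamma>(is := u))"
    and "AE z in \<nu>. H x (\<gamma>(is := u)) z = H x \<gamma> z + v * (1/2) ^ p * x p * (u - \<gamma> is) * monomial is z"
proof -
  have s: "AE z in \<nu>. summable (fterm N x \<gamma> z)" and i: "integrable \<nu> (\<lambda>z. exp (H x \<gamma> z))"
    using g by (auto simp: good_def)
  note [measurable] = measurable_monomial'[OF "is"]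
  show eq: "AE z in \<nu>. H x (\<gamma>(is := u)) z = H x \<gamma> z + v * (1/2) ^ p * x p * (u - \<gamma> is) * monomial is z"
    using s by eventually_elim (rule gfun_upd_\<gamma>(2)[OF p "is"])
  have "integrable \<nu> (\<lambda>z. exp (H x \<gamma> z + v * (1/2) ^ p * x p * (u - \<gamma> is) * monomial is z))"
  proof (rule integrable_exp_add_bounded[OF i])
    fix z assume "z \<in> space \<nu>"
    then show "\<bar>v * (1/2) ^ p * x p * (u - \<gamma> is) * monomial is z\<bar> \<le> \<bar>v * (1/2) ^ p * x p * (u - \<gamma> is)\<bar> * 1"
      unfolding abs_mult[of _ "monomial is z"] using "is" by (intro mult_left_mono abs_monomial_le_1) (auto simp: space_\<nu>)
  qed measurable
  then have "integrable \<nu> (\<lambda>z. exp (H x (\<gamma>(is := u)) z))"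
    by (rule integrable_cong_AE_imp) (use eq in \<open>auto elim: eventually_mono\<close>)
  moreover have "AE z in \<nu>. summable (fterm N x (\<gamma>(is := u)) z)"
    using s by eventually_elim (rule gfun_upd_\<gamma>(1)[OF p "is"])
  ultimately show "good x (\<gamma>(is := u))" by (simp add: good_def)
qed

lemma prob_space_gibbs: "good x \<gamma> \<Longrightarrow> prob_space (gibbs x \<gamma>)"
  by (rule prob_space_tilt[OF prob_\<nu>]) (simp add: good_def)

abbreviation replicas :: "nat \<Rightarrow> (nat \<Rightarrow> nat \<Rightarrow> real) measure" where
  "replicas m \<equiv> PiM {1..m} (\<lambda>_. \<nu>)"

lemma space_replicas: "space (replicas m) = {1..m} \<rightarrow>\<^sub>E unit_sphere N"
  by (simp add: space_PiM space_\<nu>)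

lemma measurable_gibbs_avg:
  assumes "(\<lambda>(\<gamma>, z). h \<gamma> z) \<in> borel_measurable (gauss_law N \<Otimes>\<^sub>M replicas m)"
  shows "(\<lambda>\<gamma>. gavg x \<gamma> m (h \<gamma>)) \<in> borel_measurable (gauss_law N)"
  by (rule borel_measurable_avg[OF prob_\<nu> _ assms]) (simp add: split_beta')

lemma measurable_gibbs_avg' [measurable]:
  assumes [measurable]: "h \<in> borel_measurable (replicas m)"
  shows "(\<lambda>\<gamma>. gavg x \<gamma> m h) \<in> borel_measurable (gauss_law N)"
  by (rule measurable_gibbs_avg) measurable

lemma gibbs_avg_bound:
  assumes "good x \<gamma>" and "\<And>z. z \<in> space (replicas m) \<Longrightarrow> \<bar>h z\<bar> \<le> K"
  shows "\<bar>gavg x \<gamma> m h\<bar> \<le> K"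
  using assms by (intro avg_bound[OF prob_\<nu>]) (auto simp: good_def)

lemma integrable_gibbs_avg:
  assumes x: "x \<in> coef_box" and h: "h \<in> borel_measurable (replicas m)" and b: "\<And>z. z \<in> space (replicas m) \<Longrightarrow> \<bar>h z\<bar> \<le> K"
  shows "integrable (gauss_law N) (\<lambda>\<gamma>. gavg x \<gamma> m h)"
proof (rule P.integrable_const_bound)
  show "AE \<gamma> in gauss_law N. norm (gavg x \<gamma> m h) \<le> K"
    using AE_good[OF x] by eventually_elim (use gibbs_avg_bound b in auto)
qed (rule measurable_gibbs_avg'[OF h])

lemma gibbs_component:
  assumes "good x \<gamma>" "k \<in> borel_measurable \<nu>" "l \<in> {1..m}"
  shows "gavg x \<gamma> m (\<lambda>z. k (z l)) = (\<integral>z. k z \<partial>gibbs x \<gamma>)"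
  using assms by (intro avg_component[OF prob_\<nu>]) (auto simp: good_def)

lemma measurable_replica_component:
  assumes l: "l \<in> {1..m}" and k: "k \<in> borel_measurable \<nu>"
  shows "(\<lambda>z. k (z l)) \<in> borel_measurable (replicas m)"
  by (rule measurable_compose[OF measurable_component_singleton[OF l] k])

text \<open>
  Stein's identity in one coefficient, the others being frozen. As a function of the value \<open>u\<close> of that
  coefficient, the Gibbs measure is the measure at \<open>u = 0\<close>, tilted by \<open>u\<close> times the bounded function
  \<open>\<sigma> * monomial is\<close>, so the derivative is the one computed in \<open>avg_has_derivative\<close>.
\<close>

lemma coordinate_integration_by_parts:
  assumes x: "x \<in> coef_box" and p: "1 \<le> p" and "is": "is \<in> multi_indices N p"
    and F [measurable]: "F \<in> borel_measurable (replicas m)" and FB: "\<And>z. z \<in> space (replicas m) \<Longrightarrow> \<bar>F z\<bar> \<le> 1"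
  defines "\<sigma> \<equiv> v * (1/2) ^ p * x p"
  shows "integrable (gauss_law N) (\<lambda>\<gamma>. \<gamma> is * gavg x \<gamma> m F)" (is "integrable _ ?L")
    and "integrable (gauss_law N) (\<lambda>\<gamma>. gavg x \<gamma> m (\<lambda>z. F z * (\<Sum>l\<in>{1..m}. \<sigma> * monomial is (z l)))
        - real m * gavg x \<gamma> m F * (\<integral>z. \<sigma> * monomial is z \<partial>gibbs x \<gamma>))" (is "integrable _ ?R")
    and "(\<integral>\<gamma>. \<gamma> is * gavg x \<gamma> m F \<partial>gauss_law N)
    = (\<integral>\<gamma>. gavg x \<gamma> m (\<lambda>z. F z * (\<Sum>l\<in>{1..m}. \<sigma> * monomial is (z l)))
        - real m * gavg x \<gamma> m F * (\<integral>z. \<sigma> * monomial is z \<partial>gibbs x \<gamma>) \<partial>gauss_law N)"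
proof -
  let ?P = "gauss_law N" and ?C = "\<lambda>z. \<sigma> * monomial is z"
  note [measurable] = measurable_monomial'[OF "is"]
  have isI: "is \<in> indices N" using p "is" by auto
  have C1: "\<bar>?C z\<bar> \<le> \<bar>\<sigma>\<bar>" if "z \<in> unit_sphere N" for z
    using abs_monomial_le_1[OF that "is"] by (simp add: abs_mult mult_left_le)
  have CS: "\<bar>\<Sum>l\<in>{1..m}. ?C (z l)\<bar> \<le> real m * \<bar>\<sigma>\<bar>" if z: "z \<in> space (replicas m)" for z
  proof -
    have "\<bar>\<Sum>l\<in>{1..m}. ?C (z l)\<bar> \<le> (\<Sum>l\<in>{1..m}. \<bar>?C (z l)\<bar>)" by (rule sum_abs)
    also have "\<dots> \<le> (\<Sum>l\<in>{1..m}. \<bar>\<sigma>\<bar>)"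
      by (intro sum_mono C1) (use z in \<open>auto simp: space_replicas\<close>)
    finally show ?thesis by simp
  qed
  have FCS: "\<bar>F z * (\<Sum>l\<in>{1..m}. ?C (z l))\<bar> \<le> real m * \<bar>\<sigma>\<bar>" if z: "z \<in> space (replicas m)" for z
    using mult_mono[OF FB[OF z] CS[OF z]] by (simp add: abs_mult)
  have C1': "\<bar>?C (z 1)\<bar> \<le> \<bar>\<sigma>\<bar>" if z: "z \<in> space (replicas 1)" for z
    by (rule C1) (use z in \<open>auto simp: space_PiM space_\<nu>\<close>)
  have iL: "integrable ?P ?L"
  proof (rule Bochner_Integration.integrable_bound[OF integrable_gauss_component[OF isI]])
    show "AE \<gamma> in ?P. norm (?L \<gamma>) \<le> norm (\<gamma> is)"
      using AE_good[OF x]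
    proof eventually_elim
      case (elim \<gamma>)
      have "\<bar>gavg x \<gamma> m F\<bar> \<le> 1" by (rule gibbs_avg_bound[OF elim FB])
      then show ?case by (simp add: abs_mult mult_left_le)
    qed
    note [measurable] = measurable_gauss_law_component[OF isI]
    show "?L \<in> borel_measurable ?P" by measurable
  qed
  have C1m: "(\<lambda>z. ?C (z 1)) \<in> borel_measurable (replicas 1)"
    by (rule measurable_replica_component) (auto, measurable)
  have Rb: "\<bar>?R \<gamma>\<bar> \<le> 2 * real m * \<bar>\<sigma>\<bar>" if g: "good x \<gamma>" for \<gamma>
  proof -
    have 1: "\<bar>gavg x \<gamma> m (\<lambda>z. F z * (\<Sum>l\<in>{1..m}. ?C (z l)))\<bar> \<le> real m * \<bar>\<sigma>\<bar>"
      by (rule gibbs_avg_bound[OF g FCS])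
    have 2: "\<bar>gavg x \<gamma> m F\<bar> \<le> 1" by (rule gibbs_avg_bound[OF g FB])
    have 3: "\<bar>\<integral>z. ?C z \<partial>gibbs x \<gamma>\<bar> \<le> \<bar>\<sigma>\<bar>"
      by (rule abs_integral_le_bound[OF prob_space_gibbs[OF g]]) (use C1 in \<open>simp add: space_\<nu>\<close>)
    have "\<bar>real m * gavg x \<gamma> m F * (\<integral>z. ?C z \<partial>gibbs x \<gamma>)\<bar> \<le> real m * (1 * \<bar>\<sigma>\<bar>)"
      unfolding abs_mult mult.assoc abs_of_nat by (intro mult_left_mono mult_mono 2 3) auto
    with 1 show ?thesis by linarith
  qed
  have iR: "integrable ?P ?R"
  proof (rule P.integrable_const_bound)
    show "AE \<gamma> in ?P. norm (?R \<gamma>) \<le> 2 * real m * \<bar>\<sigma>\<bar>"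
      using AE_good[OF x] by eventually_elim (use Rb in auto)
    have "(\<lambda>\<gamma>. \<integral>z. ?C z \<partial>gibbs x \<gamma>) \<in> borel_measurable ?P"
      by (subst integral_tilt) measurable
    moreover have "(\<lambda>\<gamma>. gavg x \<gamma> m (\<lambda>z. F z * (\<Sum>l\<in>{1..m}. ?C (z l)))) \<in> borel_measurable ?P"
    proof (rule measurable_gibbs_avg')
      have "(\<lambda>z. ?C (z l)) \<in> borel_measurable (replicas m)" if "l \<in> {1..m}" for l
        by (rule measurable_replica_component[OF that]) measurable
      then have "(\<lambda>z. \<Sum>l\<in>{1..m}. ?C (z l)) \<in> borel_measurable (replicas m)" by (rule borel_measurable_sum)
      with F show "(\<lambda>z. F z * (\<Sum>l\<in>{1..m}. ?C (z l))) \<in> borel_measurable (replicas m)" by (rule borel_measurable_times)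
    qed
    moreover have "(\<lambda>\<gamma>. gavg x \<gamma> m F) \<in> borel_measurable ?P" by measurable
    ultimately show "?R \<in> borel_measurable ?P" by measurable
  qed
  have key: "(\<integral>u. ?L (\<gamma>(is := u)) \<partial>std_normal_distribution) = (\<integral>u. ?R (\<gamma>(is := u)) \<partial>std_normal_distribution)" if g: "good x \<gamma>" for \<gamma>
  proof -
    \<comment> \<open>The base point \<open>u = 0\<close> makes the exponent linear, not only affine, in \<open>u\<close>.\<close>
    define \<mu> where "\<mu> = tilt \<nu> (H x (\<gamma>(is := 0)))"
    have g0: "good x (\<gamma>(is := 0))" by (rule good_upd_\<gamma>(1)[OF p "is" g])
    have \<mu>: "prob_space \<mu>" unfolding \<mu>_def by (rule prob_space_gibbs[OF g0])
    have sets_\<mu> [measurable_cong]: "sets \<mu> = sets \<nu>" by (simp add: \<mu>_def)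
    have space_\<mu>: "space \<mu> = unit_sphere N" by (simp add: \<mu>_def space_\<nu>)
    have sets_L: "sets (PiM {1..k} (\<lambda>_. \<mu>)) = sets (replicas k)" for k by (intro sets_PiM_cong) (auto simp: sets_\<mu>)
    have space_L: "space (PiM {1..k} (\<lambda>_. \<mu>)) = space (replicas k)" for k
      by (rule sets_eq_imp_space_eq[OF sets_L])
    have mL: "h \<in> borel_measurable (replicas k) \<Longrightarrow> h \<in> borel_measurable (PiM {1..k} (\<lambda>_. \<mu>))" for h :: "_ \<Rightarrow> real" and k
      by (simp cong: measurable_cong_sets add: sets_L)
    have T: "tilt \<nu> (H x (\<gamma>(is := u))) = tilt \<mu> (\<lambda>z. u * ?C z)" for u
    proof -
      have "tilt \<mu> (\<lambda>z. u * ?C z) = tilt \<nu> (\<lambda>z. H x (\<gamma>(is := 0)) z + u * ?C z)"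
        unfolding \<mu>_def using g0 by (intro tilt_tilt prob_\<nu>) (auto simp: good_def)
      also have "\<dots> = tilt \<nu> (H x (\<gamma>(is := u)))"
      proof (rule tilt_cong_AE)
        have "AE z in \<nu>. H x (\<gamma>(is := 0, is := u)) z = H x (\<gamma>(is := 0)) z + v * (1/2) ^ p * x p * (u - (\<gamma>(is := 0)) is) * monomial is z"
          by (rule good_upd_\<gamma>(2)[OF p "is" g0])
        then show "AE z in \<nu>. H x (\<gamma>(is := 0)) z + u * ?C z = H x (\<gamma>(is := u)) z"
          by eventually_elim (simp add: \<sigma>_def mult_ac)
      qed measurable
      finally show ?thesis ..
    qed
    have A: "avg \<nu> (H x (\<gamma>(is := u))) k h = avg \<mu> (\<lambda>z. u * ?C z) k h" for u k h
      unfolding avg_def T ..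
    have Cm [measurable]: "?C \<in> borel_measurable \<mu>" by measurable
    have CB: "\<And>z. z \<in> space \<mu> \<Longrightarrow> \<bar>?C z\<bar> \<le> \<bar>\<sigma>\<bar>" using C1 by (simp add: space_\<mu>)
    let ?H = "\<lambda>u. avg \<mu> (\<lambda>z. u * ?C z) m F"
    let ?G = "\<lambda>z. F z * (\<Sum>l\<in>{1..m}. ?C (z l))"
    let ?H' = "\<lambda>u. avg \<mu> (\<lambda>z. u * ?C z) m ?G - real m * ?H u * (\<integral>z. ?C z \<partial>tilt \<mu> (\<lambda>z. u * ?C z))"
    have Gm: "?G \<in> borel_measurable (PiM {1..m} (\<lambda>_. \<mu>))"
    proof -
      have "(\<lambda>z. ?C (z l)) \<in> borel_measurable (replicas m)" if "l \<in> {1..m}" for l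
        by (rule measurable_replica_component[OF that]) measurable
      then have "(\<lambda>z. \<Sum>l\<in>{1..m}. ?C (z l)) \<in> borel_measurable (replicas m)" by (rule borel_measurable_sum)
      with F have "?G \<in> borel_measurable (replicas m)" by (rule borel_measurable_times)
      then show ?thesis by (rule mL)
    qed
    have dH: "(?H has_real_derivative ?H' u) (at u)" for u
      using avg_has_derivative[OF \<mu> Cm mL[OF F] CB, of 1 u] FB by (simp add: space_L)
    have cG: "isCont (\<lambda>u. avg \<mu> (\<lambda>z. u * ?C z) m ?G) u" for u
      by (rule DERIV_isCont[OF avg_has_derivative[OF \<mu> Cm Gm CB, where K="real m * \<bar>\<sigma>\<bar>"]]) (assumption, rule FCS, simp add: space_L)
    have cC: "isCont (\<lambda>u. \<integral>z. ?C z \<partial>tilt \<mu> (\<lambda>z. u * ?C z)) u" for u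
    proof -
      have "(\<lambda>u. \<integral>z. ?C z \<partial>tilt \<mu> (\<lambda>z. u * ?C z)) = (\<lambda>u. avg \<mu> (\<lambda>z. u * ?C z) 1 (\<lambda>z. ?C (z 1)))"
        using integrable_exp_bounded[OF \<mu> Cm CB]
        by (intro ext avg_component[symmetric, OF \<mu>]) auto
      moreover have "isCont (\<lambda>u. avg \<mu> (\<lambda>z. u * ?C z) 1 (\<lambda>z. ?C (z 1))) u"
        by (rule DERIV_isCont[OF avg_has_derivative[OF \<mu> Cm mL[OF C1m] CB, where K="\<bar>\<sigma>\<bar>"]]) (assumption, rule C1', simp only: space_L)
      ultimately show ?thesis by simp
    qed
    have "(\<integral>u. u * ?H u \<partial>std_normal_distribution) = (\<integral>u. ?H' u \<partial>std_normal_distribution)"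
    proof (rule std_normal_integration_by_parts[OF dH])
      show "isCont ?H' u" for u
        using cG cC DERIV_isCont[OF dH] by (intro continuous_intros) auto
      show "\<bar>?H u\<bar> \<le> 1" for u
        using gibbs_avg_bound[OF good_upd_\<gamma>(1)[OF p "is" g, of u], of m F 1] FB by (simp add: A)
      show "\<bar>?H' u\<bar> \<le> 2 * real m * \<bar>\<sigma>\<bar>" for u
        using Rb[OF good_upd_\<gamma>(1)[OF p "is" g, of u]] unfolding A T .
    qed
    then show ?thesis unfolding A T by simp
  qed
  note res = integral_PiM_resample[OF prob_space_std_normal isI, folded gauss_law_def]
  have "(\<integral>\<gamma>. ?L \<gamma> \<partial>?P) = (\<integral>\<gamma>. (\<integral>u. ?L (\<gamma>(is := u)) \<partial>std_normal_distribution) \<partial>?P)" by (rule res(2)[OF iL])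
  also have "\<dots> = (\<integral>\<gamma>. (\<integral>u. ?R (\<gamma>(is := u)) \<partial>std_normal_distribution) \<partial>?P)"
  proof (rule integral_cong_AE)
    show "AE \<gamma> in ?P. (\<integral>u. ?L (\<gamma>(is := u)) \<partial>std_normal_distribution) = (\<integral>u. ?R (\<gamma>(is := u)) \<partial>std_normal_distribution)"
      using AE_good[OF x] by eventually_elim (rule key)
  qed (rule borel_measurable_integrable[OF res(1)[OF iL]], rule borel_measurable_integrable[OF res(1)[OF iR]])
  also have "\<dots> = (\<integral>\<gamma>. ?R \<gamma> \<partial>?P)" by (rule res(2)[OF iR, symmetric])
  finally show "(\<integral>\<gamma>. ?L \<gamma> \<partial>?P) = (\<integral>\<gamma>. ?R \<gamma> \<partial>?P)" .
  show "integrable ?P ?L" by (rule iL)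
  show "integrable ?P ?R" by (rule iR)
qed


lemma measurable_dot_replica:
  assumes "i \<in> {1..m}" "j \<in> {1..m}"
  shows "(\<lambda>z. dot N (z i) (z j)) \<in> borel_measurable (replicas m)"
proof -
  have "(\<lambda>z. z i k * z j k) \<in> borel_measurable (replicas m)" if k: "k \<in> {1..N}" for k
    by (intro borel_measurable_times measurable_replica_component[OF assms(1) measurable_\<nu>_component[OF k]]
        measurable_replica_component[OF assms(2) measurable_\<nu>_component[OF k]])
  then show ?thesis unfolding dot_def by (rule borel_measurable_sum)
qed

lemma abs_dot_replica_le:
  assumes "z \<in> space (replicas m)" "i \<in> {1..m}" "j \<in> {1..m}"
  shows "\<bar>dot N (z i) (z j)\<bar> \<le> 1"
  using assms by (intro abs_dot_le_1) (auto simp: space_replicas PiE_iff)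

lemma gibbs_integrable:
  fixes h :: "(nat \<Rightarrow> nat \<Rightarrow> real) \<Rightarrow> real"
  assumes g: "good x \<gamma>" and h: "h \<in> borel_measurable (replicas m)" and b: "\<And>z. z \<in> space (replicas m) \<Longrightarrow> \<bar>h z\<bar> \<le> K"
  shows "integrable (PiM {1..m} (\<lambda>_. gibbs x \<gamma>)) h"
proof -
  interpret L: prob_space "PiM {1..m} (\<lambda>_. gibbs x \<gamma>)"
    by (intro prob_space_PiM prob_space_gibbs g)
  have s: "space (PiM {1..m} (\<lambda>_. gibbs x \<gamma>)) = space (replicas m)"
    by (rule sets_eq_imp_space_eq[OF sets_PiM_tilt])
  show ?thesis
    by (rule L.integrable_const_bound[where B=K])
       (use h b in \<open>auto simp: s sets_PiM_tilt cong: measurable_cong_sets\<close>)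
qed

lemma gibbs_avg_sum:
  assumes g: "good x \<gamma>" and h: "\<And>i. i \<in> A \<Longrightarrow> h i \<in> borel_measurable (replicas m)"
    and b: "\<And>i z. i \<in> A \<Longrightarrow> z \<in> space (replicas m) \<Longrightarrow> \<bar>h i z\<bar> \<le> K"
  shows "gavg x \<gamma> m (\<lambda>z. \<Sum>i\<in>A. c i * h i z) = (\<Sum>i\<in>A. c i * gavg x \<gamma> m (h i))"
  unfolding avg_def
  by (subst Bochner_Integration.integral_sum) (auto intro!: integrable_mult_right gibbs_integrable[OF g h b])

lemma gibbs_avg_cong:
  assumes "\<And>z. z \<in> space (replicas m) \<Longrightarrow> h z = h' z"
  shows "gavg x \<gamma> m h = gavg x \<gamma> m h'"
  unfolding avg_def by (rule Bochner_Integration.integral_cong) (use assms in \<open>auto simp: space_PiM\<close>)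

lemma restrict_space_replicas: "z \<in> space (replicas (Suc m)) \<Longrightarrow> restrict z {1..m} \<in> space (replicas m)"
  by (auto simp: space_PiM PiE_iff)

lemma measurable_restrict_replica [measurable]: "(\<lambda>z. restrict z {1..m}) \<in> replicas (Suc m) \<rightarrow>\<^sub>M replicas m"
  by (intro measurable_restrict_subset) auto

text \<open>
  Replicas are independent under the Gibbs measure; a product of averages becomes an average over one
  more replica.
\<close>

lemma gibbs_avg_Suc:
  fixes k :: "(nat \<Rightarrow> real) \<Rightarrow> real"
  assumes g: "good x \<gamma>" and F: "F \<in> borel_measurable (replicas m)" and FB: "\<And>z. z \<in> space (replicas m) \<Longrightarrow> \<bar>F z\<bar> \<le> B"
    and k: "k \<in> borel_measurable \<nu>" and kB: "\<And>z. z \<in> unit_sphere N \<Longrightarrow> \<bar>k z\<bar> \<le> B'"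
  shows "gavg x \<gamma> (Suc m) (\<lambda>z. F (restrict z {1..m}) * k (z (Suc m)))
    = gavg x \<gamma> m F * (\<integral>z. k z \<partial>gibbs x \<gamma>)"
proof -
  have s: "space (PiM {1..m} (\<lambda>_. gibbs x \<gamma>)) = space (replicas m)"
    by (rule sets_eq_imp_space_eq[OF sets_PiM_tilt])
  show ?thesis
    unfolding avg_def
    by (rule PiM_integral_Suc[OF prob_space_gibbs[OF g], where B=B' and B'=B])
       (use F FB k kB in \<open>auto simp: s space_\<nu> sets_PiM_tilt cong: measurable_cong_sets\<close>)
qed

text \<open>
  The one-coefficient identities for the integrands \<open>F * monomial is (z 1)\<close>, summed over all
  multi-indices of degree \<open>p\<close>. The products of monomials at two replicas add up to powers of their
  overlap (\<open>sum_monomial_mult\<close>).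
\<close>

lemma gibbs_integration_by_parts:
  assumes x: "x \<in> coef_box" and p: "1 \<le> p" and m: "1 \<le> m"
    and F [measurable]: "F \<in> borel_measurable (replicas m)" and FB: "\<And>z. z \<in> space (replicas m) \<Longrightarrow> \<bar>F z\<bar> \<le> 1"
  defines "\<sigma> \<equiv> v * (1/2) ^ p * x p"
  shows "integrable (gauss_law N) (\<lambda>\<gamma>. gavg x \<gamma> m (\<lambda>z. F z * gp N \<gamma> p (z 1)))"
    and "(\<integral>\<gamma>. gavg x \<gamma> m (\<lambda>z. F z * gp N \<gamma> p (z 1)) \<partial>gauss_law N)
    = \<sigma> * (EE x m (\<lambda>z. F z * (\<Sum>l\<in>{1..m}. dot N (z 1) (z l) ^ p))
        - real m * EE x (Suc m) (\<lambda>z. F (restrict z {1..m}) * dot N (z 1) (z (Suc m)) ^ p))"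
proof -
  let ?P = "gauss_law N" and ?A = "multi_indices N p"
  let ?F = "\<lambda>is z. F z * monomial is (z 1)"
  let ?L = "\<lambda>is \<gamma>. \<gamma> is * gavg x \<gamma> m (?F is)"
  let ?R = "\<lambda>is \<gamma>. gavg x \<gamma> m (\<lambda>z. ?F is z * (\<Sum>l\<in>{1..m}. \<sigma> * monomial is (z l)))
        - real m * gavg x \<gamma> m (?F is) * (\<integral>z. \<sigma> * monomial is z \<partial>gibbs x \<gamma>)"
  let ?D = "\<lambda>z. F z * (\<Sum>l\<in>{1..m}. dot N (z 1) (z l) ^ p)"
  let ?E = "\<lambda>z. F (restrict z {1..m}) * dot N (z 1) (z (Suc m)) ^ p"
  have one: "1 \<in> {1..m}" using m by simp
  have mono: "monomial is \<in> borel_measurable \<nu>" if "is \<in> ?A" for "is"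
    using that by (rule measurable_monomial')
  have mono_l: "(\<lambda>z. monomial is (z l)) \<in> borel_measurable (replicas m)" if "is \<in> ?A" "l \<in> {1..m}" for "is" l
    by (rule measurable_replica_component[OF that(2) mono[OF that(1)]])
  have mono_b: "\<bar>monomial is (z l)\<bar> \<le> 1" if "is \<in> ?A" "l \<in> {1..k}" "z \<in> space (replicas k)" for "is" l z k
    using that by (intro abs_monomial_le_1[of _ N _ p]) (auto simp: space_replicas PiE_iff)
  have Fm: "?F is \<in> borel_measurable (replicas m)" if "is \<in> ?A" for "is"
    by (rule borel_measurable_times[OF F mono_l[OF that one]])
  have Fb: "\<bar>?F is z\<bar> \<le> 1" if "is \<in> ?A" "z \<in> space (replicas m)" for "is" z
    using mult_mono[OF FB[OF that(2)] mono_b[OF that(1) one that(2)]] by (simp add: abs_mult)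
  note ibp = coordinate_integration_by_parts[OF x p _ Fm Fb, folded \<sigma>_def]
  have avgL: "gavg x \<gamma> m (\<lambda>z. F z * gp N \<gamma> p (z 1)) = (\<Sum>is\<in>?A. ?L is \<gamma>)" if g: "good x \<gamma>" for \<gamma>
  proof -
    have "(\<lambda>z. F z * gp N \<gamma> p (z 1)) = (\<lambda>z. \<Sum>is\<in>?A. \<gamma> is * ?F is z)"
      by (simp add: gp_eq sum_distrib_left mult_ac)
    then show ?thesis using gibbs_avg_sum[OF g, of ?A ?F m 1 \<gamma>] Fm Fb by simp
  qed
  have avgR: "(\<Sum>is\<in>?A. ?R is \<gamma>) = \<sigma> * (gavg x \<gamma> m ?D - real m * gavg x \<gamma> (Suc m) ?E)"
    if g: "good x \<gamma>" for \<gamma>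
  proof -
    have Gm: "(\<lambda>z. ?F is z * (\<Sum>l\<in>{1..m}. monomial is (z l))) \<in> borel_measurable (replicas m)" if "is \<in> ?A" for "is"
      by (rule borel_measurable_times[OF Fm[OF that] borel_measurable_sum[OF mono_l[OF that]]])
    have Gb: "\<bar>?F is z * (\<Sum>l\<in>{1..m}. monomial is (z l))\<bar> \<le> real m" if "is \<in> ?A" "z \<in> space (replicas m)" for "is" z
    proof -
      have "\<bar>\<Sum>l\<in>{1..m}. monomial is (z l)\<bar> \<le> (\<Sum>l\<in>{1..m}. \<bar>monomial is (z l)\<bar>)" by (rule sum_abs)
      also have "\<dots> \<le> (\<Sum>l\<in>{1..m}. 1)" by (intro sum_mono mono_b[OF that(1) _ that(2)]) 
      finally have "\<bar>\<Sum>l\<in>{1..m}. monomial is (z l)\<bar> \<le> real m" by simp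
      from mult_mono[OF Fb[OF that] this] show ?thesis by (simp add: abs_mult)
    qed
    have "(\<Sum>is\<in>?A. gavg x \<gamma> m (\<lambda>z. ?F is z * (\<Sum>l\<in>{1..m}. \<sigma> * monomial is (z l))))
        = (\<Sum>is\<in>?A. \<sigma> * gavg x \<gamma> m (\<lambda>z. ?F is z * (\<Sum>l\<in>{1..m}. monomial is (z l))))"
    proof (rule sum.cong[OF refl])
      fix "is" assume "is": "is \<in> ?A"
      have "(\<lambda>z. ?F is z * (\<Sum>l\<in>{1..m}. \<sigma> * monomial is (z l))) = (\<lambda>z. \<sigma> * (?F is z * (\<Sum>l\<in>{1..m}. monomial is (z l))))"
        by (simp add: sum_distrib_left mult_ac)
      then show "gavg x \<gamma> m (\<lambda>z. ?F is z * (\<Sum>l\<in>{1..m}. \<sigma> * monomial is (z l)))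
        = \<sigma> * gavg x \<gamma> m (\<lambda>z. ?F is z * (\<Sum>l\<in>{1..m}. monomial is (z l)))"
        by (simp add: avg_def)
    qed
    also have "\<dots> = gavg x \<gamma> m (\<lambda>z. \<Sum>is\<in>?A. \<sigma> * (?F is z * (\<Sum>l\<in>{1..m}. monomial is (z l))))"
      by (rule gibbs_avg_sum[OF g Gm Gb, symmetric])
    also have "(\<lambda>z. \<Sum>is\<in>?A. \<sigma> * (?F is z * (\<Sum>l\<in>{1..m}. monomial is (z l)))) = (\<lambda>z. \<sigma> * ?D z)"
    proof
      fix z :: "nat \<Rightarrow> nat \<Rightarrow> real"
      have "(\<Sum>is\<in>?A. \<sigma> * (?F is z * (\<Sum>l\<in>{1..m}. monomial is (z l))))
         = (\<Sum>is\<in>?A. \<Sum>l\<in>{1..m}. \<sigma> * F z * (monomial is (z 1) * monomial is (z l)))"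
        by (simp add: sum_distrib_left mult_ac)
      also have "\<dots> = (\<Sum>l\<in>{1..m}. \<Sum>is\<in>?A. \<sigma> * F z * (monomial is (z 1) * monomial is (z l)))"
        by (rule sum.swap)
      also have "\<dots> = \<sigma> * ?D z"
        by (simp add: sum_distrib_left[symmetric] sum_monomial_mult mult_ac) (simp add: dot_commute)
      finally show "(\<Sum>is\<in>?A. \<sigma> * (?F is z * (\<Sum>l\<in>{1..m}. monomial is (z l)))) = \<sigma> * ?D z" .
    qed
    also have "gavg x \<gamma> m (\<lambda>z. \<sigma> * ?D z) = \<sigma> * gavg x \<gamma> m ?D"
      by (simp add: avg_def)
    finally have 1: "(\<Sum>is\<in>?A. gavg x \<gamma> m (\<lambda>z. ?F is z * (\<Sum>l\<in>{1..m}. \<sigma> * monomial is (z l))))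
        = \<sigma> * gavg x \<gamma> m ?D" .
    let ?H = "\<lambda>is z. ?F is (restrict z {1..m}) * monomial is (z (Suc m))"
    have Hm: "?H is \<in> borel_measurable (replicas (Suc m))" if "is \<in> ?A" for "is"
    proof (rule borel_measurable_times)
      show "(\<lambda>z. ?F is (restrict z {1..m})) \<in> borel_measurable (replicas (Suc m))"
        by (rule measurable_compose[OF measurable_restrict_replica Fm[OF that]])
      show "(\<lambda>z. monomial is (z (Suc m))) \<in> borel_measurable (replicas (Suc m))"
        by (rule measurable_replica_component[OF _ mono[OF that]]) simp
    qed
    have Hb: "\<bar>?H is z\<bar> \<le> 1" if "is \<in> ?A" "z \<in> space (replicas (Suc m))" for "is" z
      using mult_mono[OF Fb[OF that(1) restrict_space_replicas[OF that(2)]] mono_b[OF that(1) _ that(2), of "Suc m"]]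
      by (simp add: abs_mult)
    have "(\<Sum>is\<in>?A. real m * gavg x \<gamma> m (?F is) * (\<integral>z. \<sigma> * monomial is z \<partial>gibbs x \<gamma>))
        = (\<Sum>is\<in>?A. (real m * \<sigma>) * gavg x \<gamma> (Suc m) (?H is))"
    proof (rule sum.cong[OF refl])
      fix "is" assume "is": "is \<in> ?A"
      have "gavg x \<gamma> (Suc m) (?H is) = gavg x \<gamma> m (?F is) * (\<integral>z. monomial is z \<partial>gibbs x \<gamma>)"
        by (rule gibbs_avg_Suc[OF g Fm[OF "is"] Fb[OF "is"] mono[OF "is"]]) (auto intro!: abs_monomial_le_1[OF _ "is"])
      then show "real m * gavg x \<gamma> m (?F is) * (\<integral>z. \<sigma> * monomial is z \<partial>gibbs x \<gamma>)
        = (real m * \<sigma>) * gavg x \<gamma> (Suc m) (?H is)" by simp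
    qed
    also have "\<dots> = gavg x \<gamma> (Suc m) (\<lambda>z. \<Sum>is\<in>?A. (real m * \<sigma>) * ?H is z)"
      by (rule gibbs_avg_sum[OF g Hm Hb, symmetric])
    also have "(\<lambda>z. \<Sum>is\<in>?A. (real m * \<sigma>) * ?H is z) = (\<lambda>z. (real m * \<sigma>) * ?E z)"
    proof
      fix z :: "nat \<Rightarrow> nat \<Rightarrow> real"
      have "(\<Sum>is\<in>?A. (real m * \<sigma>) * ?H is z)
         = (\<Sum>is\<in>?A. (real m * \<sigma> * F (restrict z {1..m})) * (monomial is (z 1) * monomial is (z (Suc m))))"
        using one by (simp add: mult_ac)
      also have "\<dots> = (real m * \<sigma>) * ?E z"
        by (simp only: sum_distrib_left[symmetric] sum_monomial_mult mult.assoc)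
      finally show "(\<Sum>is\<in>?A. (real m * \<sigma>) * ?H is z) = (real m * \<sigma>) * ?E z" .
    qed
    also have "gavg x \<gamma> (Suc m) (\<lambda>z. (real m * \<sigma>) * ?E z) = (real m * \<sigma>) * gavg x \<gamma> (Suc m) ?E"
      by (simp add: avg_def)
    finally have 2: "(\<Sum>is\<in>?A. real m * gavg x \<gamma> m (?F is) * (\<integral>z. \<sigma> * monomial is z \<partial>gibbs x \<gamma>))
        = (real m * \<sigma>) * gavg x \<gamma> (Suc m) ?E" .
    show ?thesis unfolding sum_subtractf 1 2 by (simp add: algebra_simps)
  qed
  have mgp: "(\<lambda>\<gamma>. gavg x \<gamma> m (\<lambda>z. F z * gp N \<gamma> p (z 1))) \<in> borel_measurable ?P"
  proof (rule measurable_gibbs_avg)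
    have "(\<lambda>w. snd w 1) \<in> ?P \<Otimes>\<^sub>M replicas m \<rightarrow>\<^sub>M \<nu>"
      using one by measurable
    then have "(\<lambda>w. gp N (fst w) p (snd w 1)) \<in> borel_measurable (?P \<Otimes>\<^sub>M replicas m)"
      by (intro measurable_gp[OF p]) (auto intro!: measurable_compose[OF measurable_fst] measurable_gauss_law_component)
    then show "(\<lambda>(\<gamma>, z). F z * gp N \<gamma> p (z 1)) \<in> borel_measurable (?P \<Otimes>\<^sub>M replicas m)"
      unfolding split_beta' by measurable
  qed
  have iS: "integrable ?P (\<lambda>\<gamma>. \<Sum>is\<in>?A. ?L is \<gamma>)"
    by (intro Bochner_Integration.integrable_sum ibp(1))
  have ae: "AE \<gamma> in ?P. (\<Sum>is\<in>?A. ?L is \<gamma>) = gavg x \<gamma> m (\<lambda>z. F z * gp N \<gamma> p (z 1))"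
    using AE_good[OF x] by eventually_elim (simp add: avgL)
  show "integrable ?P (\<lambda>\<gamma>. gavg x \<gamma> m (\<lambda>z. F z * gp N \<gamma> p (z 1)))"
    by (rule integrable_cong_AE_imp[OF iS mgp ae])
  have Dm: "?D \<in> borel_measurable (replicas m)"
    by (intro borel_measurable_times[OF F] borel_measurable_sum borel_measurable_power measurable_dot_replica one)
  have Db: "\<bar>?D z\<bar> \<le> 1 * real m" if z: "z \<in> space (replicas m)" for z
  proof -
    have "\<bar>\<Sum>l\<in>{1..m}. dot N (z 1) (z l) ^ p\<bar> \<le> (\<Sum>l\<in>{1..m}. \<bar>dot N (z 1) (z l) ^ p\<bar>)" by (rule sum_abs)
    also have "\<dots> \<le> (\<Sum>l\<in>{1..m}. 1)"
      by (intro sum_mono) (simp add: power_abs power_le_one abs_dot_replica_le[OF z one])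
    finally have "\<bar>\<Sum>l\<in>{1..m}. dot N (z 1) (z l) ^ p\<bar> \<le> real m" by simp
    then show ?thesis unfolding abs_mult by (intro mult_mono FB[OF z]) auto
  qed
  have Em: "?E \<in> borel_measurable (replicas (Suc m))"
    by (intro borel_measurable_times measurable_compose[OF measurable_restrict_replica F] borel_measurable_power measurable_dot_replica) auto
  have Eb: "\<bar>?E z\<bar> \<le> 1 * 1" if z: "z \<in> space (replicas (Suc m))" for z
  proof -
    have "\<bar>dot N (z 1) (z (Suc m)) ^ p\<bar> \<le> 1"
      by (simp add: power_abs power_le_one abs_dot_replica_le[OF z])
    then show ?thesis unfolding abs_mult by (intro mult_mono FB[OF restrict_space_replicas[OF z]]) auto
  qed
  have "(\<integral>\<gamma>. gavg x \<gamma> m (\<lambda>z. F z * gp N \<gamma> p (z 1)) \<partial>?P) = (\<integral>\<gamma>. (\<Sum>is\<in>?A. ?L is \<gamma>) \<partial>?P)"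
    by (rule integral_cong_AE[OF mgp borel_measurable_integrable[OF iS]]) (use ae in \<open>auto elim: eventually_mono\<close>)
  also have "\<dots> = (\<Sum>is\<in>?A. \<integral>\<gamma>. ?L is \<gamma> \<partial>?P)"
    by (rule Bochner_Integration.integral_sum) (rule ibp(1))
  also have "\<dots> = (\<Sum>is\<in>?A. \<integral>\<gamma>. ?R is \<gamma> \<partial>?P)"
    by (rule sum.cong[OF refl]) (rule ibp(3))
  also have "\<dots> = (\<integral>\<gamma>. (\<Sum>is\<in>?A. ?R is \<gamma>) \<partial>?P)"
    by (rule Bochner_Integration.integral_sum[symmetric]) (rule ibp(2))
  also have "\<dots> = (\<integral>\<gamma>. \<sigma> * (gavg x \<gamma> m ?D - real m * gavg x \<gamma> (Suc m) ?E) \<partial>?P)"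
  proof (rule integral_cong_AE)
    show "(\<lambda>\<gamma>. \<Sum>is\<in>?A. ?R is \<gamma>) \<in> borel_measurable ?P"
      by (rule borel_measurable_integrable[OF Bochner_Integration.integrable_sum[OF ibp(2)]])
    show "(\<lambda>\<gamma>. \<sigma> * (gavg x \<gamma> m ?D - real m * gavg x \<gamma> (Suc m) ?E)) \<in> borel_measurable ?P"
      using measurable_gibbs_avg'[OF Dm] measurable_gibbs_avg'[OF Em] by measurable
    show "AE \<gamma> in ?P. (\<Sum>is\<in>?A. ?R is \<gamma>) = \<sigma> * (gavg x \<gamma> m ?D - real m * gavg x \<gamma> (Suc m) ?E)"
      using AE_good[OF x] by eventually_elim (rule avgR)
  qed
  also have "\<dots> = \<sigma> * (EE x m ?D - real m * EE x (Suc m) ?E)"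
    unfolding E_avg_def using integrable_gibbs_avg[OF x Dm Db] integrable_gibbs_avg[OF x Em Eb] by simp
  finally show "(\<integral>\<gamma>. gavg x \<gamma> m (\<lambda>z. F z * gp N \<gamma> p (z 1)) \<partial>?P)
    = \<sigma> * (EE x m ?D - real m * EE x (Suc m) ?E)" .
qed


section \<open>Concentration of a single degree of the field\<close>

lemma abs_mean_free_energy_le:
  assumes x: "x \<in> coef_box"
  shows "\<bar>mean_free_energy x\<bar> \<le> 8 * v + exp (v\<^sup>2)"
proof -
  have "\<bar>mean_free_energy x\<bar> \<le> (\<integral>\<gamma>. \<bar>free_energy x \<gamma>\<bar> \<partial>gauss_law N)"
    unfolding mean_free_energy_def by (rule integral_abs_bound)
  moreover have "ennreal (\<integral>\<gamma>. \<bar>free_energy x \<gamma>\<bar> \<partial>gauss_law N) \<le> ennreal (8 * v + exp (v\<^sup>2))"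
    using nn_integral_abs_free_energy_le[OF x] integrable_free_energy[OF x] by (subst nn_integral_eq_integral[symmetric]) auto
  then have "(\<integral>\<gamma>. \<bar>free_energy x \<gamma>\<bar> \<partial>gauss_law N) \<le> 8 * v + exp (v\<^sup>2)"
    using v_nonneg by (subst (asm) ennreal_le_iff) auto
  ultimately show ?thesis by linarith
qed

lemma free_energy_upd:
  assumes p: "1 \<le> p" and g: "good x \<gamma>"
  shows "free_energy (x(p := t)) \<gamma> = ln (\<integral>z. exp (H x \<gamma> z + v * (1/2) ^ p * (t - x p) * gp N \<gamma> p z) \<partial>\<nu>)"
proof -
  have "(\<integral>z. exp (H (x(p := t)) \<gamma> z) \<partial>\<nu>) = (\<integral>z. exp (H x \<gamma> z + v * (1/2) ^ p * (t - x p) * gp N \<gamma> p z) \<partial>\<nu>)"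
    by (rule integral_cong_AE) (use good_upd_x(2)[OF p g, of t] in \<open>auto elim: eventually_mono\<close>)
  then show ?thesis by (simp add: free_energy_def)
qed

lemma integrable_exp_gfun_add_gp:
  assumes g: "good x \<gamma>"
  shows "integrable \<nu> (\<lambda>z. exp (H x \<gamma> z + r * gp N \<gamma> p z))"
proof (rule integrable_exp_add_bounded)
  show "integrable \<nu> (\<lambda>z. exp (H x \<gamma> z))" using g by (simp add: good_def)
  fix z assume "z \<in> space \<nu>"
  then show "\<bar>r * gp N \<gamma> p z\<bar> \<le> \<bar>r\<bar> * coef_sum N p \<gamma>"
    unfolding abs_mult by (intro mult_left_mono abs_gp_le_coef_sum) (auto simp: space_\<nu>)
qed measurable

lemma integrable_tilt_bounded:
  assumes g: "good x \<gamma>" and [measurable]: "h \<in> borel_measurable \<nu>" and b: "\<And>z. z \<in> unit_sphere N \<Longrightarrow> \<bar>h z\<bar> \<le> (K::real)"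
  shows "integrable (gibbs x \<gamma>) h"
proof -
  interpret T: prob_space "gibbs x \<gamma>" by (rule prob_space_gibbs[OF g])
  show ?thesis by (rule T.integrable_const_bound[where B=K]) (use b in \<open>auto simp: space_\<nu>\<close>)
qed

definition gp_mean :: "(nat \<Rightarrow> real) \<Rightarrow> nat \<Rightarrow> real" where
  "gp_mean x p = (\<integral>\<gamma>. gavg x \<gamma> 1 (\<lambda>z. gp N \<gamma> p (z 1)) \<partial>gauss_law N)"

lemma gibbs_gp:
  assumes "good x \<gamma>"
  shows "gavg x \<gamma> 1 (\<lambda>z. gp N \<gamma> p (z 1)) = (\<integral>z. gp N \<gamma> p z \<partial>gibbs x \<gamma>)"
  by (rule gibbs_component[OF assms]) auto

lemma free_energy_slope:
  assumes p: "1 \<le> p" and g: "good x \<gamma>"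
  shows "v * (1/2) ^ p * (t - x p) * gavg x \<gamma> 1 (\<lambda>z. gp N \<gamma> p (z 1)) \<le> free_energy (x(p := t)) \<gamma> - free_energy x \<gamma>"
proof -
  let ?r = "v * (1/2) ^ p * (t - x p)"
  have "(\<integral>z. ?r * gp N \<gamma> p z \<partial>gibbs x \<gamma>) \<le> ln (\<integral>z. exp (H x \<gamma> z + ?r * gp N \<gamma> p z) \<partial>\<nu>) - ln (\<integral>z. exp (H x \<gamma> z) \<partial>\<nu>)"
  proof (rule tilt_jensen[OF prob_\<nu>])
    show "integrable \<nu> (\<lambda>z. exp (H x \<gamma> z))" using g by (simp add: good_def)
    show "integrable \<nu> (\<lambda>z. exp (H x \<gamma> z + ?r * gp N \<gamma> p z))" by (rule integrable_exp_gfun_add_gp[OF g])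
    show "integrable (gibbs x \<gamma>) (\<lambda>z. ?r * gp N \<gamma> p z)"
      by (intro integrable_mult_right integrable_tilt_bounded[OF g _ abs_gp_le_coef_sum]) auto
  qed measurable
  then show ?thesis unfolding free_energy_upd[OF p g] gibbs_gp[OF g] by (simp add: free_energy_def)
qed

lemma integrable_gibbs_gp:
  assumes x: "x \<in> coef_box" and p: "1 \<le> p"
  shows "integrable (gauss_law N) (\<lambda>\<gamma>. gavg x \<gamma> 1 (\<lambda>z. gp N \<gamma> p (z 1)))"
  using gibbs_integration_by_parts(1)[OF x p order_refl, of "\<lambda>_. 1"] by simp

text \<open>
  The mean free energy is a convex function of \<open>x\<^sub>p\<close> with slope \<open>v / 2\<^sup>p * gp_mean x p\<close>; convexity is
  used in this subgradient form.
\<close>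

lemma mean_free_energy_slope:
  assumes x: "x \<in> coef_box" "x(p := t) \<in> coef_box" and p: "1 \<le> p"
  shows "v * (1/2) ^ p * (t - x p) * gp_mean x p \<le> mean_free_energy (x(p := t)) - mean_free_energy x"
proof -
  have "(\<integral>\<gamma>. v * (1/2) ^ p * (t - x p) * gavg x \<gamma> 1 (\<lambda>z. gp N \<gamma> p (z 1)) \<partial>gauss_law N)
      \<le> (\<integral>\<gamma>. free_energy (x(p := t)) \<gamma> - free_energy x \<gamma> \<partial>gauss_law N)"
  proof (rule integral_mono_AE)
    show "AE \<gamma> in gauss_law N. v * (1/2) ^ p * (t - x p) * gavg x \<gamma> 1 (\<lambda>z. gp N \<gamma> p (z 1)) \<le> free_energy (x(p := t)) \<gamma> - free_energy x \<gamma>"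
      using AE_good[OF x(1)] by eventually_elim (rule free_energy_slope[OF p])
  qed (intro integrable_mult_right integrable_gibbs_gp[OF x(1) p], intro Bochner_Integration.integrable_diff integrable_free_energy x)
  then show ?thesis
    using integrable_free_energy[OF x(1)] integrable_free_energy[OF x(2)]
    by (simp add: gp_mean_def mean_free_energy_def)
qed

lemma abs_E_avg_le:
  assumes x: "x \<in> coef_box" and b: "\<And>z. z \<in> space (replicas m) \<Longrightarrow> \<bar>h z\<bar> \<le> K" and K: "0 \<le> K"
  shows "\<bar>EE x m h\<bar> \<le> K"
proof (cases "integrable (gauss_law N) (\<lambda>\<gamma>. gavg x \<gamma> m h)")
  case True
  have "\<bar>EE x m h\<bar> \<le> (\<integral>\<gamma>. \<bar>gavg x \<gamma> m h\<bar> \<partial>gauss_law N)"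
    unfolding E_avg_def by (rule integral_abs_bound)
  also have "\<dots> \<le> K"
  proof (rule P.integral_le_const)
    show "AE \<gamma> in gauss_law N. \<bar>gavg x \<gamma> m h\<bar> \<le> K"
      using AE_good[OF x] by eventually_elim (rule gibbs_avg_bound[OF _ b])
  qed (use True in simp)
  finally show ?thesis .
qed (simp add: E_avg_def not_integrable_integral_eq K)

lemma E_avg_cong:
  assumes "\<And>z. z \<in> space (replicas m) \<Longrightarrow> h z = h' z"
  shows "EE x m h = EE x m h'"
  unfolding E_avg_def by (intro Bochner_Integration.integral_cong refl gibbs_avg_cong assms)

lemma E_avg_const:
  assumes x: "x \<in> coef_box"
  shows "EE x m (\<lambda>_. c) = c"
proof -
  have "EE x m (\<lambda>_. c) = (\<integral>\<gamma>. c \<partial>gauss_law N)"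
    unfolding E_avg_def
  proof (rule integral_cong_AE)
    show "AE \<gamma> in gauss_law N. gavg x \<gamma> m (\<lambda>_. c) = c"
      using AE_good[OF x]
    proof eventually_elim
      case (elim \<gamma>)
      interpret L: prob_space "PiM {1..m} (\<lambda>_. gibbs x \<gamma>)"
        by (intro prob_space_PiM prob_space_gibbs elim)
      show ?case unfolding avg_def using L.prob_space by simp
    qed
  qed (rule measurable_gibbs_avg', auto)
  then show ?thesis using P.prob_space by simp
qed

lemma E_avg_sum:
  assumes x: "x \<in> coef_box" and A: "finite A" and h: "\<And>i. i \<in> A \<Longrightarrow> h i \<in> borel_measurable (replicas m)"
    and b: "\<And>i z. i \<in> A \<Longrightarrow> z \<in> space (replicas m) \<Longrightarrow> \<bar>h i z\<bar> \<le> K"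
  shows "EE x m (\<lambda>z. \<Sum>i\<in>A. c i * h i z) = (\<Sum>i\<in>A. c i * EE x m (h i))"
proof -
  have hm: "(\<lambda>z. \<Sum>i\<in>A. c i * h i z) \<in> borel_measurable (replicas m)"
    by (intro borel_measurable_sum borel_measurable_times borel_measurable_const h)
  have i: "integrable (gauss_law N) (\<lambda>\<gamma>. c i * gavg x \<gamma> m (h i))" if "i \<in> A" for i
    by (intro integrable_mult_right integrable_gibbs_avg[OF x h[OF that] b[OF that]])
  have "EE x m (\<lambda>z. \<Sum>i\<in>A. c i * h i z) = (\<integral>\<gamma>. (\<Sum>i\<in>A. c i * gavg x \<gamma> m (h i)) \<partial>gauss_law N)"
    unfolding E_avg_def
  proof (rule integral_cong_AE)
    show "AE \<gamma> in gauss_law N. gavg x \<gamma> m (\<lambda>z. \<Sum>i\<in>A. c i * h i z) = (\<Sum>i\<in>A. c i * gavg x \<gamma> m (h i))"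
      using AE_good[OF x] by eventually_elim (rule gibbs_avg_sum[OF _ h b])
  qed (rule measurable_gibbs_avg'[OF hm], rule borel_measurable_integrable[OF Bochner_Integration.integrable_sum[OF i]])
  also have "\<dots> = (\<Sum>i\<in>A. c i * EE x m (h i))"
    unfolding E_avg_def by (subst Bochner_Integration.integral_sum) (use i in auto)
  finally show ?thesis .
qed

text \<open>
  Integration by parts with \<open>F = 1\<close> and one replica. The overlap of that replica with itself is \<open>1\<close>.
\<close>

lemma abs_gp_mean_le:
  assumes x: "x \<in> coef_box" and p: "1 \<le> p"
  shows "\<bar>gp_mean x p\<bar> \<le> 4 * (v * (1/2) ^ p)"
    and "gp_mean x p = v * (1/2) ^ p * x p * (1 - EE x 2 (\<lambda>z. dot N (z 1) (z 2) ^ p))"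
proof -
  have "(\<integral>\<gamma>. gavg x \<gamma> 1 (\<lambda>z. 1 * gp N \<gamma> p (z 1)) \<partial>gauss_law N)
    = v * (1/2) ^ p * x p * (EE x 1 (\<lambda>z. 1 * (\<Sum>l\<in>{1..1}. dot N (z 1) (z l) ^ p))
        - real 1 * EE x (Suc 1) (\<lambda>z. 1 * dot N (z 1) (z (Suc 1)) ^ p))"
    by (rule gibbs_integration_by_parts(2)[OF x p order_refl, of "\<lambda>_. 1"]) auto
  moreover have "EE x 1 (\<lambda>z. 1 * (\<Sum>l\<in>{1..1}. dot N (z 1) (z l) ^ p)) = EE x 1 (\<lambda>_. 1)"
    by (rule E_avg_cong) (auto simp: space_replicas PiE_iff dot_self space_PiM space_\<nu>)
  ultimately show eq: "gp_mean x p = v * (1/2) ^ p * x p * (1 - EE x 2 (\<lambda>z. dot N (z 1) (z 2) ^ p))"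
    by (simp add: gp_mean_def E_avg_const[OF x] numeral_2_eq_2 One_nat_def)
  have "\<bar>EE x 2 (\<lambda>z. dot N (z 1) (z 2) ^ p)\<bar> \<le> 1"
    by (rule abs_E_avg_le[OF x]) (auto simp: power_abs intro!: power_le_one abs_dot_replica_le)
  then have 1: "\<bar>1 - EE x 2 (\<lambda>z. dot N (z 1) (z 2) ^ p)\<bar> \<le> 2" by linarith
  have 2: "\<bar>x p\<bar> \<le> 2" using x p by (simp add: coef_box_def)
  have "\<bar>x p\<bar> * \<bar>1 - EE x 2 (\<lambda>z. dot N (z 1) (z 2) ^ p)\<bar> \<le> 2 * 2"
    by (rule mult_mono[OF 2 1]) auto
  then have "(v * (1/2) ^ p) * (\<bar>x p\<bar> * \<bar>1 - EE x 2 (\<lambda>z. dot N (z 1) (z 2) ^ p)\<bar>) \<le> (v * (1/2) ^ p) * 4"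
    using v_nonneg by (intro mult_left_mono) auto
  then show "\<bar>gp_mean x p\<bar> \<le> 4 * (v * (1/2) ^ p)"
    unfolding eq using v_nonneg by (simp add: abs_mult mult_ac)
qed

text \<open>
  The slope is \<open>v / 2\<^sup>p\<close> times a mean which is itself of order \<open>v / 2\<^sup>p\<close>. The two one-sided bounds are the
  subgradient inequality at either end.
\<close>

lemma mean_free_energy_lipschitz:
  assumes x: "x \<in> coef_box" "x(p := t) \<in> coef_box" and p: "1 \<le> p"
  shows "\<bar>mean_free_energy (x(p := t)) - mean_free_energy x\<bar> \<le> 4 * (v * (1/2) ^ p)\<^sup>2 * \<bar>t - x p\<bar>"
proof -
  have *: "mean_free_energy y - mean_free_energy (y(p := r)) \<le> 4 * (v * (1/2) ^ p)\<^sup>2 * \<bar>r - y p\<bar>"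
    if y: "y \<in> coef_box" "y(p := r) \<in> coef_box" for y r
  proof -
    let ?s = "v * (1/2) ^ p"
    have "\<bar>?s * (r - y p) * gp_mean y p\<bar> = ?s * \<bar>r - y p\<bar> * \<bar>gp_mean y p\<bar>"
      using v_nonneg by (simp add: abs_mult)
    also have "\<dots> \<le> ?s * \<bar>r - y p\<bar> * (4 * ?s)"
      using v_nonneg by (intro mult_left_mono abs_gp_mean_le(1)[OF y(1) p]) auto
    also have "\<dots> = 4 * ?s\<^sup>2 * \<bar>r - y p\<bar>" by (simp add: power2_eq_square)
    finally show ?thesis using mean_free_energy_slope[OF y p] by linarith
  qed
  have "mean_free_energy x - mean_free_energy (x(p := t)) \<le> 4 * (v * (1/2) ^ p)\<^sup>2 * \<bar>t - x p\<bar>"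
    by (rule *[OF x])
  moreover have "mean_free_energy (x(p := t)) - mean_free_energy ((x(p := t))(p := x p)) \<le> 4 * (v * (1/2) ^ p)\<^sup>2 * \<bar>x p - (x(p := t)) p\<bar>"
    by (rule *) (use x in auto)
  ultimately show ?thesis by (simp add: abs_minus_commute)
qed

definition gp_dev :: "(nat \<Rightarrow> real) \<Rightarrow> nat \<Rightarrow> real" where
  "gp_dev x p = (\<integral>\<gamma>. gavg x \<gamma> 1 (\<lambda>z. \<bar>gp N \<gamma> p (z 1) - gp_mean x p\<bar>) \<partial>gauss_law N)"

lemma gibbs_dev:
  assumes "good x \<gamma>" "1 \<le> m"
  shows "gavg x \<gamma> m (\<lambda>z. \<bar>gp N \<gamma> p (z 1) - c\<bar>) = (\<integral>z. \<bar>gp N \<gamma> p z - c\<bar> \<partial>gibbs x \<gamma>)"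
  using assms by (intro gibbs_component) auto

lemma abs_gp_diff_le: "z \<in> unit_sphere N \<Longrightarrow> \<bar>gp N \<gamma> p z - c\<bar> \<le> coef_sum N p \<gamma> + \<bar>c\<bar>"
  using abs_gp_le_coef_sum[of z N \<gamma> p] by linarith

lemma integrable_gibbs_dev:
  assumes x: "x \<in> coef_box" and p: "1 \<le> p" and m: "1 \<le> m"
  shows "integrable (gauss_law N) (\<lambda>\<gamma>. gavg x \<gamma> m (\<lambda>z. \<bar>gp N \<gamma> p (z 1) - c\<bar>))"
proof (rule Bochner_Integration.integrable_bound)
  show "integrable (gauss_law N) (\<lambda>\<gamma>. coef_sum N p \<gamma> + \<bar>c\<bar>)"
    using integrable_coef_sum[OF p] by simp
  show "AE \<gamma> in gauss_law N. norm (gavg x \<gamma> m (\<lambda>z. \<bar>gp N \<gamma> p (z 1) - c\<bar>)) \<le> norm (coef_sum N p \<gamma> + \<bar>c\<bar>)"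
    using AE_good[OF x]
  proof eventually_elim
    case (elim \<gamma>)
    have "\<bar>gavg x \<gamma> m (\<lambda>z. \<bar>gp N \<gamma> p (z 1) - c\<bar>)\<bar> \<le> coef_sum N p \<gamma> + \<bar>c\<bar>"
    proof (rule gibbs_avg_bound[OF elim])
      fix z assume "z \<in> space (replicas m)"
      then have "z 1 \<in> unit_sphere N" using m by (auto simp: space_replicas PiE_iff)
      then show "\<bar>\<bar>gp N \<gamma> p (z 1) - c\<bar>\<bar> \<le> coef_sum N p \<gamma> + \<bar>c\<bar>" using abs_gp_diff_le by simp
    qed
    then show ?case by simp
  qed
  have "(\<lambda>w. snd w 1) \<in> gauss_law N \<Otimes>\<^sub>M replicas m \<rightarrow>\<^sub>M \<nu>"
    using m by (intro measurable_compose[OF measurable_snd] measurable_component_singleton) auto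
  then have [measurable]: "(\<lambda>w. gp N (fst w) p (snd w 1)) \<in> borel_measurable (gauss_law N \<Otimes>\<^sub>M replicas m)"
    by (intro measurable_gp[OF p]) (auto intro!: measurable_compose[OF measurable_fst] measurable_gauss_law_component)
  show "(\<lambda>\<gamma>. gavg x \<gamma> m (\<lambda>z. \<bar>gp N \<gamma> p (z 1) - c\<bar>)) \<in> borel_measurable (gauss_law N)"
    by (rule measurable_gibbs_avg) (unfold split_beta', measurable)
qed

text \<open>
  With \<open>u = r (g\<^sub>p - c)\<close>, the averages of \<open>exp u\<close> and \<open>exp (- u)\<close> are \<open>exp a\<close> and \<open>exp b\<close>, where \<open>a\<close>
  and \<open>b\<close> are the two quantities on the right, because tilting by \<open>\<plusminus> r g\<^sub>p\<close> amounts to moving \<open>x\<^sub>p\<close>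
  by \<open>\<plusminus> y\<close>. Averaging \<open>|u| \<le> exp (|u| - M) + M - 1\<close> with \<open>M = |a| + |b|\<close> gives the claim.
\<close>

lemma gibbs_dev_le_free_energy:
  assumes p: "1 \<le> p" and g: "good x \<gamma>" and y: "0 \<le> y"
  defines "r \<equiv> v * (1/2) ^ p * y"
  shows "r * gavg x \<gamma> 1 (\<lambda>z. \<bar>gp N \<gamma> p (z 1) - c\<bar>)
    \<le> 1 + \<bar>free_energy (x(p := x p + y)) \<gamma> - free_energy x \<gamma> - r * c\<bar> + \<bar>free_energy (x(p := x p - y)) \<gamma> - free_energy x \<gamma> + r * c\<bar>"
proof -
  let ?T = "gibbs x \<gamma>" and ?u = "\<lambda>z. r * (gp N \<gamma> p z - c)"
  let ?a = "free_energy (x(p := x p + y)) \<gamma> - free_energy x \<gamma> - r * c" and ?b = "free_energy (x(p := x p - y)) \<gamma> - free_energy x \<gamma> + r * c"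
  let ?M = "\<bar>?a\<bar> + \<bar>?b\<bar>"
  interpret T: prob_space ?T by (rule prob_space_gibbs[OF g])
  have r: "0 \<le> r" using v_nonneg y by (simp add: r_def)
  have Z: "0 < (\<integral>z. exp (H x \<gamma> z) \<partial>\<nu>)"
    using g by (intro integral_exp_pos prob_\<nu>) (simp add: good_def)
  have ie: "integrable ?T (\<lambda>z. exp (q * gp N \<gamma> p z))" for q
    using integrable_exp_gfun_add_gp[OF g, of q p] by (intro integrable_tilt) (auto simp: exp_add)
  have e: "(\<integral>z. exp (q * gp N \<gamma> p z) \<partial>?T) = exp (ln (\<integral>z. exp (H x \<gamma> z + q * gp N \<gamma> p z) \<partial>\<nu>) - free_energy x \<gamma>)" for q
    using integral_exp_pos[OF prob_\<nu> integrable_exp_gfun_add_gp[OF g, of q p]] Z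
    by (subst integral_tilt) (auto simp: exp_add[symmetric] exp_diff free_energy_def)
  have ea: "(\<integral>z. exp (?u z - ?M) \<partial>?T) = exp (?a - ?M)"
  proof -
    have "(\<integral>z. exp (?u z - ?M) \<partial>?T) = (\<integral>z. exp (- r * c - ?M) * exp (r * gp N \<gamma> p z) \<partial>?T)"
      by (intro Bochner_Integration.integral_cong refl) (simp add: exp_add[symmetric] algebra_simps)
    also have "\<dots> = exp (- r * c - ?M) * exp (free_energy (x(p := x p + y)) \<gamma> - free_energy x \<gamma>)"
      using e[of r] free_energy_upd[OF p g, of "x p + y"] by (simp add: r_def)
    finally show ?thesis by (simp add: exp_add[symmetric] algebra_simps)
  qed
  have eb: "(\<integral>z. exp (- ?u z - ?M) \<partial>?T) = exp (?b - ?M)"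
  proof -
    have "(\<integral>z. exp (- ?u z - ?M) \<partial>?T) = (\<integral>z. exp (r * c - ?M) * exp ((- r) * gp N \<gamma> p z) \<partial>?T)"
      by (intro Bochner_Integration.integral_cong refl) (simp add: exp_add[symmetric] algebra_simps)
    also have "\<dots> = exp (r * c - ?M) * exp (free_energy (x(p := x p - y)) \<gamma> - free_energy x \<gamma>)"
      using e[of "- r"] free_energy_upd[OF p g, of "x p - y"] by (simp add: r_def)
    finally show ?thesis by (simp add: exp_add[symmetric] algebra_simps)
  qed
  have ia: "integrable ?T (\<lambda>z. exp (?u z - ?M))"
  proof -
    have "(\<lambda>z. exp (?u z - ?M)) = (\<lambda>z. exp (- r * c - ?M) * exp (r * gp N \<gamma> p z))"
      by (rule ext) (simp add: exp_add[symmetric] algebra_simps)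
    then show ?thesis using ie[of r] by simp
  qed
  have ib: "integrable ?T (\<lambda>z. exp (- ?u z - ?M))"
  proof -
    have "(\<lambda>z. exp (- ?u z - ?M)) = (\<lambda>z. exp (r * c - ?M) * exp ((- r) * gp N \<gamma> p z))"
      by (rule ext) (simp add: exp_add[symmetric] algebra_simps)
    then show ?thesis using ie[of "- r"] by simp
  qed
  have iu: "integrable ?T (\<lambda>z. \<bar>?u z\<bar>)"
    by (intro integrable_abs integrable_mult_right integrable_tilt_bounded[OF g _ abs_gp_diff_le]) auto
  have "(\<integral>z. \<bar>?u z\<bar> \<partial>?T) \<le> (\<integral>z. exp (?u z - ?M) + exp (- ?u z - ?M) + (?M - 1) \<partial>?T)"
  proof (rule integral_mono)
    fix z
    have "\<bar>?u z\<bar> - ?M + 1 \<le> exp (\<bar>?u z\<bar> - ?M)" using exp_ge_add_one_self[of "\<bar>?u z\<bar> - ?M"] by linarith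
    also have "\<dots> \<le> exp (?u z - ?M) + exp (- ?u z - ?M)"
      by (cases "0 \<le> ?u z") (auto simp: abs_if)
    finally show "\<bar>?u z\<bar> \<le> exp (?u z - ?M) + exp (- ?u z - ?M) + (?M - 1)" by linarith
  next
    show "integrable ?T (\<lambda>z. exp (?u z - ?M) + exp (- ?u z - ?M) + (?M - 1))"
      by (intro Bochner_Integration.integrable_add ia ib T.integrable_const)
  qed (rule iu)
  also have "\<dots> = exp (?a - ?M) + exp (?b - ?M) + (?M - 1)"
    unfolding ea[symmetric] eb[symmetric] using ia ib T.prob_space
    by (simp only: Bochner_Integration.integral_add Bochner_Integration.integrable_add T.integrable_const lebesgue_integral_const) simp
  also have "\<dots> \<le> 1 + 1 + (?M - 1)"
  proof -
    have "exp (?a - ?M) \<le> 1" "exp (?b - ?M) \<le> 1" by simp_all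
    then show ?thesis by linarith
  qed
  finally have "(\<integral>z. \<bar>?u z\<bar> \<partial>?T) \<le> 1 + \<bar>?a\<bar> + \<bar>?b\<bar>" by simp
  also have "(\<integral>z. \<bar>?u z\<bar> \<partial>?T) = r * gavg x \<gamma> 1 (\<lambda>z. \<bar>gp N \<gamma> p (z 1) - c\<bar>)"
    unfolding gibbs_dev[OF g order_refl] using r by (simp add: abs_mult)
  finally show ?thesis .
qed

text \<open>
  The bound of the previous lemma in expectation. Splitting off the fluctuations of the free energy
  leaves increments of the mean free energy corrected by \<open>\<plusminus> r c\<close>. These are nonnegative by convexity,
  hence equal to their absolute values, and they add up to a second difference.
\<close>

lemma gp_dev_le:
  assumes x: "x \<in> coef_box" "x(p := x p + y) \<in> coef_box" "x(p := x p - y) \<in> coef_box" and p: "1 \<le> p" and y: "0 \<le> y"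
  shows "v * (1/2) ^ p * y * gp_dev x p
    \<le> 1 + 32 * pi * v + (mean_free_energy (x(p := x p + y)) + mean_free_energy (x(p := x p - y)) - 2 * mean_free_energy x)"
proof -
  let ?P = "gauss_law N" and ?r = "v * (1/2) ^ p * y"
  let ?c = "gp_mean x p" and ?x1 = "x(p := x p + y)" and ?x2 = "x(p := x p - y)"
  let ?d = "\<lambda>x \<gamma>. \<bar>free_energy x \<gamma> - mean_free_energy x\<bar>"
  let ?A = "mean_free_energy ?x1 - mean_free_energy x - ?r * ?c" and ?B = "mean_free_energy ?x2 - mean_free_energy x + ?r * ?c"
  have A: "0 \<le> ?A" using mean_free_energy_slope[OF x(1,2) p] by simp
  have B: "0 \<le> ?B" using mean_free_energy_slope[OF x(1,3) p] by simp
  have i: "integrable ?P (\<lambda>\<gamma>. ?d x \<gamma>)" "integrable ?P (\<lambda>\<gamma>. ?d ?x1 \<gamma>)" "integrable ?P (\<lambda>\<gamma>. ?d ?x2 \<gamma>)"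
    using x by (auto intro!: integrable_abs Bochner_Integration.integrable_diff integrable_free_energy)
  have "?r * gp_dev x p = (\<integral>\<gamma>. ?r * gavg x \<gamma> 1 (\<lambda>z. \<bar>gp N \<gamma> p (z 1) - ?c\<bar>) \<partial>?P)"
    by (simp add: gp_dev_def)
  also have "\<dots> \<le> (\<integral>\<gamma>. (1 + ?A + ?B) + (?d ?x1 \<gamma> + ?d ?x2 \<gamma> + 2 * ?d x \<gamma>) \<partial>?P)"
  proof (rule integral_mono_AE)
    show "AE \<gamma> in ?P. ?r * gavg x \<gamma> 1 (\<lambda>z. \<bar>gp N \<gamma> p (z 1) - ?c\<bar>) \<le> (1 + ?A + ?B) + (?d ?x1 \<gamma> + ?d ?x2 \<gamma> + 2 * ?d x \<gamma>)"
      using AE_good[OF x(1)]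
    proof eventually_elim
      case (elim \<gamma>)
      define R where "R = ?r * ?c"
      have t: "\<bar>a - b - R\<bar> \<le> \<bar>a - a'\<bar> + \<bar>b - b'\<bar> + (a' - b' - R)" if "0 \<le> a' - b' - R" for a b a' b' R :: real
        using that by linarith
      have t': "\<bar>a - b + R\<bar> \<le> \<bar>a - a'\<bar> + \<bar>b - b'\<bar> + (a' - b' + R)" if "0 \<le> a' - b' + R" for a b a' b' R :: real
        using that by linarith
      show ?case
        using gibbs_dev_le_free_energy[OF p elim y, of ?c] t[OF A, of "free_energy ?x1 \<gamma>" "free_energy x \<gamma>"] t'[OF B, of "free_energy ?x2 \<gamma>" "free_energy x \<gamma>"]
        unfolding R_def[symmetric] by linarith
    qed
    show "integrable ?P (\<lambda>\<gamma>. ?r * gavg x \<gamma> 1 (\<lambda>z. \<bar>gp N \<gamma> p (z 1) - ?c\<bar>))"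
      by (intro integrable_mult_right integrable_gibbs_dev[OF x(1) p order_refl])
    show "integrable ?P (\<lambda>\<gamma>. (1 + ?A + ?B) + (?d ?x1 \<gamma> + ?d ?x2 \<gamma> + 2 * ?d x \<gamma>))"
      by (intro Bochner_Integration.integrable_add P.integrable_const integrable_mult_right i)
  qed
  also have "\<dots> = (1 + ?A + ?B) + ((\<integral>\<gamma>. ?d ?x1 \<gamma> \<partial>?P) + (\<integral>\<gamma>. ?d ?x2 \<gamma> \<partial>?P) + 2 * (\<integral>\<gamma>. ?d x \<gamma> \<partial>?P))"
    using i P.prob_space
    by (simp only: Bochner_Integration.integral_add Bochner_Integration.integrable_add P.integrable_const integrable_mult_right
        lebesgue_integral_const integral_mult_right_zero) simp
  also have "\<dots> \<le> (1 + ?A + ?B) + 32 * pi * v"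
    using free_energy_concentration[OF x(1)] free_energy_concentration[OF x(2)] free_energy_concentration[OF x(3)] by linarith
  finally show ?thesis by linarith
qed

section \<open>The defect in the identities\<close>

definition gg_defect :: "nat \<Rightarrow> ((nat \<Rightarrow> nat \<Rightarrow> real) \<Rightarrow> real) \<Rightarrow> (real \<Rightarrow> real) \<Rightarrow> (nat \<Rightarrow> real) \<Rightarrow> real" where
  "gg_defect n f \<psi> x = EE x (n + 1) (\<lambda>z. f (restrict z {1..n}) * \<psi> (dot N (z 1) (z (n + 1))))
      - 1 / real n * EE x n f * EE x 2 (\<lambda>z. \<psi> (dot N (z 1) (z 2)))
      - 1 / real n * (\<Sum>l=2..n. EE x n (\<lambda>z. f z * \<psi> (dot N (z 1) (z l))))"

text \<open>
  By integration by parts the left-hand side, even with an additional factor \<open>n\<close>, is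
  \<open>|E\<langle>f\<rangle> E\<langle>g\<^sub>p\<rangle> - E\<langle>f g\<^sub>p(z\<^sup>1)\<rangle>|\<close>, and \<open>|f| \<le> 1\<close> bounds this by the mean deviation of \<open>g\<^sub>p\<close>.
\<close>

lemma gg_defect_power_le:
  assumes x: "x \<in> coef_box" and xp: "0 \<le> x p" and p: "1 \<le> p" and n: "1 \<le> n"
    and f [measurable]: "f \<in> borel_measurable (replicas n)" and fb: "\<And>z. z \<in> space (replicas n) \<Longrightarrow> \<bar>f z\<bar> \<le> 1"
  shows "v * (1/2) ^ p * x p * \<bar>gg_defect n f (\<lambda>t. t ^ p) x\<bar> \<le> gp_dev x p"
proof -
  let ?P = "gauss_law N" and ?\<sigma> = "v * (1/2) ^ p * x p" and ?c = "gp_mean x p"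
  let ?E = "EE x"
  let ?I = "\<integral>\<gamma>. gavg x \<gamma> n (\<lambda>z. f z * gp N \<gamma> p (z 1)) \<partial>?P"
  have \<sigma>: "0 \<le> ?\<sigma>" using v_nonneg xp by simp
  have one: "1 \<in> {1..n}" using n by simp
  have dotb: "\<bar>dot N (z 1) (z l) ^ p\<bar> \<le> 1" if "z \<in> space (replicas n)" "l \<in> {1..n}" for z l
    using abs_dot_replica_le[OF that(1) one that(2)] by (simp add: power_abs power_le_one)
  have hm: "(\<lambda>z. f z * dot N (z 1) (z l) ^ p) \<in> borel_measurable (replicas n)" if "l \<in> {1..n}" for l
    by (intro borel_measurable_times f borel_measurable_power measurable_dot_replica one that)
  have hb: "\<bar>f z * dot N (z 1) (z l) ^ p\<bar> \<le> 1" if "l \<in> {1..n}" "z \<in> space (replicas n)" for z l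
    using mult_mono[OF fb[OF that(2)] dotb[OF that(2,1)]] by (simp add: abs_mult)
  have "?E n (\<lambda>z. f z * (\<Sum>l\<in>{1..n}. dot N (z 1) (z l) ^ p)) = ?E n (\<lambda>z. \<Sum>l\<in>{1..n}. 1 * (f z * dot N (z 1) (z l) ^ p))"
    by (simp add: sum_distrib_left)
  also have "\<dots> = (\<Sum>l\<in>{1..n}. 1 * ?E n (\<lambda>z. f z * dot N (z 1) (z l) ^ p))"
    by (rule E_avg_sum[OF x _ hm hb]) auto
  also have "\<dots> = (\<Sum>l\<in>insert 1 {2..n}. 1 * ?E n (\<lambda>z. f z * dot N (z 1) (z l) ^ p))"
    using n by (intro sum.cong) auto
  also have "(\<Sum>l\<in>insert 1 {2..n}. 1 * ?E n (\<lambda>z. f z * dot N (z 1) (z l) ^ p))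
      = ?E n (\<lambda>z. f z * dot N (z 1) (z 1) ^ p) + (\<Sum>l=2..n. ?E n (\<lambda>z. f z * dot N (z 1) (z l) ^ p))"
    by simp
  also have "?E n (\<lambda>z. f z * dot N (z 1) (z 1) ^ p) = ?E n f"
    by (rule E_avg_cong) (use one in \<open>auto simp: space_replicas PiE_iff dot_self\<close>)
  finally have S: "?E n (\<lambda>z. f z * (\<Sum>l\<in>{1..n}. dot N (z 1) (z l) ^ p)) = ?E n f + (\<Sum>l=2..n. ?E n (\<lambda>z. f z * dot N (z 1) (z l) ^ p))" .
  have "?I = ?\<sigma> * (?E n (\<lambda>z. f z * (\<Sum>l\<in>{1..n}. dot N (z 1) (z l) ^ p))
        - real n * ?E (Suc n) (\<lambda>z. f (restrict z {1..n}) * dot N (z 1) (z (Suc n)) ^ p))"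
    by (rule gibbs_integration_by_parts(2)[OF x p n f fb])
  then have IS: "?I = ?\<sigma> * (?E n f + (\<Sum>l=2..n. ?E n (\<lambda>z. f z * dot N (z 1) (z l) ^ p))
        - real n * ?E (Suc n) (\<lambda>z. f (restrict z {1..n}) * dot N (z 1) (z (Suc n)) ^ p))"
    unfolding S .
  have alg: "\<sigma> * (1 - c) * a - i = \<sigma> * (real n * (e - 1 / real n * a * c - 1 / real n * b))"
    if "i = \<sigma> * (a + b - real n * e)" for \<sigma> a b c e i :: real
    using n unfolding that by (simp add: field_simps)
  have I: "?c * ?E n f - ?I = ?\<sigma> * (real n * gg_defect n f (\<lambda>t. t ^ p) x)"
    unfolding gg_defect_def abs_gp_mean_le(2)[OF x p] Suc_eq_plus1[symmetric] by (rule alg[OF IS])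
  have iI: "integrable ?P (\<lambda>\<gamma>. gavg x \<gamma> n (\<lambda>z. f z * gp N \<gamma> p (z 1)))"
    by (rule gibbs_integration_by_parts(1)[OF x p n f fb])
  have iE: "integrable ?P (\<lambda>\<gamma>. gavg x \<gamma> n f)" by (rule integrable_gibbs_avg[OF x f fb])
  have "\<bar>?c * ?E n f - ?I\<bar> = \<bar>\<integral>\<gamma>. ?c * gavg x \<gamma> n f - gavg x \<gamma> n (\<lambda>z. f z * gp N \<gamma> p (z 1)) \<partial>?P\<bar>"
    using iI iE by (simp add: E_avg_def)
  also have "\<dots> \<le> (\<integral>\<gamma>. \<bar>?c * gavg x \<gamma> n f - gavg x \<gamma> n (\<lambda>z. f z * gp N \<gamma> p (z 1))\<bar> \<partial>?P)"
    by (rule integral_abs_bound)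
  also have "\<dots> \<le> gp_dev x p"
    unfolding gp_dev_def
  proof (rule integral_mono_AE)
    show "AE \<gamma> in ?P. \<bar>?c * gavg x \<gamma> n f - gavg x \<gamma> n (\<lambda>z. f z * gp N \<gamma> p (z 1))\<bar>
      \<le> gavg x \<gamma> 1 (\<lambda>z. \<bar>gp N \<gamma> p (z 1) - ?c\<bar>)"
      using AE_good[OF x]
    proof eventually_elim
      case (elim \<gamma>)
      let ?L = "PiM {1..n} (\<lambda>_. gibbs x \<gamma>)"
      have m1: "(\<lambda>z. gp N \<gamma> p (z 1)) \<in> borel_measurable (replicas n)"
        by (rule measurable_replica_component[OF one]) measurable
      have z1: "z 1 \<in> unit_sphere N" if "z \<in> space (replicas n)" for z
        using that one by (auto simp: space_replicas PiE_iff)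
      have i1: "integrable ?L f" by (rule gibbs_integrable[OF elim f fb])
      have i2: "integrable ?L (\<lambda>z. f z * gp N \<gamma> p (z 1))"
      proof (rule gibbs_integrable[OF elim borel_measurable_times[OF f m1]])
        fix z assume z: "z \<in> space (replicas n)"
        show "\<bar>f z * gp N \<gamma> p (z 1)\<bar> \<le> 1 * coef_sum N p \<gamma>"
          unfolding abs_mult by (intro mult_mono fb[OF z] abs_gp_le_coef_sum z1[OF z]) auto
      qed
      have i3: "integrable ?L (\<lambda>z. \<bar>gp N \<gamma> p (z 1) - ?c\<bar>)"
      proof (rule gibbs_integrable[OF elim])
        show "(\<lambda>z. \<bar>gp N \<gamma> p (z 1) - ?c\<bar>) \<in> borel_measurable (replicas n)" using m1 by measurable
        fix z assume z: "z \<in> space (replicas n)"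
        show "\<bar>\<bar>gp N \<gamma> p (z 1) - ?c\<bar>\<bar> \<le> coef_sum N p \<gamma> + \<bar>?c\<bar>"
          using abs_gp_diff_le[OF z1[OF z]] by simp
      qed
      have "\<bar>?c * gavg x \<gamma> n f - gavg x \<gamma> n (\<lambda>z. f z * gp N \<gamma> p (z 1))\<bar>
        = \<bar>\<integral>z. ?c * f z - f z * gp N \<gamma> p (z 1) \<partial>?L\<bar>"
        unfolding avg_def using i1 i2 by simp
      also have "\<dots> \<le> (\<integral>z. \<bar>?c * f z - f z * gp N \<gamma> p (z 1)\<bar> \<partial>?L)" by (rule integral_abs_bound)
      also have "\<dots> \<le> (\<integral>z. \<bar>gp N \<gamma> p (z 1) - ?c\<bar> \<partial>?L)"
      proof (rule integral_mono)
        fix z assume "z \<in> space ?L"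
        then have z: "z \<in> space (replicas n)" by (simp add: space_PiM)
        have "\<bar>?c * f z - f z * gp N \<gamma> p (z 1)\<bar> = \<bar>f z\<bar> * \<bar>gp N \<gamma> p (z 1) - ?c\<bar>"
          by (simp add: abs_mult[symmetric] algebra_simps abs_minus_commute)
        also have "\<dots> \<le> 1 * \<bar>gp N \<gamma> p (z 1) - ?c\<bar>" by (intro mult_right_mono fb[OF z]) simp
        finally show "\<bar>?c * f z - f z * gp N \<gamma> p (z 1)\<bar> \<le> \<bar>gp N \<gamma> p (z 1) - ?c\<bar>" by simp
      qed (use i1 i2 i3 in auto)
      also have "\<dots> = gavg x \<gamma> 1 (\<lambda>z. \<bar>gp N \<gamma> p (z 1) - ?c\<bar>)"
        using gibbs_dev[OF elim n] gibbs_dev[OF elim order_refl] by (simp add: avg_def)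
      finally show ?case .
    qed
    show "integrable ?P (\<lambda>\<gamma>. gavg x \<gamma> 1 (\<lambda>z. \<bar>gp N \<gamma> p (z 1) - ?c\<bar>))"
      by (rule integrable_gibbs_dev[OF x p order_refl])
  qed (use iI iE in auto)
  finally have "?\<sigma> * (real n * \<bar>gg_defect n f (\<lambda>t. t ^ p) x\<bar>) \<le> gp_dev x p"
    unfolding I abs_mult[of ?\<sigma>] abs_of_nonneg[OF \<sigma>] by (simp only: abs_mult[of "real n"] abs_of_nat)
  moreover have "?\<sigma> * (1 * \<bar>gg_defect n f (\<lambda>t. t ^ p) x\<bar>) \<le> ?\<sigma> * (real n * \<bar>gg_defect n f (\<lambda>t. t ^ p) x\<bar>)"
    using n \<sigma> by (intro mult_left_mono mult_right_mono) auto
  ultimately show ?thesis by simp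
qed

end

section \<open>Averaging over the uniform variables\<close>

abbreviation unif1 :: "real measure" where
  "unif1 \<equiv> uniform_measure lborel {0..1}"

lemma prob_space_unif1: "prob_space unif1"
  by (rule prob_space_uniform_measure) auto

lemma integral_unif1:
  fixes k :: "real \<Rightarrow> real"
  assumes [measurable]: "k \<in> borel_measurable borel"
  shows "(\<integral>t. k t \<partial>unif1) = (\<integral>t. indicator {0..1} t *\<^sub>R k t \<partial>lborel)"
proof -
  have "unif1 = density lborel (\<lambda>t. ennreal (indicator {0..1} t))"
    unfolding uniform_measure_def by (intro density_cong) (auto simp: ennreal_indicator divide_ennreal_def)
  then show ?thesis by (simp add: integral_density)
qed

text \<open>
  The integral of a second difference telescopes into a contribution from each end of the interval.
  Each contribution compares the integrals of \<open>\<phi>\<close> over two adjacent intervals of length \<open>y\<close>, which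
  differ by at most \<open>2 L y\<^sup>2\<close>.
\<close>

lemma integral_second_difference_le:
  fixes \<phi> :: "real \<Rightarrow> real"
  assumes lip: "\<And>s t. s \<in> {-1..2} \<Longrightarrow> t \<in> {-1..2} \<Longrightarrow> \<bar>\<phi> s - \<phi> t\<bar> \<le> L * \<bar>s - t\<bar>"
    and L: "0 \<le> L" and y: "0 < y" "y \<le> 1"
    and m: "(\<lambda>t. \<phi> (t + y) + \<phi> (t - y) - 2 * \<phi> t) \<in> borel_measurable borel"
  shows "(\<integral>t. \<phi> (t + y) + \<phi> (t - y) - 2 * \<phi> t \<partial>unif1) \<le> 4 * L * y\<^sup>2"
proof -
  have "L-lipschitz_on {-1..2} \<phi>"
    using lip L by (intro lipschitz_onI) (auto simp: dist_real_def)
  then have c: "continuous_on {-1..2} \<phi>" by (rule lipschitz_on_continuous_on)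
  \<comment> \<open>The second difference of \<open>\<phi>\<close> is the derivative of that of an antiderivative \<open>\<Psi>\<close>.\<close>
  define \<Psi> where "\<Psi> t = integral {-1..t} \<phi>" for t
  have d: "(\<Psi> has_real_derivative \<phi> t) (at t within {-1..2})" if "t \<in> {-1..2}" for t
    unfolding \<Psi>_def[abs_def] by (rule integral_has_real_derivative[OF c that])
  let ?G = "\<lambda>t. \<Psi> (t + y) + \<Psi> (t - y) - 2 * \<Psi> t" and ?\<kappa> = "\<lambda>t. \<phi> (t + y) + \<phi> (t - y) - 2 * \<phi> t"
  have dsh: "((\<lambda>t. \<Psi> (t + a)) has_real_derivative \<phi> (t + a)) (at t within {0..1})"
    if t: "t \<in> {0..1}" and a: "\<bar>a\<bar> \<le> 1" for t a
  proof -
    have "(\<Psi> \<circ> (\<lambda>t. t + a) has_real_derivative \<phi> (t + a) * 1) (at t within {0..1})"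
    proof (rule DERIV_image_chain)
      have "(\<lambda>t. t + a) ` {0..1} \<subseteq> {-1..2}" using a by auto
      then show "(\<Psi> has_real_derivative \<phi> (t + a)) (at (t + a) within (\<lambda>t. t + a) ` {0..1})"
        using t a by (intro DERIV_subset[OF d]) auto
    qed (auto intro!: derivative_eq_intros)
    then show ?thesis by (simp add: o_def)
  qed
  have dG: "(?G has_real_derivative ?\<kappa> t) (at t within {0..1})" if t: "t \<in> {0..1}" for t
    using dsh[OF t, of y] dsh[OF t, of "- y"] dsh[OF t, of 0] y by (auto intro!: derivative_eq_intros)
  have cs: "continuous_on {0..1} (\<lambda>t. \<phi> (t + a))" if "\<bar>a\<bar> \<le> 1" for a
    by (rule continuous_on_compose2[OF c]) (use that in \<open>auto intro!: continuous_intros\<close>)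
  have "(\<integral>t. ?\<kappa> t \<partial>unif1) = (\<integral>t. indicator {0..1} t *\<^sub>R ?\<kappa> t \<partial>lborel)"
    by (rule integral_unif1[OF m])
  also have "\<dots> = ?G 1 - ?G 0"
  proof (rule integral_FTC_atLeastAtMost)
    show "(?G has_vector_derivative ?\<kappa> t) (at t within {0..1})" if "0 \<le> t" "t \<le> 1" for t
      using dG[of t] that by (simp add: has_real_derivative_iff_has_vector_derivative)
    show "continuous_on {0..1} ?\<kappa>"
      using cs[of y] cs[of "- y"] cs[of 0] y by (intro continuous_intros) auto
  qed simp
  also have "\<dots> \<le> 4 * L * y\<^sup>2"
  proof -
    have mv: "\<exists>\<xi>\<in>{a<..<b}. \<Psi> b - \<Psi> a = \<phi> \<xi> * (b - a)" if "-1 \<le> a" "a < b" "b \<le> 2" for a b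
    proof (rule mvt_simple[OF that(2)])
      fix t assume "a \<le> t" "t \<le> b"
      then have "(\<Psi> has_real_derivative \<phi> t) (at t within {a..b})"
        using that by (intro DERIV_subset[OF d]) auto
      then show "(\<Psi> has_derivative (*) (\<phi> t)) (at t within {a..b})" by (simp add: has_field_derivative_def)
    qed
    have two: "\<bar>(\<Psi> (a + y) - \<Psi> a) - (\<Psi> a - \<Psi> (a - y))\<bar> \<le> 2 * L * y\<^sup>2" if a: "0 \<le> a" "a \<le> 1" for a
    proof -
      obtain \<xi> where \<xi>: "\<xi> \<in> {a<..<a + y}" "\<Psi> (a + y) - \<Psi> a = \<phi> \<xi> * y" using mv[of a "a + y"] a y by auto
      obtain \<zeta> where \<zeta>: "\<zeta> \<in> {a - y<..<a}" "\<Psi> a - \<Psi> (a - y) = \<phi> \<zeta> * y" using mv[of "a - y" a] a y by auto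
      have "\<bar>(\<Psi> (a + y) - \<Psi> a) - (\<Psi> a - \<Psi> (a - y))\<bar> = \<bar>\<phi> \<xi> - \<phi> \<zeta>\<bar> * y"
        unfolding \<xi>(2) \<zeta>(2) left_diff_distrib[symmetric] abs_mult using y by simp
      also have "\<dots> \<le> (L * \<bar>\<xi> - \<zeta>\<bar>) * y"
        using \<xi>(1) \<zeta>(1) a y by (intro mult_right_mono lip) auto
      also have "\<dots> \<le> (L * (2 * y)) * y"
        using \<xi>(1) \<zeta>(1) y L by (intro mult_right_mono mult_left_mono) auto
      finally show ?thesis by (simp add: power2_eq_square mult_ac)
    qed
    show ?thesis using two[of 0] two[of 1] by (simp add: abs_le_iff add.commute)
  qed
  finally show ?thesis .
qed

lemma prob_space_uniform_law: "prob_space uniform_law"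
  unfolding uniform_law_def by (intro prob_space_PiM prob_space_unif1)

lemma measurable_uniform_law_component:
  assumes "1 \<le> p"
  shows "(\<lambda>x. x p) \<in> borel_measurable uniform_law"
proof -
  have "(\<lambda>x. x p) \<in> uniform_law \<rightarrow>\<^sub>M unif1"
    unfolding uniform_law_def using assms by (intro measurable_component_singleton) simp
  then show ?thesis by (simp cong: measurable_cong_sets)
qed

lemma AE_uniform_law_unit: "AE x in uniform_law. \<forall>p\<ge>1. 0 \<le> x p \<and> x p \<le> 1"
proof -
  have U: "AE t in unif1. t \<in> {0..1}"
    by (rule AE_uniform_measureI) auto
  have "AE x in uniform_law. 1 \<le> p \<longrightarrow> 0 \<le> x p \<and> x p \<le> 1" for p
  proof (cases "1 \<le> p")
    case True
    have "AE x in uniform_law. x p \<in> {0..1}"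
      unfolding uniform_law_def by (rule AE_PiM_component) (use True U prob_space_unif1 in auto)
    then show ?thesis by eventually_elim auto
  qed simp
  then show ?thesis by (simp add: AE_all_countable)
qed

context sphere_field
begin

text \<open>
  The uniform variables enter through an arbitrary measurable parameter, so that shifted coordinates
  and functions of one coordinate alone are covered as well.
\<close>

lemma measurable_mean_free_energy:
  assumes X: "\<And>p. 1 \<le> p \<Longrightarrow> (\<lambda>k. X k p) \<in> borel_measurable K"
  shows "(\<lambda>k. mean_free_energy (X k)) \<in> borel_measurable K"
proof -
  have "(\<lambda>w. H (X (fst (fst w))) (snd (fst w)) (snd w)) \<in> borel_measurable ((K \<Otimes>\<^sub>M gauss_law N) \<Otimes>\<^sub>M \<nu>)"
  proof (rule measurable_gfun)
    show "(\<lambda>w. X (fst (fst w)) p) \<in> borel_measurable ((K \<Otimes>\<^sub>M gauss_law N) \<Otimes>\<^sub>M \<nu>)" if "1 \<le> p" for p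
      by (rule measurable_compose[OF _ X[OF that]]) measurable
    show "(\<lambda>w. snd (fst w) is) \<in> borel_measurable ((K \<Otimes>\<^sub>M gauss_law N) \<Otimes>\<^sub>M \<nu>)" if "is \<in> indices N" for "is"
      by (rule measurable_compose[OF _ measurable_gauss_law_component[OF that]]) measurable
  qed measurable
  then have [measurable]: "(\<lambda>(w, z). exp (H (X (fst w)) (snd w) z)) \<in> borel_measurable ((K \<Otimes>\<^sub>M gauss_law N) \<Otimes>\<^sub>M \<nu>)"
    unfolding split_beta' by measurable
  have "(\<lambda>w. \<integral>z. exp (H (X (fst w)) (snd w) z) \<partial>\<nu>) \<in> borel_measurable (K \<Otimes>\<^sub>M gauss_law N)"
    by (rule \<nu>.borel_measurable_lebesgue_integral) measurable
  then have "(\<lambda>(k, \<gamma>). free_energy (X k) \<gamma>) \<in> borel_measurable (K \<Otimes>\<^sub>M gauss_law N)"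
    unfolding free_energy_def split_beta' by measurable
  then show ?thesis unfolding mean_free_energy_def by (rule P.borel_measurable_lebesgue_integral)
qed

definition second_diff :: "nat \<Rightarrow> real \<Rightarrow> (nat \<Rightarrow> real) \<Rightarrow> real" where
  "second_diff p y x = mean_free_energy (x(p := x p + y)) + mean_free_energy (x(p := x p - y)) - 2 * mean_free_energy x"

lemma unit_upd_in_coef_box:
  assumes "\<forall>p\<ge>1. 0 \<le> x p \<and> x p \<le> 1" "-2 \<le> t" "t \<le> 2"
  shows "x(p := t) \<in> coef_box"
proof -
  have "\<bar>(x(p := t)) q\<bar> \<le> 2" if "1 \<le> q" for q
    using assms that by (cases "q = p") (auto simp: abs_le_iff dest!: spec[of _ q])
  then show ?thesis by (simp add: coef_box_def)
qed

lemma unit_in_coef_box: "\<forall>p\<ge>1. 0 \<le> x p \<and> x p \<le> 1 \<Longrightarrow> x \<in> coef_box"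
  by (fastforce simp: coef_box_def)

lemma integrable_second_diff:
  assumes p: "1 \<le> p" and y: "0 < y" "y \<le> 1"
  shows "integrable uniform_law (second_diff p y)"
proof -
  interpret X: prob_space uniform_law by (rule prob_space_uniform_law)
  let ?B = "8 * v + exp (v\<^sup>2)"
  show ?thesis
  proof (rule X.integrable_const_bound)
    show "AE x in uniform_law. norm (second_diff p y x) \<le> 4 * ?B"
      using AE_uniform_law_unit
    proof eventually_elim
      case (elim x)
      have "0 \<le> x p" "x p \<le> 1" using elim p by auto
      then have "x(p := x p + y) \<in> coef_box" "x(p := x p - y) \<in> coef_box"
        using y by (auto intro!: unit_upd_in_coef_box[OF elim])
      note b = abs_mean_free_energy_le[OF this(1)] abs_mean_free_energy_le[OF this(2)] abs_mean_free_energy_le[OF unit_in_coef_box[OF elim]]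
      have t: "\<bar>a + b - 2 * c\<bar> \<le> 4 * B" if "\<bar>a\<bar> \<le> B" "\<bar>b\<bar> \<le> B" "\<bar>c\<bar> \<le> B" for a b c B :: real
        using that by linarith
      show ?case unfolding second_diff_def real_norm_def by (rule t[OF b])
    qed
    have *: "(\<lambda>x. mean_free_energy (x(p := x p + r))) \<in> borel_measurable uniform_law" for r
    proof (rule measurable_mean_free_energy)
      fix q :: nat assume q: "1 \<le> q"
      note [measurable] = measurable_uniform_law_component[OF q] measurable_uniform_law_component[OF p]
      show "(\<lambda>x. (x(p := x p + r)) q) \<in> borel_measurable uniform_law"
        by (cases "q = p") (simp_all, measurable)
    qed
    show "second_diff p y \<in> borel_measurable uniform_law"
      unfolding second_diff_def[abs_def] using *[of y] *[of "- y"] *[of 0] by simp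
  qed
qed

lemma integral_second_diff_le:
  assumes p: "1 \<le> p" and y: "0 < y" "y \<le> 1"
  shows "(\<integral>x. second_diff p y x \<partial>uniform_law) \<le> 16 * (v * (1/2) ^ p)\<^sup>2 * y\<^sup>2"
proof -
  interpret X: prob_space uniform_law by (rule prob_space_uniform_law)
  have "p \<in> {1..}" using p by simp
  note res = integral_PiM_resample[OF prob_space_unif1 this, folded uniform_law_def, OF integrable_second_diff[OF p y]]
  have "(\<integral>x. second_diff p y x \<partial>uniform_law) = (\<integral>x. (\<integral>t. second_diff p y (x(p := t)) \<partial>unif1) \<partial>uniform_law)"
    by (rule res(2))
  also have "\<dots> \<le> 4 * (4 * (v * (1/2) ^ p)\<^sup>2) * y\<^sup>2"
  proof (rule X.integral_le_const[OF res(1)])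
    show "AE x in uniform_law. (\<integral>t. second_diff p y (x(p := t)) \<partial>unif1) \<le> 4 * (4 * (v * (1/2) ^ p)\<^sup>2) * y\<^sup>2"
      using AE_uniform_law_unit
    proof eventually_elim
      case (elim x)
      let ?\<phi> = "\<lambda>t. mean_free_energy (x(p := t))"
      have m: "?\<phi> \<in> borel_measurable borel"
        by (rule measurable_mean_free_energy) (auto simp: fun_upd_def)
      have "(\<integral>t. ?\<phi> (t + y) + ?\<phi> (t - y) - 2 * ?\<phi> t \<partial>unif1) \<le> 4 * (4 * (v * (1/2) ^ p)\<^sup>2) * y\<^sup>2"
      proof (rule integral_second_difference_le)
        fix s t :: real assume "s \<in> {-1..2}" "t \<in> {-1..2}"
        then have "x(p := t) \<in> coef_box" "(x(p := t))(p := s) \<in> coef_box"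
          using unit_upd_in_coef_box[OF elim] by auto
        from mean_free_energy_lipschitz[OF this p] show "\<bar>?\<phi> s - ?\<phi> t\<bar> \<le> 4 * (v * (1/2) ^ p)\<^sup>2 * \<bar>s - t\<bar>" by simp
      next
        show "(\<lambda>t. ?\<phi> (t + y) + ?\<phi> (t - y) - 2 * ?\<phi> t) \<in> borel_measurable borel"
          using measurable_compose[OF _ m, of "\<lambda>t. t + y" borel] measurable_compose[OF _ m, of "\<lambda>t. t - y" borel] m by simp
      qed (use y in auto)
      then show ?case by (simp add: second_diff_def)
    qed
  qed
  finally show ?thesis by simp
qed

lemma gg_defect_le:
  assumes x: "x \<in> coef_box" and n: "1 \<le> n" and fb: "\<And>z. z \<in> space (replicas n) \<Longrightarrow> \<bar>f z\<bar> \<le> 1"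
    and \<psi>: "\<And>t. \<bar>t\<bar> \<le> 1 \<Longrightarrow> \<bar>\<psi> t\<bar> \<le> K"
  shows "\<bar>gg_defect n f \<psi> x\<bar> \<le> 3 * K"
proof -
  have K: "0 \<le> K" using \<psi>[of 0] by simp
  have one: "1 \<in> {1..n}" using n by simp
  have 1: "\<bar>EE x (n + 1) (\<lambda>z. f (restrict z {1..n}) * \<psi> (dot N (z 1) (z (n + 1))))\<bar> \<le> 1 * K"
    unfolding Suc_eq_plus1[symmetric]
  proof (rule abs_E_avg_le[OF x])
    fix z assume z: "z \<in> space (replicas (Suc n))"
    show "\<bar>f (restrict z {1..n}) * \<psi> (dot N (z 1) (z (Suc n)))\<bar> \<le> 1 * K"
      unfolding abs_mult by (intro mult_mono fb[OF restrict_space_replicas[OF z]] \<psi> abs_dot_replica_le[OF z]) auto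
  qed (use K in simp)
  have 2: "\<bar>EE x n f\<bar> \<le> 1" by (rule abs_E_avg_le[OF x fb]) auto
  have 3: "\<bar>EE x 2 (\<lambda>z. \<psi> (dot N (z 1) (z 2)))\<bar> \<le> K"
    by (rule abs_E_avg_le[OF x]) (auto intro!: \<psi> abs_dot_replica_le K)
  have 4: "\<bar>EE x n (\<lambda>z. f z * \<psi> (dot N (z 1) (z l)))\<bar> \<le> 1 * K" if l: "l \<in> {2..n}" for l
  proof (rule abs_E_avg_le[OF x])
    fix z assume z: "z \<in> space (replicas n)"
    show "\<bar>f z * \<psi> (dot N (z 1) (z l))\<bar> \<le> 1 * K"
      unfolding abs_mult using l by (intro mult_mono fb[OF z] \<psi> abs_dot_replica_le[OF z one]) auto
  qed (use K in simp)
  have "\<bar>1 / real n * EE x n f * EE x 2 (\<lambda>z. \<psi> (dot N (z 1) (z 2)))\<bar> \<le> 1 * 1 * K"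
    unfolding abs_mult using n 2 3 by (intro mult_mono) auto
  moreover have "\<bar>1 / real n * (\<Sum>l=2..n. EE x n (\<lambda>z. f z * \<psi> (dot N (z 1) (z l))))\<bar> \<le> K"
  proof -
    have "\<bar>\<Sum>l=2..n. EE x n (\<lambda>z. f z * \<psi> (dot N (z 1) (z l)))\<bar> \<le> (\<Sum>l=2..n. \<bar>EE x n (\<lambda>z. f z * \<psi> (dot N (z 1) (z l)))\<bar>)"
      by (rule sum_abs)
    also have "\<dots> \<le> (\<Sum>l=2..n. 1 * K)" by (rule sum_mono[OF 4])
    also have "\<dots> \<le> real n * K" using K n by (simp add: mult_right_mono)
    finally show ?thesis using n by (simp add: abs_mult field_simps)
  qed
  ultimately show ?thesis using 1 unfolding gg_defect_def by linarith
qed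

text \<open>
  The defect is linear in the test function. This does not hold by definition, because Bochner
  integrals are additive on integrable functions only.
\<close>

lemma gg_defect_sum:
  assumes x: "x \<in> coef_box" and n: "1 \<le> n"
    and f: "f \<in> borel_measurable (replicas n)" and fb: "\<And>z. z \<in> space (replicas n) \<Longrightarrow> \<bar>f z\<bar> \<le> 1"
    and A: "finite A" and k: "\<And>i. i \<in> A \<Longrightarrow> k i \<in> borel_measurable borel" and kb: "\<And>i t. i \<in> A \<Longrightarrow> \<bar>t\<bar> \<le> 1 \<Longrightarrow> \<bar>k i t\<bar> \<le> K"
  shows "gg_defect n f (\<lambda>t. \<Sum>i\<in>A. c i * k i t) x = (\<Sum>i\<in>A. c i * gg_defect n f (k i) x)"
proof (cases "A = {}")
  case True
  then show ?thesis by (simp add: gg_defect_def E_avg_const[OF x])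
next
  case False
  then have K: "0 \<le> K" using kb[of _ 0] by (auto intro: order_trans[OF abs_ge_zero])
  have one: "1 \<in> {1..n}" using n by simp
  have km: "(\<lambda>z. k i (dot N (z a) (z b))) \<in> borel_measurable (replicas m)" if "i \<in> A" "a \<in> {1..m}" "b \<in> {1..m}" for i a b m
    by (rule measurable_compose[OF measurable_dot_replica[OF that(2,3)] k[OF that(1)]])
  have 1: "EE x (n + 1) (\<lambda>z. f (restrict z {1..n}) * (\<Sum>i\<in>A. c i * k i (dot N (z 1) (z (n + 1)))))
     = (\<Sum>i\<in>A. c i * EE x (n + 1) (\<lambda>z. f (restrict z {1..n}) * k i (dot N (z 1) (z (n + 1)))))"
    unfolding Suc_eq_plus1[symmetric]
  proof -
    have "EE x (Suc n) (\<lambda>z. \<Sum>i\<in>A. c i * (f (restrict z {1..n}) * k i (dot N (z 1) (z (Suc n)))))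
      = (\<Sum>i\<in>A. c i * EE x (Suc n) (\<lambda>z. f (restrict z {1..n}) * k i (dot N (z 1) (z (Suc n)))))"
    proof (rule E_avg_sum[OF x A])
      show "(\<lambda>z. f (restrict z {1..n}) * k i (dot N (z 1) (z (Suc n)))) \<in> borel_measurable (replicas (Suc n))" if "i \<in> A" for i
        by (intro borel_measurable_times measurable_compose[OF measurable_restrict_replica f] km that) auto
      show "\<bar>f (restrict z {1..n}) * k i (dot N (z 1) (z (Suc n)))\<bar> \<le> 1 * K" if "i \<in> A" "z \<in> space (replicas (Suc n))" for i z
        unfolding abs_mult by (intro mult_mono fb[OF restrict_space_replicas[OF that(2)]] kb that abs_dot_replica_le[OF that(2)]) auto
    qed
    then show "EE x (Suc n) (\<lambda>z. f (restrict z {1..n}) * (\<Sum>i\<in>A. c i * k i (dot N (z 1) (z (Suc n)))))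
      = (\<Sum>i\<in>A. c i * EE x (Suc n) (\<lambda>z. f (restrict z {1..n}) * k i (dot N (z 1) (z (Suc n)))))"
      by (simp add: sum_distrib_left mult_ac)
  qed
  have 2: "EE x 2 (\<lambda>z. \<Sum>i\<in>A. c i * k i (dot N (z 1) (z 2))) = (\<Sum>i\<in>A. c i * EE x 2 (\<lambda>z. k i (dot N (z 1) (z 2))))"
    by (rule E_avg_sum[OF x A, where K=K]) (auto intro!: km kb abs_dot_replica_le)
  have 3: "EE x n (\<lambda>z. f z * (\<Sum>i\<in>A. c i * k i (dot N (z 1) (z l)))) = (\<Sum>i\<in>A. c i * EE x n (\<lambda>z. f z * k i (dot N (z 1) (z l))))"
    if l: "l \<in> {2..n}" for l
  proof -
    have l': "l \<in> {1..n}" using l by simp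
    have "EE x n (\<lambda>z. \<Sum>i\<in>A. c i * (f z * k i (dot N (z 1) (z l)))) = (\<Sum>i\<in>A. c i * EE x n (\<lambda>z. f z * k i (dot N (z 1) (z l))))"
    proof (rule E_avg_sum[OF x A])
      show "(\<lambda>z. f z * k i (dot N (z 1) (z l))) \<in> borel_measurable (replicas n)" if "i \<in> A" for i
        by (intro borel_measurable_times f km that one l')
      show "\<bar>f z * k i (dot N (z 1) (z l))\<bar> \<le> 1 * K" if "i \<in> A" "z \<in> space (replicas n)" for i z
        unfolding abs_mult by (intro mult_mono fb[OF that(2)] kb that abs_dot_replica_le[OF that(2) one l']) auto
    qed
    then show ?thesis by (simp add: sum_distrib_left mult_ac)
  qed
  have 4: "(\<Sum>l=2..n. EE x n (\<lambda>z. f z * (\<Sum>i\<in>A. c i * k i (dot N (z 1) (z l)))))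
      = (\<Sum>i\<in>A. c i * (\<Sum>l=2..n. EE x n (\<lambda>z. f z * k i (dot N (z 1) (z l)))))"
  proof -
    have "(\<Sum>l=2..n. EE x n (\<lambda>z. f z * (\<Sum>i\<in>A. c i * k i (dot N (z 1) (z l)))))
      = (\<Sum>l=2..n. \<Sum>i\<in>A. c i * EE x n (\<lambda>z. f z * k i (dot N (z 1) (z l))))"
      by (rule sum.cong[OF refl 3])
    also have "\<dots> = (\<Sum>i\<in>A. \<Sum>l=2..n. c i * EE x n (\<lambda>z. f z * k i (dot N (z 1) (z l))))" by (rule sum.swap)
    finally show ?thesis by (simp add: sum_distrib_left)
  qed
  show ?thesis
    unfolding gg_defect_def 1 2 4 by (simp add: sum_distrib_left sum_subtractf[symmetric] right_diff_distrib mult_ac)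
qed

text \<open>
  In degree \<open>0\<close> the coefficients \<open>1\<close>, \<open>- 1 / n\<close> and \<open>- (n - 1) / n\<close> of \<open>E\<langle>f\<rangle>\<close> cancel.
\<close>

lemma gg_defect_const:
  assumes x: "x \<in> coef_box" and n: "1 \<le> n"
    and f: "f \<in> borel_measurable (replicas n)" and fb: "\<And>z. z \<in> space (replicas n) \<Longrightarrow> \<bar>f z\<bar> \<le> 1"
  shows "gg_defect n f (\<lambda>t. 1) x = 0"
proof -
  have "EE x (Suc n) (\<lambda>z. f (restrict z {1..n}) * 1) = EE x n f"
    unfolding E_avg_def
  proof (rule integral_cong_AE)
    have "(\<lambda>z. f (restrict z {1..n}) * 1) \<in> borel_measurable (replicas (Suc n))"
      using measurable_compose[OF measurable_restrict_replica f] by simp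
    then show "(\<lambda>\<gamma>. gavg x \<gamma> (Suc n) (\<lambda>z. f (restrict z {1..n}) * 1)) \<in> borel_measurable (gauss_law N)"
      by (rule measurable_gibbs_avg')
    show "(\<lambda>\<gamma>. gavg x \<gamma> n f) \<in> borel_measurable (gauss_law N)" by (rule measurable_gibbs_avg'[OF f])
    show "AE \<gamma> in gauss_law N. gavg x \<gamma> (Suc n) (\<lambda>z. f (restrict z {1..n}) * 1) = gavg x \<gamma> n f"
      using AE_good[OF x]
    proof eventually_elim
      case (elim \<gamma>)
      interpret T: prob_space "gibbs x \<gamma>" by (rule prob_space_gibbs[OF elim])
      have "gavg x \<gamma> (Suc n) (\<lambda>z. f (restrict z {1..n}) * 1)
        = gavg x \<gamma> n f * (\<integral>z. 1 \<partial>gibbs x \<gamma>)"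
        by (rule gibbs_avg_Suc[OF elim f fb, of "\<lambda>_. 1" 1]) auto
      then show ?case using T.prob_space by simp
    qed
  qed
  then show ?thesis
    using n unfolding gg_defect_def Suc_eq_plus1[symmetric]
    by (simp add: E_avg_const[OF x] of_nat_diff field_simps)
qed

text \<open>
  Linearity, applied to the monomials together with the remainder of the approximation.
\<close>

lemma gg_defect_approx:
  assumes x: "x \<in> coef_box" and n: "1 \<le> n"
    and f: "f \<in> borel_measurable (replicas n)" and fb: "\<And>z. z \<in> space (replicas n) \<Longrightarrow> \<bar>f z\<bar> \<le> 1"
    and \<psi>: "\<psi> \<in> borel_measurable borel" and \<epsilon>: "\<And>t. \<bar>t\<bar> \<le> 1 \<Longrightarrow> \<bar>\<psi> t - (\<Sum>i\<le>d. a i * t ^ i)\<bar> \<le> \<epsilon>"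
  shows "\<bar>gg_defect n f \<psi> x\<bar> \<le> 3 * \<epsilon> + (\<Sum>i\<in>{1..d}. \<bar>a i\<bar> * \<bar>gg_defect n f (\<lambda>t. t ^ i) x\<bar>)"
proof -
  let ?r = "\<lambda>t. \<psi> t - (\<Sum>i\<le>d. a i * t ^ i)"
  \<comment> \<open>The remainder takes the place of degree \<open>d + 1\<close>.\<close>
  define k where "k i = (if i \<le> d then (\<lambda>t. t ^ i) else ?r)" for i
  define c where "c i = (if i \<le> d then a i else 1)" for i
  have \<epsilon>0: "0 \<le> \<epsilon>" using \<epsilon>[of 0] by simp
  have "\<psi> = (\<lambda>t. \<Sum>i\<le>Suc d. c i * k i t)"
    by (rule ext) (simp add: c_def k_def)
  moreover have "gg_defect n f (\<lambda>t. \<Sum>i\<le>Suc d. c i * k i t) x = (\<Sum>i\<le>Suc d. c i * gg_defect n f (k i) x)"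
  proof (rule gg_defect_sum[OF x n f fb])
    have r: "?r \<in> borel_measurable borel" using \<psi> by measurable
    then show "k i \<in> borel_measurable borel" for i unfolding k_def by simp
    show "\<bar>k i t\<bar> \<le> 1 + \<epsilon>" if "\<bar>t\<bar> \<le> 1" for i t
      using \<epsilon>[OF that] \<epsilon>0 power_le_one[of "\<bar>t\<bar>" i] that by (auto simp: k_def power_abs)
  qed auto
  ultimately have "gg_defect n f \<psi> x = (\<Sum>i\<le>d. a i * gg_defect n f (\<lambda>t. t ^ i) x) + gg_defect n f ?r x"
    by (simp add: c_def k_def)
  also have "(\<Sum>i\<le>d. a i * gg_defect n f (\<lambda>t. t ^ i) x) = (\<Sum>i\<in>{1..d}. a i * gg_defect n f (\<lambda>t. t ^ i) x)"
  proof -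
    have "{..d} = insert 0 {1..d}" by auto
    then show ?thesis by (simp add: gg_defect_const[OF x n f fb])
  qed
  finally have "\<bar>gg_defect n f \<psi> x\<bar> \<le> \<bar>\<Sum>i\<in>{1..d}. a i * gg_defect n f (\<lambda>t. t ^ i) x\<bar> + \<bar>gg_defect n f ?r x\<bar>"
    by linarith
  moreover have "\<bar>gg_defect n f ?r x\<bar> \<le> 3 * \<epsilon>" by (rule gg_defect_le[OF x n fb \<epsilon>])
  moreover have "\<bar>\<Sum>i\<in>{1..d}. a i * gg_defect n f (\<lambda>t. t ^ i) x\<bar> \<le> (\<Sum>i\<in>{1..d}. \<bar>a i * gg_defect n f (\<lambda>t. t ^ i) x\<bar>)"
    by (rule sum_abs)
  ultimately show ?thesis by (simp add: abs_mult)
qed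

text \<open>
  A pointwise majorant of the defect for \<open>t\<^sup>p\<close>. Integration by parts controls the defect multiplied by
  \<open>x\<^sub>p\<close> only; for \<open>x\<^sub>p < \<eta>\<close> the trivial bound \<open>3\<close> takes over.
\<close>

definition power_bound :: "nat \<Rightarrow> real \<Rightarrow> real \<Rightarrow> (nat \<Rightarrow> real) \<Rightarrow> real" where
  "power_bound p y \<eta> x = 3 * indicator {..<\<eta>} (x p) + 1 / (\<eta> * (v * (1/2) ^ p)\<^sup>2 * y) * (1 + 32 * pi * v + second_diff p y x)"

lemma gg_defect_power_le_bound:
  assumes x: "\<forall>p\<ge>1. 0 \<le> x p \<and> x p \<le> 1" and p: "1 \<le> p" and n: "1 \<le> n" and v: "0 < v" and y: "0 < y" "y \<le> 1" and \<eta>: "0 < \<eta>"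
    and f: "f \<in> borel_measurable (replicas n)" and fb: "\<And>z. z \<in> space (replicas n) \<Longrightarrow> \<bar>f z\<bar> \<le> 1"
  shows "\<bar>gg_defect n f (\<lambda>t. t ^ p) x\<bar> \<le> power_bound p y \<eta> x"
proof -
  let ?s = "v * (1/2) ^ p" and ?g = "\<bar>gg_defect n f (\<lambda>t. t ^ p) x\<bar>" and ?W = "1 + 32 * pi * v + second_diff p y x"
  have s: "0 < ?s" using v by simp
  have xp: "0 \<le> x p" "x p \<le> 1" using x p by auto
  have xb: "x \<in> coef_box" by (rule unit_in_coef_box[OF x])
  have "x(p := x p + y) \<in> coef_box" "x(p := x p - y) \<in> coef_box"
    using y xp by (auto intro!: unit_upd_in_coef_box[OF x])
  from gp_dev_le[OF xb this p] have W: "?s * y * gp_dev x p \<le> ?W"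
    using y by (simp add: second_diff_def)
  have d: "?s * x p * ?g \<le> gp_dev x p" by (rule gg_defect_power_le[OF xb xp(1) p n f fb])
  have "?s * y * (?s * x p * ?g) \<le> ?s * y * gp_dev x p"
    using s y by (intro mult_left_mono d) simp
  with W have gW: "?s * y * (?s * x p * ?g) \<le> ?W" by linarith
  have "0 \<le> ?s * y * (?s * x p * ?g)" using s y xp by simp
  with gW have W0: "0 \<le> ?W" by linarith
  have Q: "0 < \<eta> * ?s\<^sup>2 * y" by (intro mult_pos_pos zero_less_power \<eta> s y)
  show ?thesis
  proof (cases "x p < \<eta>")
    case True
    have "?g \<le> 3 * 1"
      by (rule gg_defect_le[OF xb n fb]) (simp_all add: power_abs power_le_one)
    moreover have "0 \<le> 1 / (\<eta> * ?s\<^sup>2 * y) * ?W" using W0 Q by simp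
    ultimately show ?thesis using True by (simp add: power_bound_def)
  next
    case False
    have "(\<eta> * ?s\<^sup>2 * y) * ?g \<le> (x p * ?s\<^sup>2 * y) * ?g"
      using False y s by (intro mult_right_mono) auto
    also have "\<dots> = ?s * y * (?s * x p * ?g)" by (simp add: power2_eq_square mult_ac)
    also have "\<dots> \<le> ?W" by (rule gW)
    finally have "?g \<le> ?W / (\<eta> * ?s\<^sup>2 * y)" using Q by (simp add: pos_le_divide_eq mult.commute)
    then show ?thesis using False by (simp add: power_bound_def)
  qed
qed

lemma integral_power_bound:
  assumes p: "1 \<le> p" and v: "0 < v" and y: "0 < y" "y \<le> 1" and \<eta>: "0 < \<eta>"
  shows "integrable uniform_law (power_bound p y \<eta>)"
    and "(\<integral>x. power_bound p y \<eta> x \<partial>uniform_law) \<le> 3 * \<eta> + 1 / (\<eta> * (v * (1/2) ^ p)\<^sup>2 * y) * (1 + 32 * pi * v + 16 * (v * (1/2) ^ p)\<^sup>2 * y\<^sup>2)"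
proof -
  interpret X: prob_space uniform_law by (rule prob_space_uniform_law)
  let ?s = "v * (1/2) ^ p"
  let ?q = "1 / (\<eta> * ?s\<^sup>2 * y)"
  have q: "0 \<le> ?q" using \<eta> y v by simp
  note [measurable] = measurable_uniform_law_component[OF p]
  have i1: "integrable uniform_law (\<lambda>x. indicator {..<\<eta>} (x p) :: real)"
    by (rule X.integrable_const_bound[where B=1]) (auto simp: indicator_def)
  have i2: "integrable uniform_law (\<lambda>x. 1 + 32 * pi * v + second_diff p y x)"
    using integrable_second_diff[OF p y] by simp
  show "integrable uniform_law (power_bound p y \<eta>)"
    unfolding power_bound_def[abs_def] by (intro Bochner_Integration.integrable_add integrable_mult_right i1 i2)
  have I1: "(\<integral>x. indicator {..<\<eta>} (x p) \<partial>uniform_law) \<le> \<eta>"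
  proof -
    have "(\<integral>x. (indicator {..<\<eta>} (x p) :: real) \<partial>uniform_law) = (\<integral>t. indicator {..<\<eta>} t \<partial>unif1)"
      unfolding uniform_law_def by (rule PiM_integral_component[OF prob_space_unif1]) (rule borel_measurable_indicator, use p in auto)
    also have "\<dots> = (\<integral>t. indicator {0..1} t *\<^sub>R indicator {..<\<eta>} t \<partial>lborel)"
      by (rule integral_unif1) measurable
    also have "\<dots> \<le> (\<integral>t. indicator {0..\<eta>} t \<partial>lborel)"
    proof (rule integral_mono')
      show "integrable lborel (\<lambda>t. indicator {0..\<eta>} t :: real)"
        by (intro integrable_real_indicator) (auto simp: emeasure_lborel_Icc_eq)
    qed (auto simp: indicator_def)
    also have "\<dots> = \<eta>" using \<eta> by simp
    finally show ?thesis .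
  qed
  have "(\<integral>x. power_bound p y \<eta> x \<partial>uniform_law) = 3 * (\<integral>x. indicator {..<\<eta>} (x p) \<partial>uniform_law) + ?q * (\<integral>x. 1 + 32 * pi * v + second_diff p y x \<partial>uniform_law)"
    unfolding power_bound_def using i1 i2 by (subst Bochner_Integration.integral_add) auto
  also have "(\<integral>x. 1 + 32 * pi * v + second_diff p y x \<partial>uniform_law) = 1 + 32 * pi * v + (\<integral>x. second_diff p y x \<partial>uniform_law)"
    using integrable_second_diff[OF p y] X.prob_space by simp
  also have "3 * (\<integral>x. indicator {..<\<eta>} (x p) \<partial>uniform_law) + ?q * (1 + 32 * pi * v + (\<integral>x. second_diff p y x \<partial>uniform_law))
     \<le> 3 * \<eta> + ?q * (1 + 32 * pi * v + 16 * ?s\<^sup>2 * y\<^sup>2)"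
    using I1 integral_second_diff_le[OF p y] q by (intro add_mono mult_left_mono) auto
  finally show "(\<integral>x. power_bound p y \<eta> x \<partial>uniform_law) \<le> 3 * \<eta> + ?q * (1 + 32 * pi * v + 16 * ?s\<^sup>2 * y\<^sup>2)" .
qed

text \<open>
  The choice \<open>y = v powr (-1/2)\<close> balances the fluctuation term \<open>1 / (v y)\<close> against \<open>y\<close>, and the cutoff
  \<open>\<eta> = v powr (-1/4)\<close> balances \<open>\<eta>\<close> against \<open>v powr (-1/2) / \<eta>\<close>.
\<close>

lemma integral_power_bound_rate:
  assumes p: "1 \<le> p" and v: "1 \<le> v"
  shows "(\<integral>x. power_bound p (1 / sqrt v) (1 / sqrt (sqrt v)) x \<partial>uniform_law) \<le> (3 + 4 ^ p * (1 + 32 * pi) + 16) / sqrt (sqrt v)"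
proof -
  \<comment> \<open>In terms of \<open>w\<close> all quantities are integral powers.\<close>
  define w where "w = sqrt (sqrt v)"
  have w: "1 \<le> w" using v by (simp add: w_def)
  have w2: "sqrt v = w\<^sup>2" using v by (simp add: w_def)
  have w4: "v = w ^ 4"
  proof -
    have "w ^ 4 = (w\<^sup>2)\<^sup>2" by (simp add: power_mult[symmetric])
    then show ?thesis using v by (simp add: w2[symmetric])
  qed
  let ?s = "v * (1/2) ^ p" and ?y = "1 / w\<^sup>2"
  have y: "0 < ?y" "?y \<le> 1" using w by (auto simp: divide_le_eq)
  have s2: "?s\<^sup>2 = w ^ 8 / 4 ^ p"
    unfolding w4 by (simp add: power_mult_distrib power_divide power_mult[symmetric] mult.commute[of p] power_mult)
  have "(\<integral>x. power_bound p ?y (1 / w) x \<partial>uniform_law) \<le> 3 * (1 / w) + 1 / (1 / w * ?s\<^sup>2 * ?y) * (1 + 32 * pi * v + 16 * ?s\<^sup>2 * ?y\<^sup>2)"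
    using v w y by (intro integral_power_bound(2) p) auto
  also have "1 / (1 / w * ?s\<^sup>2 * ?y) * (1 + 32 * pi * v + 16 * ?s\<^sup>2 * ?y\<^sup>2) = 4 ^ p * (1 + 32 * pi * v) / w ^ 5 + 16 / w"
    unfolding s2 using w by (simp add: field_simps power_numeral_reduce)
  also have "4 ^ p * (1 + 32 * pi * v) / w ^ 5 \<le> 4 ^ p * ((1 + 32 * pi) * v) / w ^ 5"
    using v w by (intro divide_right_mono mult_left_mono) (auto simp: algebra_simps)
  also have "4 ^ p * ((1 + 32 * pi) * v) / w ^ 5 = 4 ^ p * (1 + 32 * pi) / w"
    unfolding w4 using w by (simp add: field_simps power_numeral_reduce)
  finally have "(\<integral>x. power_bound p ?y (1 / w) x \<partial>uniform_law) \<le> (3 + 4 ^ p * (1 + 32 * pi) + 16) / w"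
    by (simp add: add_divide_distrib)
  then show ?thesis unfolding w2[symmetric] unfolding w_def .
qed

lemma integral_gg_defect_le:
  assumes n: "1 \<le> n" and v: "1 \<le> v"
    and f: "f \<in> borel_measurable (replicas n)" and fb: "\<And>z. z \<in> space (replicas n) \<Longrightarrow> \<bar>f z\<bar> \<le> 1"
    and \<psi>: "\<psi> \<in> borel_measurable borel" and \<epsilon>: "\<And>t. \<bar>t\<bar> \<le> 1 \<Longrightarrow> \<bar>\<psi> t - (\<Sum>i\<le>d. a i * t ^ i)\<bar> \<le> \<epsilon>"
  shows "(\<integral>x. \<bar>gg_defect n f \<psi> x\<bar> \<partial>uniform_law) \<le> 3 * \<epsilon> + (\<Sum>i\<in>{1..d}. \<bar>a i\<bar> * (19 + 4 ^ i * (1 + 32 * pi))) / sqrt (sqrt v)"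
proof -
  interpret X: prob_space uniform_law by (rule prob_space_uniform_law)
  let ?y = "1 / sqrt v" and ?\<eta> = "1 / sqrt (sqrt v)"
  have v0: "0 < v" using v by simp
  have y: "0 < ?y" "?y \<le> 1" "0 < ?\<eta>" using v by auto
  let ?B = "\<lambda>x. 3 * \<epsilon> + (\<Sum>i\<in>{1..d}. \<bar>a i\<bar> * power_bound i ?y ?\<eta> x)"
  have i: "integrable uniform_law (\<lambda>x. \<bar>a i\<bar> * power_bound i ?y ?\<eta> x)" if "i \<in> {1..d}" for i
    using that by (intro integrable_mult_right integral_power_bound(1) v0 y) auto
  have iB: "integrable uniform_law ?B"
    by (intro Bochner_Integration.integrable_add X.integrable_const Bochner_Integration.integrable_sum i)
  have le: "AE x in uniform_law. \<bar>gg_defect n f \<psi> x\<bar> \<le> ?B x"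
    using AE_uniform_law_unit
  proof eventually_elim
    case (elim x)
    have "\<bar>gg_defect n f \<psi> x\<bar> \<le> 3 * \<epsilon> + (\<Sum>i\<in>{1..d}. \<bar>a i\<bar> * \<bar>gg_defect n f (\<lambda>t. t ^ i) x\<bar>)"
      by (rule gg_defect_approx[OF unit_in_coef_box[OF elim] n f fb \<psi> \<epsilon>])
    also have "\<dots> \<le> ?B x"
      by (intro add_left_mono sum_mono mult_left_mono gg_defect_power_le_bound[OF elim _ n v0 y f fb]) auto
    finally show ?case .
  qed
  have "(\<integral>x. \<bar>gg_defect n f \<psi> x\<bar> \<partial>uniform_law) \<le> (\<integral>x. ?B x \<partial>uniform_law)"
  proof (rule integral_mono_AE'[OF iB le])
    show "AE x in uniform_law. 0 \<le> ?B x" using le by eventually_elim (rule order_trans[OF abs_ge_zero])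
  qed
  also have "\<dots> = 3 * \<epsilon> + (\<Sum>i\<in>{1..d}. \<bar>a i\<bar> * (\<integral>x. power_bound i ?y ?\<eta> x \<partial>uniform_law))"
  proof -
    have "(\<integral>x. ?B x \<partial>uniform_law) = (\<integral>x. 3 * \<epsilon> \<partial>uniform_law) + (\<integral>x. (\<Sum>i\<in>{1..d}. \<bar>a i\<bar> * power_bound i ?y ?\<eta> x) \<partial>uniform_law)"
      by (intro Bochner_Integration.integral_add X.integrable_const Bochner_Integration.integrable_sum i)
    also have "(\<integral>x. (\<Sum>i\<in>{1..d}. \<bar>a i\<bar> * power_bound i ?y ?\<eta> x) \<partial>uniform_law)
        = (\<Sum>i\<in>{1..d}. \<integral>x. \<bar>a i\<bar> * power_bound i ?y ?\<eta> x \<partial>uniform_law)"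
      by (rule Bochner_Integration.integral_sum[OF i])
    finally show ?thesis using X.prob_space by simp
  qed
  also have "\<dots> \<le> 3 * \<epsilon> + (\<Sum>i\<in>{1..d}. \<bar>a i\<bar> * ((3 + 4 ^ i * (1 + 32 * pi) + 16) / sqrt (sqrt v)))"
    by (intro add_left_mono sum_mono mult_left_mono integral_power_bound_rate v) auto
  also have "\<dots> = 3 * \<epsilon> + (\<Sum>i\<in>{1..d}. \<bar>a i\<bar> * (19 + 4 ^ i * (1 + 32 * pi))) / sqrt (sqrt v)"
    by (simp add: sum_divide_distrib algebra_simps)
  finally show ?thesis .
qed

lemma integral_gg_defect_bounded:
  assumes n: "1 \<le> n" and fb: "\<And>z. z \<in> space (replicas n) \<Longrightarrow> \<bar>f z\<bar> \<le> 1"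
    and \<psi>: "\<And>t. \<bar>t\<bar> \<le> 1 \<Longrightarrow> \<bar>\<psi> t\<bar> \<le> K"
  shows "(\<integral>x. \<bar>gg_defect n f \<psi> x\<bar> \<partial>uniform_law) \<le> 3 * K"
proof -
  interpret X: prob_space uniform_law by (rule prob_space_uniform_law)
  have le: "AE x in uniform_law. \<bar>gg_defect n f \<psi> x\<bar> \<le> 3 * K"
    using AE_uniform_law_unit by eventually_elim (rule gg_defect_le[OF unit_in_coef_box n fb \<psi>])
  have "0 \<le> K" using \<psi>[of 0] by simp
  then have "(\<integral>x. \<bar>gg_defect n f \<psi> x\<bar> \<partial>uniform_law) \<le> (\<integral>x. 3 * K \<partial>uniform_law)"
    by (intro integral_mono_AE' le) auto
  then show ?thesis using X.prob_space by simp
qed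

end

section \<open>Passage to a uniform rate\<close>

text \<open>
  The rate is the supremum of \<open>T b v\<close> over all admissible \<open>b\<close>, which is finite by the uniform bound.
  The point \<open>0\<close> is adjoined so that the supremum is taken over a nonempty set and is nonnegative.
\<close>

lemma uniform_rate_exists:
  fixes T :: "'b \<Rightarrow> real \<Rightarrow> real"
  assumes b: "\<And>b v. Q b v \<Longrightarrow> 0 \<le> T b v \<and> T b v \<le> K"
    and e: "\<And>e. 0 < e \<Longrightarrow> \<exists>V. \<forall>v\<ge>V. \<forall>b. Q b v \<longrightarrow> T b v \<le> e"
  shows "\<exists>\<delta>. (\<delta> \<longlongrightarrow> 0) at_top \<and> (\<forall>b v. Q b v \<longrightarrow> T b v \<le> \<delta> v)"
proof (intro exI conjI allI impI)
  define \<delta> where "\<delta> v = Sup (insert 0 {T b v |b. Q b v})" for v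
  have bdd: "bdd_above (insert 0 {T b v |b. Q b v})" for v
    using b by (intro bdd_aboveI[of _ "max 0 K"]) fastforce
  show "T b v \<le> \<delta> v" if "Q b v" for b v
    unfolding \<delta>_def using that bdd by (intro cSup_upper) auto
  have \<delta>0: "0 \<le> \<delta> v" for v unfolding \<delta>_def using bdd by (intro cSup_upper) auto
  show "(\<delta> \<longlongrightarrow> 0) at_top"
  proof (rule tendstoI)
    fix r :: real assume r: "0 < r"
    obtain V where V: "\<forall>v\<ge>V. \<forall>b. Q b v \<longrightarrow> T b v \<le> r / 2" using e[of "r / 2"] r by auto
    have "\<delta> v \<le> r / 2" if "V \<le> v" for v
      unfolding \<delta>_def using V that r by (intro cSup_least) auto
    then have "dist (\<delta> v) 0 < r" if "V \<le> v" for v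
      using \<delta>0[of v] that r by (fastforce simp: dist_real_def)
    then show "\<forall>\<^sub>F v in at_top. dist (\<delta> v) 0 < r"
      by (auto simp: eventually_at_top_linorder)
  qed
qed

text \<open>
  Only the values on \<open>[-1, 1]\<close> enter, since overlaps lie there; an extension to the whole line is Borel
  measurable.
\<close>

lemma continuous_clamp_exists:
  fixes \<psi> :: "real \<Rightarrow> real"
  assumes "continuous_on {-1..1} \<psi>"
  shows "\<exists>\<psi>'. continuous_on UNIV \<psi>' \<and> (\<forall>t\<in>{-1..1}. \<psi>' t = \<psi> t)"
proof (intro exI conjI ballI)
  let ?\<psi>' = "\<lambda>t. \<psi> (max (-1) (min 1 t))"
  show "continuous_on UNIV ?\<psi>'"
    by (rule continuous_on_compose2[OF assms]) (auto intro!: continuous_intros)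
  fix t :: real assume "t \<in> {-1..1}"
  then have "max (-1) (min 1 t) = t" by auto
  then show "?\<psi>' t = \<psi> t" by simp
qed

lemma polynomial_approximation:
  fixes \<psi> :: "real \<Rightarrow> real"
  assumes "continuous_on {-1..1} \<psi>" "0 < \<epsilon>"
  obtains a d where "\<And>t. \<bar>t\<bar> \<le> 1 \<Longrightarrow> \<bar>\<psi> t - (\<Sum>i\<le>d. a i * t ^ i)\<bar> \<le> \<epsilon>"
proof -
  obtain g where g: "real_polynomial_function g" "\<And>t. t \<in> {-1..1} \<Longrightarrow> \<bar>\<psi> t - g t\<bar> < \<epsilon>"
    using Stone_Weierstrass_real_polynomial_function[OF _ assms] by (metis compact_Icc)
  from g(1) obtain a d where "g = (\<lambda>t. \<Sum>i\<le>d. a i * t ^ i)"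
    unfolding real_polynomial_function_iff_sum by blast
  with g(2) show ?thesis by (intro that[of a d]) (fastforce simp: abs_le_iff intro: less_imp_le)
qed

theorem theorem2:
  fixes n :: nat and \<psi> :: "real \<Rightarrow> real"
  assumes "n \<ge> 1" and "continuous_on {-1..1} \<psi>"
  shows "\<exists>\<delta> :: real \<Rightarrow> real. (\<delta> \<longlongrightarrow> 0) at_top \<and>
    (\<forall>(N :: nat) (\<nu> :: (nat \<Rightarrow> real) measure) (f :: (nat \<Rightarrow> nat \<Rightarrow> real) \<Rightarrow> real) (v :: real).
      N \<ge> 1 \<longrightarrow>
      prob_space \<nu> \<longrightarrow> sets \<nu> = sets (sphere_borel N) \<longrightarrow>
      f \<in> borel_measurable (\<Pi>\<^sub>M l\<in>{1..n}. sphere_borel N) \<longrightarrow>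
      (\<forall>z \<in> {1..n} \<rightarrow>\<^sub>E unit_sphere N. \<bar>f z\<bar> \<le> 1) \<longrightarrow>
      v \<ge> 0 \<longrightarrow>
      (AE x in uniform_law. AE \<gamma> in gauss_law N. integrable \<nu> (\<lambda>z. exp (gfun N v x \<gamma> z))) \<longrightarrow>
      (\<integral>x. \<bar>E_avg N v \<nu> x (n + 1) (\<lambda>z. f (restrict z {1..n}) * \<psi> (dot N (z 1) (z (n + 1))))
            - 1 / real n * E_avg N v \<nu> x n f * E_avg N v \<nu> x 2 (\<lambda>z. \<psi> (dot N (z 1) (z 2)))
            - 1 / real n * (\<Sum>l=2..n. E_avg N v \<nu> x n (\<lambda>z. f z * \<psi> (dot N (z 1) (z l))))\<bar>
        \<partial>uniform_law) \<le> \<delta> v)"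
proof -
  \<comment> \<open>The data over which the rate has to be uniform are collected in one tuple.\<close>
  define T where "T = (\<lambda>(N, \<nu>, f) v. \<integral>x. \<bar>sphere_field.gg_defect N \<nu> v n f \<psi> x\<bar> \<partial>uniform_law)"
  define Q where "Q = (\<lambda>(N, \<nu>, f) v. sphere_field N \<nu> v \<and> f \<in> borel_measurable (PiM {1..n} (\<lambda>_. \<nu>))
      \<and> (\<forall>z \<in> {1..n} \<rightarrow>\<^sub>E unit_sphere N. \<bar>f z\<bar> \<le> (1::real)))"
  obtain \<psi>' where \<psi>'c: "continuous_on UNIV \<psi>'" and \<psi>': "\<And>t. t \<in> {-1..1} \<Longrightarrow> \<psi>' t = \<psi> t"
    using continuous_clamp_exists[OF assms(2)] by blast
  obtain K where K: "\<And>t. \<bar>t\<bar> \<le> 1 \<Longrightarrow> \<bar>\<psi>' t\<bar> \<le> K"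
  proof -
    have "compact (\<psi>' ` {-1..1})"
      by (intro compact_continuous_image continuous_on_subset[OF \<psi>'c]) auto
    then obtain K where "\<forall>y\<in>\<psi>' ` {-1..1}. norm y \<le> K" using compact_imp_bounded bounded_iff by metis
    then show ?thesis by (intro that[of K]) (auto simp: abs_le_iff)
  qed
  have \<psi>'m: "\<psi>' \<in> borel_measurable borel" using \<psi>'c by (rule borel_measurable_continuous_onI)
  have eq: "sphere_field.gg_defect N \<nu> v n f \<psi> x = sphere_field.gg_defect N \<nu> v n f \<psi>' x"
    if "sphere_field N \<nu> v" for N \<nu> v f x
  proof -
    interpret sphere_field N \<nu> v by fact
    have *: "\<psi> (dot N (z i) (z j)) = \<psi>' (dot N (z i) (z j))"
      if "z \<in> space (replicas m)" "i \<in> {1..m}" "j \<in> {1..m}" for z i j m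
      using abs_dot_replica_le[OF that] \<psi>'[of "dot N (z i) (z j)"] by (auto simp: abs_le_iff)
    have "E_avg N v \<nu> x (n + 1) (\<lambda>z. f (restrict z {1..n}) * \<psi> (dot N (z 1) (z (n + 1))))
        = E_avg N v \<nu> x (n + 1) (\<lambda>z. f (restrict z {1..n}) * \<psi>' (dot N (z 1) (z (n + 1))))"
      by (rule E_avg_cong) (simp add: *)
    moreover have "E_avg N v \<nu> x 2 (\<lambda>z. \<psi> (dot N (z 1) (z 2))) = E_avg N v \<nu> x 2 (\<lambda>z. \<psi>' (dot N (z 1) (z 2)))"
      by (rule E_avg_cong) (simp add: *)
    moreover have "(\<Sum>l=2..n. E_avg N v \<nu> x n (\<lambda>z. f z * \<psi> (dot N (z 1) (z l))))
        = (\<Sum>l=2..n. E_avg N v \<nu> x n (\<lambda>z. f z * \<psi>' (dot N (z 1) (z l))))"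
      by (intro sum.cong refl E_avg_cong) (simp add: *)
    ultimately show ?thesis unfolding gg_defect_def by simp
  qed
  have "\<exists>\<delta>. (\<delta> \<longlongrightarrow> 0) at_top \<and> (\<forall>b v. Q b v \<longrightarrow> T b v \<le> \<delta> v)"
  proof (rule uniform_rate_exists)
    fix b v assume Qb: "Q b v"
    obtain N \<nu> f where b: "b = (N, \<nu>, f)" by (cases b)
    interpret sphere_field N \<nu> v using Qb by (simp add: Q_def b)
    have "(\<integral>x. \<bar>gg_defect n f \<psi>' x\<bar> \<partial>uniform_law) \<le> 3 * K"
      using Qb by (intro integral_gg_defect_bounded assms(1) K) (auto simp: Q_def b space_replicas)
    then show "0 \<le> T b v \<and> T b v \<le> 3 * K"
      by (simp add: T_def b eq[OF sphere_field_axioms])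
  next
    fix e :: real assume e: "0 < e"
    have "continuous_on {-1..1} \<psi>'" by (rule continuous_on_subset[OF \<psi>'c]) simp
    then obtain a d where ad: "\<And>t. \<bar>t\<bar> \<le> 1 \<Longrightarrow> \<bar>\<psi>' t - (\<Sum>i\<le>d. a i * t ^ i)\<bar> \<le> e / 6"
      by (rule polynomial_approximation[of \<psi>' "e / 6"]) (use e in auto)
    define D where "D = (\<Sum>i\<in>{1..d}. \<bar>a i\<bar> * (19 + 4 ^ i * (1 + 32 * pi)))"
    have "((\<lambda>v. D / sqrt (sqrt v)) \<longlongrightarrow> 0) at_top"
      by (intro real_tendsto_divide_at_top[OF tendsto_const] filterlim_compose[OF sqrt_at_top sqrt_at_top])
    then have "\<forall>\<^sub>F v in at_top. D / sqrt (sqrt v) < e / 2"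
      by (rule order_tendstoD) (use e in simp)
    then obtain V where V: "\<And>v. V \<le> v \<Longrightarrow> D / sqrt (sqrt v) < e / 2"
      by (auto simp: eventually_at_top_linorder)
    have "T b v \<le> e" if v: "max 1 V \<le> v" and Qb: "Q b v" for b v
    proof -
      obtain N \<nu> f where b: "b = (N, \<nu>, f)" by (cases b)
      interpret sphere_field N \<nu> v using Qb by (simp add: Q_def b)
      have "(\<integral>x. \<bar>gg_defect n f \<psi>' x\<bar> \<partial>uniform_law) \<le> 3 * (e / 6) + D / sqrt (sqrt v)"
        unfolding D_def using Qb v
        by (intro integral_gg_defect_le assms(1) \<psi>'m ad) (auto simp: Q_def b space_replicas)
      moreover have "D / sqrt (sqrt v) < e / 2" using V v by simp
      ultimately have "(\<integral>x. \<bar>gg_defect n f \<psi>' x\<bar> \<partial>uniform_law) \<le> e" by linarith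
      then show ?thesis by (simp add: T_def b eq[OF sphere_field_axioms])
    qed
    then show "\<exists>V. \<forall>v\<ge>V. \<forall>b. Q b v \<longrightarrow> T b v \<le> e" by blast
  qed
  then obtain \<delta> where \<delta>: "(\<delta> \<longlongrightarrow> 0) at_top" "\<And>b v. Q b v \<Longrightarrow> T b v \<le> \<delta> v" by blast
  show ?thesis
  proof (rule exI[of _ \<delta>], rule conjI[OF \<delta>(1)], intro allI impI)
    fix N :: nat and \<nu> :: "(nat \<Rightarrow> real) measure" and f :: "(nat \<Rightarrow> nat \<Rightarrow> real) \<Rightarrow> real" and v :: real
    assume h: "prob_space \<nu>" "sets \<nu> = sets (sphere_borel N)" "f \<in> borel_measurable (\<Pi>\<^sub>M l\<in>{1..n}. sphere_borel N)"
      "\<forall>z \<in> {1..n} \<rightarrow>\<^sub>E unit_sphere N. \<bar>f z\<bar> \<le> 1" "v \<ge> 0"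
    interpret sphere_field N \<nu> v by (rule sphere_field.intro) (rule h)+
    have sets_r: "sets (PiM {1..n} (\<lambda>_. \<nu>)) = sets (\<Pi>\<^sub>M l\<in>{1..n}. sphere_borel N)"
      by (intro sets_PiM_cong refl h(2))
    then have "f \<in> borel_measurable (PiM {1..n} (\<lambda>_. \<nu>))" by (subst measurable_cong_sets[OF sets_r refl]) (rule h(3))
    then have "Q (N, \<nu>, f) v" unfolding Q_def prod.case using h(4) sphere_field_axioms by blast
    from \<delta>(2)[OF this] show "(\<integral>x. \<bar>E_avg N v \<nu> x (n + 1) (\<lambda>z. f (restrict z {1..n}) * \<psi> (dot N (z 1) (z (n + 1))))
            - 1 / real n * E_avg N v \<nu> x n f * E_avg N v \<nu> x 2 (\<lambda>z. \<psi> (dot N (z 1) (z 2)))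
            - 1 / real n * (\<Sum>l=2..n. E_avg N v \<nu> x n (\<lambda>z. f z * \<psi> (dot N (z 1) (z l))))\<bar>
        \<partial>uniform_law) \<le> \<delta> v"
      unfolding T_def prod.case gg_defect_def .
  qed
qed

end
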